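(* Let $E$ and $F$ be complex Banach spaces, let $U$ be an open subset of $E$, let $p\in[1,\infty)$ and let $f\in\mathcal{H}^\infty(U,F)$. The following conditions are equivalent: (i) $f\colon U\to F$ has relatively $p$-compact range. (ii) There exist a closed subspace $M$ of $\ell_{p^*}$ (of $c_0$ instead of $\ell_{p^*}$ if $p=1$), a separable Banach space $G$, an operator $T\in\mathcal{K}_p(\ell_{p^*}/M,G)$, a mapping $g\in\mathcal{H}^\infty_{\mathcal{K}}(U,\ell_{p^*}/M)$ and an operator $S\in\mathcal{K}(G,F)$ such that $f=S\circ T\circ g$ (with $\ell_{p^*}/M$ replaced by $c_0/M$ if $p=1$). In this case, $k_p^{\mathcal{H}^\infty}(f)=\inf\{\|S\|\,k_p(T)\,\|g\|_\infty\}$, where the infimum is extended over all factorizations of $f$ as in (ii).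
   Context: All Banach spaces are complex. $B_X$ is the closed unit ball of $X$; $\mathcal{K}(X,Y)$ is the space of compact linear operators from $X$ to $Y$. $\mathcal{H}^\infty(U,F)$ is the Banach space of all bounded holomorphic mappings $f\colon U\to F$ with the supremum norm $\|\cdot\|_\infty$, and $\mathcal{H}^\infty_{\mathcal{K}}(U,F)$ is its subspace of those mappings with relatively compact range. For $1<p<\infty$ put $p^*=p/(p-1)$ and, for $(x_n)\in\ell_p(F)$ (absolutely $p$-summable sequences in $F$, with norm $\|(x_n)\|_p=(\sum_n\|x_n\|^p)^{1/p}$), $p\text{-}\mathrm{conv}(x_n)=\{\sum_{n=1}^\infty a_nx_n\colon (a_n)\in B_{\ell_{p^*}}\}$; for $p=1$ and $(x_n)\in\ell_1(F)$, $1\text{-}\mathrm{conv}(x_n)=\{\sum_{n=1}^\infty a_nx_n\colon (a_n)\in B_{c_0}\}$. A set $K\subseteq F$ is relatively $p$-compact if $K\subseteq p\text{-}\mathrm{conv}(x_n)$ for some $(x_n)\in\ell_p(F)$; then $m_p(K)$ is the infimum of $\|(x_n)\|_p$ over all such sequences. $\mathcal{K}_p(X,Y)$ is the space of $p$-compact operators, i.e. linear $T\colon X\to Y$ with $T(B_X)$ relatively $p$-compact in $Y$, with norm $k_p(T)=m_p(T(B_X))$. A holomorphic $f\colon U\to F$ has relatively $p$-compact range if $f(U)$ is relatively $p$-compact in $F$, and then $k_p^{\mathcal{H}^\infty}(f)=m_p(f(U))$. *)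

theory Defs
  imports
    "HOL-Analysis.Analysis"
    "HOL-Algebra.Module"
    "HOL-Algebra.AbelCoset"
    "HOL-Library.Equipollence"
begin

section \<open>Complex Banach spaces with explicit carriers\<close>

text \<open>
  The quotients \<open>\<ell>\<^sub>q / M\<close> depend on a variable subspace \<open>M\<close> and the space \<open>G\<close> is
  existentially quantified, so normed spaces are structures on a carrier set rather than types.
  They are modules over the field of complex numbers in the sense of \<open>HOL-Algebra\<close>, with a norm.
  The fields \<^const>\<open>mult\<close> and \<^const>\<open>one\<close> inherited from the record of modules play no role.
\<close>

definition complex_field :: "complex ring" where
  "complex_field =
     \<lparr>carrier = UNIV, mult = (*), one = 1, zero = 0, add = (+)\<rparr>"

record 'a cnspace = "(complex, 'a) module" +
  vnorm :: "'a \<Rightarrow> real"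

locale complex_normed_space = module complex_field V for V :: "'a cnspace" (structure) +
  assumes vnorm_eq_zero: "x \<in> carrier V \<Longrightarrow> vnorm V x = 0 \<Longrightarrow> x = \<zero>\<^bsub>V\<^esub>"
    and vnorm_smult: "x \<in> carrier V \<Longrightarrow> vnorm V (c \<odot>\<^bsub>V\<^esub> x) = cmod c * vnorm V x"
    and vnorm_triangle: "x \<in> carrier V \<Longrightarrow> y \<in> carrier V \<Longrightarrow>
      vnorm V (x \<oplus>\<^bsub>V\<^esub> y) \<le> vnorm V x + vnorm V y"

text \<open>The locale \<^locale>\<open>Metric_space\<close> requires symmetry and nonnegativity also off the carrier.\<close>

definition vdist :: "'a cnspace \<Rightarrow> 'a \<Rightarrow> 'a \<Rightarrow> real" where
  "vdist V x y = (if x \<in> carrier V \<and> y \<in> carrier V then vnorm V (x \<ominus>\<^bsub>V\<^esub> y) else 0)"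

definition vtopology :: "'a cnspace \<Rightarrow> 'a topology" where
  "vtopology V = Metric_space.mtopology (carrier V) (vdist V)"

locale complex_banach_space = complex_normed_space +
  assumes complete: "Metric_space.mcomplete (carrier V) (vdist V)"

lemma (in complex_normed_space) vnorm_zero: "vnorm V \<zero>\<^bsub>V\<^esub> = 0"
  using vnorm_smult[of "\<zero>\<^bsub>V\<^esub>" 0] smult_r_null[of 0] by (simp add: complex_field_def)

lemma (in complex_normed_space) vnorm_uminus:
  assumes x: "x \<in> carrier V"
  shows "vnorm V (\<ominus>\<^bsub>V\<^esub> x) = vnorm V x"
proof -
  have "\<ominus>\<^bsub>complex_field\<^esub> \<one>\<^bsub>complex_field\<^esub> \<in> carrier complex_field"
    by (simp add: complex_field_def)
  then have "\<ominus>\<^bsub>complex_field\<^esub> \<one>\<^bsub>complex_field\<^esub> = (- 1 :: complex)"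
    using R.r_neg[OF R.one_closed]
    by (simp add: complex_field_def add_eq_0_iff)
  moreover have "\<ominus>\<^bsub>V\<^esub> x = (\<ominus>\<^bsub>complex_field\<^esub> \<one>\<^bsub>complex_field\<^esub>) \<odot>\<^bsub>V\<^esub> x"
    using smult_l_minus[OF R.one_closed x] smult_one[OF x] by simp
  ultimately show ?thesis
    using vnorm_smult[OF x, of "- 1"] by simp
qed

lemma (in complex_normed_space) vnorm_nonneg:
  assumes x: "x \<in> carrier V"
  shows "0 \<le> vnorm V x"
  using vnorm_triangle[OF x M.a_inv_closed[OF x]] vnorm_uminus[OF x] vnorm_zero M.r_neg[OF x]
  by simp

lemma (in complex_normed_space) Metric_space_vdist: "Metric_space (carrier V) (vdist V)"
proof
  fix x y
  show "0 \<le> vdist V x y"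
    by (simp add: vdist_def vnorm_nonneg)
  show "vdist V x y = vdist V y x"
  proof (cases "x \<in> carrier V \<and> y \<in> carrier V")
    case True
    then have "\<ominus>\<^bsub>V\<^esub> (x \<ominus>\<^bsub>V\<^esub> y) = y \<ominus>\<^bsub>V\<^esub> x"
      by (simp add: a_minus_def M.minus_add M.a_comm)
    then show ?thesis
      using True vnorm_uminus[of "x \<ominus>\<^bsub>V\<^esub> y"] by (simp add: vdist_def)
  qed (auto simp: vdist_def)
next
  fix x y assume xy: "x \<in> carrier V" "y \<in> carrier V"
  then show "(vdist V x y = 0) = (x = y)"
    using vnorm_eq_zero[of "x \<ominus>\<^bsub>V\<^esub> y"] vnorm_zero
    by (auto simp: vdist_def M.r_neg a_minus_def dest: M.minus_equality[OF _ xy(2)])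
       (metis M.a_inv_closed M.minus_equality M.minus_minus)
next
  fix x y z assume xyz: "x \<in> carrier V" "y \<in> carrier V" "z \<in> carrier V"
  then have "(x \<ominus>\<^bsub>V\<^esub> y) \<oplus>\<^bsub>V\<^esub> (y \<ominus>\<^bsub>V\<^esub> z) = x \<ominus>\<^bsub>V\<^esub> z"
    by (simp add: a_minus_def M.a_assoc M.r_neg1)
  then show "vdist V x z \<le> vdist V x y + vdist V y z"
    using xyz vnorm_triangle[of "x \<ominus>\<^bsub>V\<^esub> y" "y \<ominus>\<^bsub>V\<^esub> z"] by (simp add: vdist_def)
qed

definition unit_ball :: "'a cnspace \<Rightarrow> 'a set" where
  "unit_ball V = {x \<in> carrier V. vnorm V x \<le> 1}"

definition relatively_compact :: "'a cnspace \<Rightarrow> 'a set \<Rightarrow> bool" where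
  "relatively_compact V K \<longleftrightarrow>
     K \<subseteq> carrier V \<and> compactin (vtopology V) (vtopology V closure_of K)"

definition closed_subspace :: "'a set \<Rightarrow> 'a cnspace \<Rightarrow> bool" where
  "closed_subspace M V \<longleftrightarrow> submodule M complex_field V \<and> closedin (vtopology V) M"

text \<open>
  In the scalar multiplication of the quotient, \<open>M\<close> is added so that multiplication by \<open>0\<close> yields
  the coset \<open>M\<close> and not \<open>{0}\<close>.
\<close>

definition quotient_space :: "'a cnspace \<Rightarrow> 'a set \<Rightarrow> 'a set cnspace" where
  "quotient_space V M =
     \<lparr>carrier = a_rcosets\<^bsub>V\<^esub> M, mult = undefined, one = undefined,
      zero = M, add = set_add V,
      smult = (\<lambda>c A. set_add V M ((\<lambda>a. c \<odot>\<^bsub>V\<^esub> a) ` A)),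
      vnorm = (\<lambda>A. Inf (vnorm V ` A))\<rparr>"

section \<open>Sequence spaces\<close>

definition complex_space :: "complex cnspace" where
  "complex_space =
     \<lparr>carrier = UNIV, mult = (*), one = 1, zero = 0, add = (+), smult = (*), vnorm = cmod\<rparr>"

definition lp_space :: "real \<Rightarrow> 'a cnspace \<Rightarrow> (nat \<Rightarrow> 'a) cnspace" where
  "lp_space p V =
     \<lparr>carrier = {x. range x \<subseteq> carrier V \<and> summable (\<lambda>n. vnorm V (x n) powr p)},
      mult = undefined, one = undefined,
      zero = (\<lambda>n. \<zero>\<^bsub>V\<^esub>), add = (\<lambda>x y n. x n \<oplus>\<^bsub>V\<^esub> y n),
      smult = (\<lambda>c x n. c \<odot>\<^bsub>V\<^esub> x n),
      vnorm = (\<lambda>x. (\<Sum>n. vnorm V (x n) powr p) powr (1 / p))\<rparr>"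

definition c0_space :: "(nat \<Rightarrow> complex) cnspace" where
  "c0_space =
     \<lparr>carrier = {a. a \<longlonglongrightarrow> 0}, mult = undefined, one = undefined,
      zero = (\<lambda>n. 0), add = (\<lambda>a b n. a n + b n), smult = (\<lambda>c a n. c * a n),
      vnorm = (\<lambda>a. SUP n. cmod (a n))\<rparr>"

text \<open>\<open>\<ell>\<^sub>q\<close> for the conjugate exponent \<open>q = p / (p - 1)\<close> if \<open>p > 1\<close>, and \<open>c\<^sub>0\<close> if \<open>p = 1\<close>.\<close>

definition conj_space :: "real \<Rightarrow> (nat \<Rightarrow> complex) cnspace" where
  "conj_space p = (if p = 1 then c0_space else lp_space (p / (p - 1)) complex_space)"

section \<open>Relatively p-compact sets and p-compact operators\<close>

definition p_conv :: "real \<Rightarrow> 'a cnspace \<Rightarrow> (nat \<Rightarrow> 'a) \<Rightarrow> 'a set" where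
  "p_conv p V x =
     {y. \<exists>a \<in> unit_ball (conj_space p).
           limitin (vtopology V) (\<lambda>N. finsum V (\<lambda>n. a n \<odot>\<^bsub>V\<^esub> x n) {..<N}) y sequentially}"

definition relatively_p_compact :: "real \<Rightarrow> 'a cnspace \<Rightarrow> 'a set \<Rightarrow> bool" where
  "relatively_p_compact p V K \<longleftrightarrow> (\<exists>x \<in> carrier (lp_space p V). K \<subseteq> p_conv p V x)"

definition m_p :: "real \<Rightarrow> 'a cnspace \<Rightarrow> 'a set \<Rightarrow> real" where
  "m_p p V K = Inf {vnorm (lp_space p V) x | x. x \<in> carrier (lp_space p V) \<and> K \<subseteq> p_conv p V x}"

definition linear_operator :: "'a cnspace \<Rightarrow> 'b cnspace \<Rightarrow> ('a \<Rightarrow> 'b) \<Rightarrow> bool" where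
  "linear_operator X Y T \<longleftrightarrow>
     T \<in> hom (add_monoid X) (add_monoid Y) \<and>
     (\<forall>c. \<forall>x \<in> carrier X. T (c \<odot>\<^bsub>X\<^esub> x) = c \<odot>\<^bsub>Y\<^esub> T x)"

definition bounded_operator :: "'a cnspace \<Rightarrow> 'b cnspace \<Rightarrow> ('a \<Rightarrow> 'b) \<Rightarrow> bool" where
  "bounded_operator X Y T \<longleftrightarrow>
     linear_operator X Y T \<and> (\<exists>C. \<forall>x \<in> carrier X. vnorm Y (T x) \<le> C * vnorm X x)"

definition operator_norm :: "'a cnspace \<Rightarrow> 'b cnspace \<Rightarrow> ('a \<Rightarrow> 'b) \<Rightarrow> real" where
  "operator_norm X Y T = (SUP x \<in> unit_ball X. vnorm Y (T x))"

definition compact_operator :: "'a cnspace \<Rightarrow> 'b cnspace \<Rightarrow> ('a \<Rightarrow> 'b) \<Rightarrow> bool" where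
  "compact_operator X Y T \<longleftrightarrow>
     linear_operator X Y T \<and> relatively_compact Y (T ` unit_ball X)"

definition p_compact_operator :: "real \<Rightarrow> 'a cnspace \<Rightarrow> 'b cnspace \<Rightarrow> ('a \<Rightarrow> 'b) \<Rightarrow> bool" where
  "p_compact_operator p X Y T \<longleftrightarrow>
     linear_operator X Y T \<and> relatively_p_compact p Y (T ` unit_ball X)"

definition k_p :: "real \<Rightarrow> 'a cnspace \<Rightarrow> 'b cnspace \<Rightarrow> ('a \<Rightarrow> 'b) \<Rightarrow> real" where
  "k_p p X Y T = m_p p Y (T ` unit_ball X)"

section \<open>Bounded holomorphic mappings\<close>

text \<open>
  Holomorphy on an open set is complex Frechet differentiability at each of its points. Mappings on
  \<open>U\<close> are total functions whose values outside \<open>U\<close> are irrelevant.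
\<close>

definition holomorphic_map :: "'a cnspace \<Rightarrow> 'a set \<Rightarrow> 'b cnspace \<Rightarrow> ('a \<Rightarrow> 'b) \<Rightarrow> bool" where
  "holomorphic_map X U Y f \<longleftrightarrow>
     f \<in> U \<rightarrow> carrier Y \<and>
     (\<forall>x \<in> U. \<exists>L. bounded_operator X Y L \<and>
        (\<forall>\<epsilon> > 0. \<exists>\<delta> > 0. \<forall>y \<in> U. vnorm X (y \<ominus>\<^bsub>X\<^esub> x) < \<delta> \<longrightarrow>
           vnorm Y (f y \<ominus>\<^bsub>Y\<^esub> f x \<ominus>\<^bsub>Y\<^esub> L (y \<ominus>\<^bsub>X\<^esub> x)) \<le> \<epsilon> * vnorm X (y \<ominus>\<^bsub>X\<^esub> x)))"

definition H_inf :: "'a cnspace \<Rightarrow> 'a set \<Rightarrow> 'b cnspace \<Rightarrow> ('a \<Rightarrow> 'b) set" where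
  "H_inf X U Y = {f. holomorphic_map X U Y f \<and> bdd_above ((\<lambda>x. vnorm Y (f x)) ` U)}"

definition H_inf_K :: "'a cnspace \<Rightarrow> 'a set \<Rightarrow> 'b cnspace \<Rightarrow> ('a \<Rightarrow> 'b) set" where
  "H_inf_K X U Y = {f \<in> H_inf X U Y. relatively_compact Y (f ` U)}"

text \<open>Inserting \<open>0\<close> only matters for empty \<open>U\<close>, where \<^term>\<open>Sup {} :: real\<close> is unspecified.\<close>

definition sup_norm :: "'a set \<Rightarrow> 'b cnspace \<Rightarrow> ('a \<Rightarrow> 'b) \<Rightarrow> real" where
  "sup_norm U Y f = Sup (insert 0 ((\<lambda>x. vnorm Y (f x)) ` U))"

definition k_p_H_inf :: "real \<Rightarrow> 'a set \<Rightarrow> 'b cnspace \<Rightarrow> ('a \<Rightarrow> 'b) \<Rightarrow> real" where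
  "k_p_H_inf p U Y f = m_p p Y (f ` U)"

definition p_compact_factorization ::
  "real \<Rightarrow> 'a cnspace \<Rightarrow> 'a set \<Rightarrow> 'b cnspace \<Rightarrow> ('a \<Rightarrow> 'b) \<Rightarrow>
   (nat \<Rightarrow> complex) set \<Rightarrow> 'g cnspace \<Rightarrow> ((nat \<Rightarrow> complex) set \<Rightarrow> 'g) \<Rightarrow>
   ('a \<Rightarrow> (nat \<Rightarrow> complex) set) \<Rightarrow> ('g \<Rightarrow> 'b) \<Rightarrow> bool" where
  "p_compact_factorization p E U F f M G T g S \<longleftrightarrow>
     closed_subspace M (conj_space p) \<and>
     complex_banach_space G \<and> separable_space (vtopology G) \<and>
     p_compact_operator p (quotient_space (conj_space p) M) G T \<and>
     g \<in> H_inf_K E U (quotient_space (conj_space p) M) \<and>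
     compact_operator G F S \<and>
     (\<forall>x \<in> U. f x = S (T (g x)))"

end

theory Submission
  imports Defs "HOL-Complex_Analysis.Complex_Analysis"
begin

text \<open>
  Suppose that \<open>f ` U\<close> lies in the \<open>p\<close>-convex hull of \<open>x\<close>. The norms \<open>\<sigma> n\<close> of the vectors \<open>x n\<close> form a
  sequence in \<open>\<ell>\<^sub>p\<close>, from which a null sequence \<open>\<beta>\<close> in \<open>(0, 1]\<close> can be split off twice at an arbitrarily
  small cost: \<open>\<sigma> n = \<beta> n * (\<beta> n * \<tau> n)\<close>, where the norm of \<open>\<tau>\<close> in \<open>\<ell>\<^sub>p\<close> hardly exceeds that of \<open>\<sigma>\<close>
  (\<open>lp_null_factor\<close>). With \<open>e n\<close> the normalized \<open>x n\<close> and \<open>\<Psi>\<close> the operator on \<open>\<ell>\<^sub>1\<close> that maps \<open>b\<close> to the sum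
  of all \<open>b n e n\<close>, each value of \<open>f\<close> is obtained from a vector in the unit ball of \<open>\<ell>\<^sub>q\<close> (\<open>c\<^sub>0\<close> if \<open>p = 1\<close>)
  by multiplying with \<open>\<beta>\<close>, then with \<open>\<tau>\<close>, which leads into \<open>\<ell>\<^sub>1\<close>, then again with \<open>\<beta>\<close>, and applying \<open>\<Psi>\<close>.
  The first step makes the range of \<open>g\<close> relatively compact, the second one makes \<open>T\<close> a \<open>p\<close>-compact
  operator of norm close to that of \<open>x\<close>, and the third one, together with \<open>\<Psi>\<close>, makes \<open>S\<close> compact of norm
  at most \<open>1\<close>. Dividing the sequence spaces by the kernels of the maps that lead from them to \<open>F\<close> makes
  \<open>g\<close> well defined: the operator \<open>J\<close> induced by \<open>S \<circ> T\<close> on \<open>\<ell>\<^sub>q / M\<close> is injective, and \<open>g\<close> is \<open>f\<close> followed by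
  the inverse of \<open>J\<close> (\<open>exists_factorization\<close>).

  The crucial point is that \<open>g\<close> is holomorphic although the inverse of \<open>J\<close> need not be bounded. The values
  of \<open>f\<close> stay in the image under \<open>J\<close> of a compact absolutely convex subset of the unit ball. Cauchy's
  estimates, applied to the compositions of \<open>f\<close> with complex lines and with functionals bounded by \<open>1\<close> on
  that image, and the bipolar theorem place the derivatives and the Taylor remainders of \<open>f\<close> in multiples
  of this image, where \<open>J\<close> can be inverted with control of the norm (\<open>holomorphic_lift\<close>). The bipolar
  theorem rests on a proof of the Hahn-Banach theorem for spaces with explicit carriers.

  Conversely, a continuous linear operator maps the \<open>p\<close>-convex hull of a sequence into that of the image
  sequence. Hence each factorization shows that \<open>f ` U\<close> is relatively \<open>p\<close>-compact, and the product of the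
  three norms bounds \<open>m_p\<close> of this set (\<open>factorization_imp_relatively_p_compact\<close>).

  The spaces \<open>\<ell>\<^sub>q\<close> and \<open>c\<^sub>0\<close> are treated together as solid spaces of scalar sequences with order continuous
  norm, and the separable space is realized inside the given type as a copy of a quotient of \<open>\<ell>\<^sub>1\<close>, which
  has at most continuum many points.
\<close>

section \<open>Complex normed spaces and linear operators\<close>

lemma complex_field_simps [simp]:
  "carrier complex_field = UNIV" "mult complex_field = (*)" "one complex_field = 1"
  "zero complex_field = 0" "add complex_field = (+)"
  by (simp_all add: complex_field_def)

lemma cring_complex_field: "cring complex_field"
proof (rule cringI)
  show "abelian_group complex_field"
  proof (rule abelian_groupI)
    fix x :: complex
    show "\<exists>y\<in>carrier complex_field. y \<oplus>\<^bsub>complex_field\<^esub> x = \<zero>\<^bsub>complex_field\<^esub>"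
      by (auto intro: exI[of _ "- x"])
  qed (auto simp: algebra_simps)
  show "comm_monoid complex_field"
    by (rule comm_monoidI) (auto simp: algebra_simps)
qed (auto simp: algebra_simps)

text \<open>
  The zero of the scalar field must annihilate vectors by assumption here: this is what supplies
  additive inverses, as the multiples by \<open>-1\<close>.
\<close>

lemma complex_normed_spaceI:
  assumes "\<zero>\<^bsub>V\<^esub> \<in> carrier V"
    and add: "\<And>x y. x \<in> carrier V \<Longrightarrow> y \<in> carrier V \<Longrightarrow> x \<oplus>\<^bsub>V\<^esub> y \<in> carrier V"
    and smult: "\<And>c x. x \<in> carrier V \<Longrightarrow> c \<odot>\<^bsub>V\<^esub> x \<in> carrier V"
    and "\<And>x y z. x \<in> carrier V \<Longrightarrow> y \<in> carrier V \<Longrightarrow> z \<in> carrier V \<Longrightarrow>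
      (x \<oplus>\<^bsub>V\<^esub> y) \<oplus>\<^bsub>V\<^esub> z = x \<oplus>\<^bsub>V\<^esub> (y \<oplus>\<^bsub>V\<^esub> z)"
    and "\<And>x y. x \<in> carrier V \<Longrightarrow> y \<in> carrier V \<Longrightarrow> x \<oplus>\<^bsub>V\<^esub> y = y \<oplus>\<^bsub>V\<^esub> x"
    and "\<And>x. x \<in> carrier V \<Longrightarrow> \<zero>\<^bsub>V\<^esub> \<oplus>\<^bsub>V\<^esub> x = x"
    and l0: "\<And>x. x \<in> carrier V \<Longrightarrow> 0 \<odot>\<^bsub>V\<^esub> x = \<zero>\<^bsub>V\<^esub>"
    and l_distr: "\<And>a b x. x \<in> carrier V \<Longrightarrow> (a + b) \<odot>\<^bsub>V\<^esub> x = a \<odot>\<^bsub>V\<^esub> x \<oplus>\<^bsub>V\<^esub> b \<odot>\<^bsub>V\<^esub> x"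
    and "\<And>a x y. x \<in> carrier V \<Longrightarrow> y \<in> carrier V \<Longrightarrow>
      a \<odot>\<^bsub>V\<^esub> (x \<oplus>\<^bsub>V\<^esub> y) = a \<odot>\<^bsub>V\<^esub> x \<oplus>\<^bsub>V\<^esub> a \<odot>\<^bsub>V\<^esub> y"
    and "\<And>a b x. x \<in> carrier V \<Longrightarrow> (a * b) \<odot>\<^bsub>V\<^esub> x = a \<odot>\<^bsub>V\<^esub> (b \<odot>\<^bsub>V\<^esub> x)"
    and one: "\<And>x. x \<in> carrier V \<Longrightarrow> 1 \<odot>\<^bsub>V\<^esub> x = x"
    and "\<And>x. x \<in> carrier V \<Longrightarrow> vnorm V x = 0 \<Longrightarrow> x = \<zero>\<^bsub>V\<^esub>"
    and "\<And>c x. x \<in> carrier V \<Longrightarrow> vnorm V (c \<odot>\<^bsub>V\<^esub> x) = cmod c * vnorm V x"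
    and "\<And>x y. x \<in> carrier V \<Longrightarrow> y \<in> carrier V \<Longrightarrow>
      vnorm V (x \<oplus>\<^bsub>V\<^esub> y) \<le> vnorm V x + vnorm V y"
  shows "complex_normed_space V"
proof (intro complex_normed_space.intro complex_normed_space_axioms.intro)
  show "module complex_field V"
  proof (rule moduleI)
    show "abelian_group V"
    proof (rule abelian_groupI)
      fix x assume x: "x \<in> carrier V"
      have "(-1) \<odot>\<^bsub>V\<^esub> x \<oplus>\<^bsub>V\<^esub> x = \<zero>\<^bsub>V\<^esub>"
        using l_distr[OF x, of "-1" 1] l0[OF x] one[OF x] by simp
      then show "\<exists>y\<in>carrier V. y \<oplus>\<^bsub>V\<^esub> x = \<zero>\<^bsub>V\<^esub>"
        using smult[OF x] by blast
    qed (use assms in auto)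
  qed (use assms cring_complex_field in auto)
qed (use assms in auto)

context complex_normed_space
begin

lemma smult_in [simp]: "x \<in> carrier V \<Longrightarrow> c \<odot> x \<in> carrier V"
  by simp

lemma smult_plus: "x \<in> carrier V \<Longrightarrow> (a + b) \<odot> x = a \<odot> x \<oplus> b \<odot> x"
  using smult_l_distr[of a b x] by simp

lemma smult_distrib: "x \<in> carrier V \<Longrightarrow> y \<in> carrier V \<Longrightarrow> c \<odot> (x \<oplus> y) = c \<odot> x \<oplus> c \<odot> y"
  using smult_r_distr[of c x y] by simp

lemma smult_smult: "x \<in> carrier V \<Longrightarrow> a \<odot> (b \<odot> x) = (a * b) \<odot> x"
  using smult_assoc1[of a b x] by simp

lemma smult_1 [simp]: "x \<in> carrier V \<Longrightarrow> 1 \<odot> x = x"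
  using smult_one[of x] by simp

lemma smult_0 [simp]: "x \<in> carrier V \<Longrightarrow> 0 \<odot> x = \<zero>"
  using smult_l_null[of x] by simp

lemma smult_zero [simp]: "c \<odot> \<zero> = \<zero>"
  using smult_r_null[of c] by simp

lemma uminus_eq: "x \<in> carrier V \<Longrightarrow> \<ominus> x = (-1) \<odot> x"
  using smult_plus[of x "-1" 1] by (simp add: M.minus_equality)

lemma minus_eq_smult: "x \<in> carrier V \<Longrightarrow> y \<in> carrier V \<Longrightarrow> x \<ominus> y = x \<oplus> (-1) \<odot> y"
  by (simp add: a_minus_def uminus_eq)

lemma minus_in [simp]: "x \<in> carrier V \<Longrightarrow> y \<in> carrier V \<Longrightarrow> x \<ominus> y \<in> carrier V"
  by simp

lemma smult_minus: "x \<in> carrier V \<Longrightarrow> y \<in> carrier V \<Longrightarrow> c \<odot> (x \<ominus> y) = c \<odot> x \<ominus> c \<odot> y"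
  by (simp add: minus_eq_smult smult_distrib smult_smult)

lemma smult_diff: "x \<in> carrier V \<Longrightarrow> (a - b) \<odot> x = a \<odot> x \<ominus> b \<odot> x"
  using smult_plus[of x a "-b"] by (simp add: minus_eq_smult smult_smult)

lemma minus_self [simp]: "x \<in> carrier V \<Longrightarrow> x \<ominus> x = \<zero>"
  by (simp add: a_minus_def M.r_neg)

lemma minus_zero_right [simp]: "x \<in> carrier V \<Longrightarrow> x \<ominus> \<zero> = x"
  by (simp add: a_minus_def)

lemma minus_plus_cancel [simp]: "x \<in> carrier V \<Longrightarrow> y \<in> carrier V \<Longrightarrow> (x \<ominus> y) \<oplus> y = x"
  by (simp add: a_minus_def M.a_assoc M.l_neg)

lemma plus_minus_cancel [simp]: "x \<in> carrier V \<Longrightarrow> y \<in> carrier V \<Longrightarrow> (x \<oplus> y) \<ominus> y = x"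
  by (simp add: a_minus_def M.a_assoc M.r_neg)

lemma plus_minus_cancel_left [simp]: "x \<in> carrier V \<Longrightarrow> y \<in> carrier V \<Longrightarrow> (x \<oplus> y) \<ominus> x = y"
  using plus_minus_cancel[of y x] by (simp add: M.a_comm)

lemma minus_eq_zero_iff: "x \<in> carrier V \<Longrightarrow> y \<in> carrier V \<Longrightarrow> x \<ominus> y = \<zero> \<longleftrightarrow> x = y"
  by (metis M.l_zero minus_plus_cancel minus_self)

lemma plus_minus_plus:
  "x \<in> carrier V \<Longrightarrow> y \<in> carrier V \<Longrightarrow> z \<in> carrier V \<Longrightarrow> w \<in> carrier V \<Longrightarrow>
    (x \<oplus> y) \<ominus> (z \<oplus> w) = (x \<ominus> z) \<oplus> (y \<ominus> w)"
  by (simp add: minus_eq_smult smult_distrib M.a_ac)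

lemma vnorm_minus_commute:
  "x \<in> carrier V \<Longrightarrow> y \<in> carrier V \<Longrightarrow> vnorm V (x \<ominus> y) = vnorm V (y \<ominus> x)"
  using Metric_space.commute[OF Metric_space_vdist, of x y] by (simp add: vdist_def)

lemma vnorm_minus_triangle:
  "x \<in> carrier V \<Longrightarrow> y \<in> carrier V \<Longrightarrow> z \<in> carrier V \<Longrightarrow>
    vnorm V (x \<ominus> z) \<le> vnorm V (x \<ominus> y) + vnorm V (y \<ominus> z)"
  using Metric_space.triangle[OF Metric_space_vdist, of x y z] by (simp add: vdist_def)

lemma vnorm_minus_le: "x \<in> carrier V \<Longrightarrow> y \<in> carrier V \<Longrightarrow> vnorm V (x \<ominus> y) \<le> vnorm V x + vnorm V y"
  using vnorm_triangle[of x "\<ominus> y"] by (simp add: a_minus_def vnorm_uminus)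

lemma vnorm_reverse_triangle:
  "x \<in> carrier V \<Longrightarrow> y \<in> carrier V \<Longrightarrow> \<bar>vnorm V x - vnorm V y\<bar> \<le> vnorm V (x \<ominus> y)"
  using vnorm_triangle[of "x \<ominus> y" y] vnorm_triangle[of "y \<ominus> x" x] vnorm_minus_commute[of x y]
  by simp

lemma vnorm_zero_iff: "x \<in> carrier V \<Longrightarrow> vnorm V x = 0 \<longleftrightarrow> x = \<zero>"
  using vnorm_eq_zero vnorm_zero by blast

lemma topspace_vtopology [simp]: "topspace (vtopology V) = carrier V"
  by (simp add: vtopology_def Metric_space.topspace_mtopology[OF Metric_space_vdist])

lemma limitin_vtopology:
  assumes "range s \<subseteq> carrier V"
  shows "limitin (vtopology V) s l sequentially \<longleftrightarrow>
    l \<in> carrier V \<and> (\<lambda>n. vnorm V (s n \<ominus> l)) \<longlonglongrightarrow> 0"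
proof -
  have s: "s n \<in> carrier V" for n
    using assms by auto
  have "limitin (vtopology V) s l sequentially \<longleftrightarrow>
     l \<in> carrier V \<and> (\<lambda>n. vdist V (s n) l) \<longlonglongrightarrow> 0"
    unfolding vtopology_def Metric_space.limit_metric_sequentially[OF Metric_space_vdist]
    using s Metric_space.nonneg[OF Metric_space_vdist]
    by (auto simp: LIMSEQ_def)
  then show ?thesis
    using s by (auto simp: vdist_def)
qed

lemma limitinI:
  assumes "\<And>n. s n \<in> carrier V" "l \<in> carrier V" "(\<lambda>n. vnorm V (s n \<ominus> l)) \<longlonglongrightarrow> 0"
  shows "limitin (vtopology V) s l sequentially"
  using assms limitin_vtopology[of s l] by (simp add: image_subset_iff)

lemma limitin_unique:
  "limitin (vtopology V) s l sequentially \<Longrightarrow> limitin (vtopology V) s l' sequentially \<Longrightarrow> l = l'"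
  unfolding vtopology_def
  using Metric_space.limitin_metric_unique[OF Metric_space_vdist] sequentially_bot by blast

lemma limitin_add:
  assumes s: "range s \<subseteq> carrier V" and t: "range t \<subseteq> carrier V"
    and "limitin (vtopology V) s l sequentially" "limitin (vtopology V) t m sequentially"
  shows "limitin (vtopology V) (\<lambda>n. s n \<oplus> t n) (l \<oplus> m) sequentially"
proof -
  have lm: "l \<in> carrier V" "m \<in> carrier V"
    and lim: "(\<lambda>n. vnorm V (s n \<ominus> l) + vnorm V (t n \<ominus> m)) \<longlonglongrightarrow> 0"
    using assms limitin_vtopology[OF s] limitin_vtopology[OF t] tendsto_add_zero by auto
  have st: "s n \<in> carrier V" "t n \<in> carrier V" for n
    using s t by auto
  have "vnorm V ((s n \<oplus> t n) \<ominus> (l \<oplus> m)) \<le> vnorm V (s n \<ominus> l) + vnorm V (t n \<ominus> m)" for n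
    using st lm vnorm_triangle by (simp add: plus_minus_plus)
  then have "(\<lambda>n. vnorm V ((s n \<oplus> t n) \<ominus> (l \<oplus> m))) \<longlonglongrightarrow> 0"
    using st lm by (intro tendsto_sandwich[OF _ _ tendsto_const lim]) (auto simp: vnorm_nonneg)
  then show ?thesis
    using st lm by (intro limitinI) simp_all
qed

lemma limitin_smult:
  assumes s: "range s \<subseteq> carrier V" and "limitin (vtopology V) s l sequentially"
  shows "limitin (vtopology V) (\<lambda>n. c \<odot> s n) (c \<odot> l) sequentially"
proof -
  have l: "l \<in> carrier V" and lim: "(\<lambda>n. cmod c * vnorm V (s n \<ominus> l)) \<longlonglongrightarrow> 0"
    using assms limitin_vtopology[OF s] tendsto_mult_right_zero by auto
  have s': "s n \<in> carrier V" for n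
    using s by auto
  have "vnorm V (c \<odot> s n \<ominus> c \<odot> l) = cmod c * vnorm V (s n \<ominus> l)" for n
    using s' l by (simp add: vnorm_smult flip: smult_minus)
  then show ?thesis
    using lim s' l by (intro limitinI) simp_all
qed

lemma limitin_vnorm:
  assumes s: "range s \<subseteq> carrier V" and "limitin (vtopology V) s l sequentially"
  shows "(\<lambda>n. vnorm V (s n)) \<longlonglongrightarrow> vnorm V l"
proof -
  have l: "l \<in> carrier V" and lim: "(\<lambda>n. vnorm V (s n \<ominus> l)) \<longlonglongrightarrow> 0"
    using assms limitin_vtopology[OF s] by auto
  have s': "s n \<in> carrier V" for n
    using s by auto
  have "(\<lambda>n. vnorm V (s n) - vnorm V l) \<longlonglongrightarrow> 0"
    using s' l vnorm_reverse_triangle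
    by (intro Lim_null_comparison[OF _ lim]) auto
  then show ?thesis
    using LIM_zero_iff by blast
qed

lemma closedin_sequentially:
  "closedin (vtopology V) A \<longleftrightarrow> A \<subseteq> carrier V \<and>
    (\<forall>s l. range s \<subseteq> A \<and> limitin (vtopology V) s l sequentially \<longrightarrow> l \<in> A)"
  unfolding vtopology_def Metric_space.metric_closedin_iff_sequentially_closed[OF
      Metric_space_vdist]
  by blast

lemma closure_of_sequentially:
  "vtopology V closure_of A =
    {l \<in> carrier V. \<exists>s. range s \<subseteq> A \<inter> carrier V \<and> limitin (vtopology V) s l sequentially}"
  unfolding vtopology_def Metric_space.closure_of_sequentially[OF Metric_space_vdist]
  by blast

lemma openin_ball:
  assumes "openin (vtopology V) U" "x \<in> U"
  obtains r where "r > 0" "\<And>y. y \<in> carrier V \<Longrightarrow> vnorm V (y \<ominus> x) < r \<Longrightarrow> y \<in> U"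
proof -
  have xC: "x \<in> carrier V"
    using assms openin_subset by fastforce
  obtain r where "r > 0" "Metric_space.mball (carrier V) (vdist V) x r \<subseteq> U"
    using assms unfolding vtopology_def Metric_space.openin_mtopology[OF Metric_space_vdist]
        by blast
  moreover have "y \<in> Metric_space.mball (carrier V) (vdist V) x r"
    if "y \<in> carrier V" "vnorm V (y \<ominus> x) < r" for y
    using that xC vnorm_minus_commute[of x y]
    by (simp add: Metric_space.in_mball[OF Metric_space_vdist] vdist_def)
  ultimately show thesis
    using that by blast
qed

lemma closedin_dist:
  assumes A: "closedin (vtopology V) A" and x: "x \<in> carrier V" "x \<notin> A"
  obtains r where "r > 0" "\<And>y. y \<in> A \<Longrightarrow> r \<le> vnorm V (y \<ominus> x)"
proof -
  have "openin (vtopology V) (carrier V - A)" "x \<in> carrier V - A"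
    using A x by (auto simp: closedin_def)
  then obtain r where "r > 0" "\<And>y. y \<in> carrier V \<Longrightarrow> vnorm V (y \<ominus> x) < r \<Longrightarrow> y \<in> carrier V - A"
    using openin_ball by metis
  then show thesis
    using that A closedin_subset[OF A] by (metis DiffD2 leI topspace_vtopology subset_iff)
qed

lemma MCauchy_vdist:
  "Metric_space.MCauchy (carrier V) (vdist V) s \<longleftrightarrow> range s \<subseteq> carrier V \<and>
    (\<forall>\<epsilon>>0. \<exists>N. \<forall>m\<ge>N. \<forall>n\<ge>N. vnorm V (s m \<ominus> s n) < \<epsilon>)"
proof -
  have "vdist V (s m) (s n) = vnorm V (s m \<ominus> s n)" if "range s \<subseteq> carrier V" for m n
    using that by (auto simp: vdist_def)
  then show ?thesis
    unfolding Metric_space.MCauchy_def[OF Metric_space_vdist] by auto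
qed

lemma complex_banach_spaceI:
  assumes "\<And>s. range s \<subseteq> carrier V \<Longrightarrow> (\<forall>\<epsilon>>0. \<exists>N. \<forall>m\<ge>N. \<forall>n\<ge>N. vnorm V (s m \<ominus> s n) < \<epsilon>) \<Longrightarrow>
    \<exists>l. limitin (vtopology V) s l sequentially"
  shows "complex_banach_space V"
proof
  show "Metric_space.mcomplete (carrier V) (vdist V)"
    unfolding Metric_space.mcomplete_def[OF Metric_space_vdist] MCauchy_vdist
    using assms unfolding vtopology_def by blast
qed

end

lemma (in complex_banach_space) Cauchy_limitin:
  assumes "range s \<subseteq> carrier V" "\<forall>\<epsilon>>0. \<exists>N. \<forall>m\<ge>N. \<forall>n\<ge>N. vnorm V (s m \<ominus> s n) < \<epsilon>"
  shows "\<exists>l. limitin (vtopology V) s l sequentially"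
  using complete assms
  unfolding Metric_space.mcomplete_def[OF Metric_space_vdist] MCauchy_vdist vtopology_def by blast

text \<open>
  In a complete space, extracting Cauchy subsequences is total boundedness, hence relative
  compactness. This is the form in which the diagonal argument below delivers compactness.
\<close>

lemma (in complex_banach_space) relatively_compactI:
  assumes K: "K \<subseteq> carrier V"
    and sub: "\<And>s :: nat \<Rightarrow> _. range s \<subseteq> K \<Longrightarrow>
      \<exists>r :: nat \<Rightarrow> nat. strict_mono r \<and> (\<forall>\<epsilon>>0. \<exists>N. \<forall>m\<ge>N. \<forall>n\<ge>N. vnorm V (s (r m) \<ominus> s (r n)) < \<epsilon>)"
  shows "relatively_compact V K"
proof -
  interpret MS: Metric_space "carrier V" "vdist V"
    by (rule Metric_space_vdist)
  have "MS.mtotally_bounded K"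
    unfolding MS.mtotally_bounded_sequentially
  proof (intro conjI allI impI)
    fix s :: "nat \<Rightarrow> _" assume s: "range s \<subseteq> K"
    then obtain r :: "nat \<Rightarrow> nat" where "strict_mono r" "\<forall>\<epsilon>>0. \<exists>N. \<forall>m\<ge>N. \<forall>n\<ge>N. vnorm V (s (r m) \<ominus> s
        (r n)) < \<epsilon>"
      using sub[OF s] by blast
    moreover have "s n \<in> carrier V" for n
      using s K by auto
    ultimately show "\<exists>r. strict_mono r \<and> MS.MCauchy (s \<circ> r)"
      unfolding MCauchy_vdist by (intro exI[of _ r]) auto
  qed (rule K)
  then show ?thesis
    using K MS.mtotally_bounded_eq_compact_closure_of[OF complete]
    by (simp add: relatively_compact_def vtopology_def)
qed

lemma (in complex_normed_space) relatively_compact_bounded: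
  assumes "relatively_compact V K"
  obtains B where "\<And>x. x \<in> K \<Longrightarrow> vnorm V x \<le> B"
proof -
  interpret MS: Metric_space "carrier V" "vdist V"
    by (rule Metric_space_vdist)
  have "MS.mtotally_bounded K"
    using assms MS.compact_closure_of_imp_mtotally_bounded
    by (auto simp: relatively_compact_def vtopology_def)
  then have "MS.mbounded K"
    by (rule MS.mtotally_bounded_imp_mbounded)
  then obtain c B where "K \<subseteq> MS.mcball c B"
    unfolding MS.mbounded_def by blast
  then have "vnorm V x \<le> vnorm V c + B" if "x \<in> K" for x
    using that vnorm_reverse_triangle[of c x] by (force simp: vdist_def)
  then show thesis
    using that by blast
qed

lemma linear_operatorI:
  assumes "\<And>x. x \<in> carrier X \<Longrightarrow> T x \<in> carrier Y"
    and "\<And>x y. x \<in> carrier X \<Longrightarrow> y \<in> carrier X \<Longrightarrow> T (x \<oplus>\<^bsub>X\<^esub> y) = T x \<oplus>\<^bsub>Y\<^esub> T y"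
    and "\<And>c x. x \<in> carrier X \<Longrightarrow> T (c \<odot>\<^bsub>X\<^esub> x) = c \<odot>\<^bsub>Y\<^esub> T x"
  shows "linear_operator X Y T"
  using assms by (auto simp: linear_operator_def hom_def)

lemma linear_operatorD:
  assumes "linear_operator X Y T"
  shows "x \<in> carrier X \<Longrightarrow> T x \<in> carrier Y"
    and "x \<in> carrier X \<Longrightarrow> y \<in> carrier X \<Longrightarrow> T (x \<oplus>\<^bsub>X\<^esub> y) = T x \<oplus>\<^bsub>Y\<^esub> T y"
    and "x \<in> carrier X \<Longrightarrow> T (c \<odot>\<^bsub>X\<^esub> x) = c \<odot>\<^bsub>Y\<^esub> T x"
  using assms by (auto simp: linear_operator_def hom_def)

lemma linear_operator_compose:
  "linear_operator X Y T \<Longrightarrow> linear_operator Y Z S \<Longrightarrow> linear_operator X Z (\<lambda>x. S (T x))"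
  by (rule linear_operatorI) (simp_all add: linear_operatorD)

locale linear_operator_between =
  X: complex_normed_space X + Y: complex_normed_space Y
  for X :: "'a cnspace" and Y :: "'b cnspace" +
  fixes T :: "'a \<Rightarrow> 'b"
  assumes linear: "linear_operator X Y T"
begin

lemmas in_carrier [simp] = linear_operatorD(1)[OF linear]
lemmas add = linear_operatorD(2)[OF linear]
lemmas smult = linear_operatorD(3)[OF linear]

lemma minus: "x \<in> carrier X \<Longrightarrow> y \<in> carrier X \<Longrightarrow> T (x \<ominus>\<^bsub>X\<^esub> y) = T x \<ominus>\<^bsub>Y\<^esub> T y"
  by (simp add: X.minus_eq_smult Y.minus_eq_smult add smult)

lemma zero: "T \<zero>\<^bsub>X\<^esub> = \<zero>\<^bsub>Y\<^esub>"
  using minus[of "\<zero>\<^bsub>X\<^esub>" "\<zero>\<^bsub>X\<^esub>"] by simp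

lemma finsum_smult:
  assumes "range x \<subseteq> carrier X"
  shows "T (finsum X (\<lambda>n. a n \<odot>\<^bsub>X\<^esub> x n) {..<N::nat}) = finsum Y (\<lambda>n. a n \<odot>\<^bsub>Y\<^esub> T (x n)) {..<N}"
proof -
  have x: "x n \<in> carrier X" for n
    using assms by auto
  show ?thesis
    by (induction N) (simp_all add: zero x lessThan_Suc add smult X.M.finsum_closed)
qed

lemma limitin_image:
  assumes C: "\<And>x. x \<in> carrier X \<Longrightarrow> vnorm Y (T x) \<le> C * vnorm X x"
    and s: "range s \<subseteq> carrier X" and l: "limitin (vtopology X) s l sequentially"
  shows "limitin (vtopology Y) (\<lambda>n. T (s n)) (T l) sequentially"
proof -
  have s': "s n \<in> carrier X" for n
    using s by auto
  have l': "l \<in> carrier X" and lim: "(\<lambda>n. C * vnorm X (s n \<ominus>\<^bsub>X\<^esub> l)) \<longlonglongrightarrow> 0"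
    using l X.limitin_vtopology[OF s] tendsto_mult_right_zero by auto
  have "vnorm Y (T (s n) \<ominus>\<^bsub>Y\<^esub> T l) \<le> C * vnorm X (s n \<ominus>\<^bsub>X\<^esub> l)" for n
    using C[of "s n \<ominus>\<^bsub>X\<^esub> l"] s' l' by (simp add: minus)
  then have "(\<lambda>n. vnorm Y (T (s n) \<ominus>\<^bsub>Y\<^esub> T l)) \<longlonglongrightarrow> 0"
    using s' l' by (intro tendsto_sandwich[OF _ _ tendsto_const lim]) (auto simp: Y.vnorm_nonneg)
  then show ?thesis
    using s' l' by (intro Y.limitinI) simp_all
qed

lemma continuous:
  assumes C: "\<And>x. x \<in> carrier X \<Longrightarrow> vnorm Y (T x) \<le> C * vnorm X x"
  shows "continuous_map (vtopology X) (vtopology Y) T"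
  unfolding continuous_map_closedin
proof (intro conjI ballI allI impI)
  fix A assume A: "closedin (vtopology Y) A"
  show "closedin (vtopology X) {x \<in> topspace (vtopology X). T x \<in> A}"
    unfolding X.closedin_sequentially
  proof (intro conjI allI impI)
    fix s l
    assume *: "range s \<subseteq> {x \<in> topspace (vtopology X). T x \<in> A} \<and> limitin (vtopology X) s l
        sequentially"
    then have "limitin (vtopology Y) (\<lambda>n. T (s n)) (T l) sequentially"
      by (intro limitin_image[OF C]) auto
    then have "T l \<in> A"
      using A * unfolding Y.closedin_sequentially
          by (metis (no_types, lifting) image_subset_iff mem_Collect_eq)
    then show "l \<in> {x \<in> topspace (vtopology X). T x \<in> A}"
      using * limitin_topspace by fastforce
  qed auto
qed simp

lemma vnorm_le_of_unit_ball:
  assumes B: "\<And>x. x \<in> unit_ball X \<Longrightarrow> vnorm Y (T x) \<le> B" and x: "x \<in> carrier X"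
  shows "vnorm Y (T x) \<le> B * vnorm X x"
proof (cases "x = \<zero>\<^bsub>X\<^esub>")
  case True
  then show ?thesis
    by (simp add: zero X.vnorm_zero Y.vnorm_zero)
next
  case False
  then have pos: "vnorm X x > 0"
    using X.vnorm_zero_iff[OF x] X.vnorm_nonneg[OF x] by linarith
  let ?c = "complex_of_real (1 / vnorm X x)"
  have "?c \<odot>\<^bsub>X\<^esub> x \<in> unit_ball X"
    using x pos by (simp add: unit_ball_def X.vnorm_smult norm_divide)
  then have "vnorm Y (T (?c \<odot>\<^bsub>X\<^esub> x)) \<le> B"
    by (rule B)
  then have "vnorm Y (T x) / vnorm X x \<le> B"
    using x pos by (simp add: smult Y.vnorm_smult norm_divide)
  then show ?thesis
    using pos by (simp add: pos_divide_le_eq)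
qed

lemma kernel_submodule: "submodule {x \<in> carrier X. T x = \<zero>\<^bsub>Y\<^esub>} complex_field X"
  by (rule X.submoduleI)
    (auto simp: zero add smult X.uminus_eq)

lemma closed_subspace_kernel:
  assumes C: "\<And>x. x \<in> carrier X \<Longrightarrow> vnorm Y (T x) \<le> C * vnorm X x"
  shows "closed_subspace {x \<in> carrier X. T x = \<zero>\<^bsub>Y\<^esub>} X"
proof -
  have "closedin (vtopology Y) {\<zero>\<^bsub>Y\<^esub>}"
    using Metric_space.t1_space_mtopology[OF Y.Metric_space_vdist]
    by (simp add: vtopology_def[symmetric] closedin_t1_singleton)
  then have "closedin (vtopology X) {x \<in> topspace (vtopology X). T x \<in> {\<zero>\<^bsub>Y\<^esub>}}"
    using continuous[OF C] closedin_continuous_map_preimage by blast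
  then show ?thesis
    using kernel_submodule by (simp add: closed_subspace_def)
qed

end

section \<open>The Hahn-Banach and bipolar theorems\<close>

context complex_normed_space
begin

text \<open>
  The Hahn-Banach theorem is proved by minimality instead of by extending partial functionals: the
  sublinear functionals below a given one are closed under infima of chains, and a minimal one is
  additive. All functionals are then defined on the whole space.
\<close>

definition sublinear :: "('a \<Rightarrow> real) \<Rightarrow> bool" where
  "sublinear q \<longleftrightarrow>
    (\<forall>x\<in>carrier V. \<forall>y\<in>carrier V. q (x \<oplus> y) \<le> q x + q y) \<and>
    (\<forall>t\<ge>0. \<forall>x\<in>carrier V. q (complex_of_real t \<odot> x) = t * q x)"

lemma sublinearD:
  assumes "sublinear q"
  shows "x \<in> carrier V \<Longrightarrow> y \<in> carrier V \<Longrightarrow> q (x \<oplus> y) \<le> q x + q y"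
    and "t \<ge> 0 \<Longrightarrow> x \<in> carrier V \<Longrightarrow> q (complex_of_real t \<odot> x) = t * q x"
  using assms by (auto simp: sublinear_def)

lemma sublinear_zero: "sublinear q \<Longrightarrow> q \<zero> = 0"
  using sublinearD(2)[of q 0 "\<zero>"] by simp

lemma sublinear_uminus: "sublinear q \<Longrightarrow> x \<in> carrier V \<Longrightarrow> - q (\<ominus> x) \<le> q x"
  using sublinearD(1)[of q x "\<ominus> x"] sublinear_zero[of q] by (simp add: M.r_neg)

lemma sublinearI:
  assumes add: "\<And>x y. x \<in> carrier V \<Longrightarrow> y \<in> carrier V \<Longrightarrow> q (x \<oplus> y) \<le> q x + q y"
    and zero: "q \<zero> = 0"
    and scale: "\<And>t x. t > 0 \<Longrightarrow> x \<in> carrier V \<Longrightarrow> q (complex_of_real t \<odot> x) \<le> t * q x"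
  shows "sublinear q"
  unfolding sublinear_def
proof (intro conjI ballI allI impI)
  fix t :: real and x assume t: "0 \<le> t" and x: "x \<in> carrier V"
  show "q (complex_of_real t \<odot> x) = t * q x"
  proof (cases "t = 0")
    case False
    then have t: "t > 0"
      using t by simp
    have "complex_of_real (1 / t) \<odot> (complex_of_real t \<odot> x) = x"
      using t x by (simp add: smult_smult flip: of_real_mult)
    then have "q x \<le> (1 / t) * q (complex_of_real t \<odot> x)"
      using scale[of "1 / t" "complex_of_real t \<odot> x"] t x by simp
    then have "t * q x \<le> q (complex_of_real t \<odot> x)"
      using t by (simp add: field_simps)
    then show ?thesis
      using scale[OF t x] by simp
  qed (use x zero in simp)
qed (rule add)

text \<open>
  The infimum of a chain stays finite because \<open>-N (-x) \<le> q x\<close> for every sublinear \<open>q \<le> N\<close>. Being a chain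
  is needed for subadditivity: of two members, the smaller one serves both summands.
\<close>

lemma sublinear_Inf:
  assumes Q: "Q \<noteq> {}" and sub: "\<And>q. q \<in> Q \<Longrightarrow> sublinear q"
    and le: "\<And>q x. q \<in> Q \<Longrightarrow> x \<in> carrier V \<Longrightarrow> q x \<le> N x"
    and chain: "\<And>q q'. q \<in> Q \<Longrightarrow> q' \<in> Q \<Longrightarrow>
      (\<forall>x\<in>carrier V. q x \<le> q' x) \<or> (\<forall>x\<in>carrier V. q' x \<le> q x)"
  shows "sublinear (\<lambda>x. INF q\<in>Q. q x)"
    and "q \<in> Q \<Longrightarrow> x \<in> carrier V \<Longrightarrow> (INF q\<in>Q. q x) \<le> q x"
proof -
  have bdd: "bdd_below ((\<lambda>q. q x) ` Q)" if x: "x \<in> carrier V" for x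
  proof (rule bdd_belowI2)
    fix q assume q: "q \<in> Q"
    show "- N (\<ominus> x) \<le> q x"
      using sublinear_uminus[OF sub[OF q] x] le[OF q, of "\<ominus> x"] x by simp
  qed
  show lower: "(INF q\<in>Q. q x) \<le> q x" if "q \<in> Q" "x \<in> carrier V" for q x
    using that by (intro cINF_lower bdd)
  show "sublinear (\<lambda>x. INF q\<in>Q. q x)"
  proof (rule sublinearI)
    fix x y assume x: "x \<in> carrier V" and y: "y \<in> carrier V"
    have 1: "(INF q\<in>Q. q (x \<oplus> y)) \<le> q x + q' y" if q: "q \<in> Q" "q' \<in> Q" for q q'
    proof -
      obtain r where r: "r \<in> Q" "r x \<le> q x" "r y \<le> q' y"
        using chain[OF q] q x y by (metis order_refl)
      have "(INF q\<in>Q. q (x \<oplus> y)) \<le> r (x \<oplus> y)"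
        using r x y by (intro lower) auto
      also have "\<dots> \<le> r x + r y"
        using sub[OF r(1)] x y by (rule sublinearD)
      finally show ?thesis
        using r by linarith
    qed
    have "(INF q\<in>Q. q (x \<oplus> y)) - q' y \<le> (INF q\<in>Q. q x)" if "q' \<in> Q" for q'
      using 1 that Q by (intro cINF_greatest) (auto simp: algebra_simps)
    then have "(INF q\<in>Q. q (x \<oplus> y)) - (INF q\<in>Q. q x) \<le> (INF q\<in>Q. q y)"
      using Q by (intro cINF_greatest) (auto simp: algebra_simps)
    then show "(INF q\<in>Q. q (x \<oplus> y)) \<le> (INF q\<in>Q. q x) + (INF q\<in>Q. q y)"
      by simp
  next
    have "(\<lambda>q. q \<zero>) ` Q = {0}"
      using sub Q by (auto simp: sublinear_zero image_iff)
    then show "(INF q\<in>Q. q \<zero>) = 0"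
      by simp
  next
    fix t :: real and x assume t: "t > 0" and x: "x \<in> carrier V"
    have "(INF q\<in>Q. q (complex_of_real t \<odot> x)) / t \<le> (INF q\<in>Q. q x)"
    proof (rule cINF_greatest[OF Q])
      fix q assume q: "q \<in> Q"
      show "(INF q\<in>Q. q (complex_of_real t \<odot> x)) / t \<le> q x"
        using lower[OF q, of "complex_of_real t \<odot> x"] sublinearD(2)[OF sub[OF q], of t x] t x
        by (simp add: field_simps)
    qed
    then show "(INF q\<in>Q. q (complex_of_real t \<odot> x)) \<le> t * (INF q\<in>Q. q x)"
      using t by (simp add: field_simps)
  qed
qed

lemma exists_minimal_sublinear:
  assumes N: "sublinear N"
  obtains q where "sublinear q" "\<And>x. x \<in> carrier V \<Longrightarrow> q x \<le> N x"
    "\<And>q' x. sublinear q' \<Longrightarrow> (\<And>x. x \<in> carrier V \<Longrightarrow> q' x \<le> q x) \<Longrightarrow> x \<in> carrier V \<Longrightarrow> q' x = q x"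
proof -
  define A where "A = {q \<in> extensional (carrier V). sublinear q \<and> (\<forall>x\<in>carrier V. q x \<le> N x)}"
  define P where "P = (\<lambda>q q' :: 'a \<Rightarrow> real. \<forall>x\<in>carrier V. q' x \<le> q x)"
  have restrict: "sublinear (restrict q (carrier V)) \<longleftrightarrow> sublinear q" for q
    by (simp add: sublinear_def)
  have inA: "restrict q (carrier V) \<in> A" if "sublinear q" "\<And>x. x \<in> carrier V \<Longrightarrow> q x \<le> N x" for q
    using that by (simp add: A_def restrict)
  have "\<exists>m\<in>A. \<forall>a\<in>A. P m a \<longrightarrow> a = m"
  proof (rule predicate_Zorn)
    show "partial_order_on A (relation_of P A)"
    proof (rule partial_order_on_relation_ofI)
      fix a b assume "a \<in> A" "b \<in> A" "P a b" "P b a"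
      then show "a = b"
        by (intro extensionalityI[of _ "carrier V"]) (force simp: A_def P_def)+
    qed (force simp: P_def)+
  next
    fix C assume C: "C \<in> Chains (relation_of P A)"
    then have CA: "C \<subseteq> A"
      by (force simp: Chains_def relation_of_def)
    have chain: "P a b \<or> P b a" if "a \<in> C" "b \<in> C" for a b
      using C that by (force simp: Chains_def relation_of_def)
    show "\<exists>u\<in>A. \<forall>a\<in>C. P a u"
    proof (cases "C = {}")
      case True
      then show ?thesis
        using inA[OF N] by auto
    next
      case False
      have sub: "\<And>q. q \<in> C \<Longrightarrow> sublinear q" and le: "\<And>q x. q \<in> C \<Longrightarrow> x \<in> carrier V \<Longrightarrow> q x \<le> N x"
        using CA by (auto simp: A_def)
      have chain': "(\<forall>x\<in>carrier V. q x \<le> q' x) \<or> (\<forall>x\<in>carrier V. q' x \<le> q x)"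
        if "q \<in> C" "q' \<in> C" for q q'
        using chain[OF that] by (auto simp: P_def)
      have Inf: "sublinear (\<lambda>x. INF q\<in>C. q x)"
        and Inf_le: "\<And>q x. q \<in> C \<Longrightarrow> x \<in> carrier V \<Longrightarrow> (INF q\<in>C. q x) \<le> q x"
        using sublinear_Inf[where Q = C and N = N] False sub le chain' by blast+
      obtain q where "q \<in> C"
        using False by blast
      have "(INF q\<in>C. q x) \<le> N x" if "x \<in> carrier V" for x
        using Inf_le[OF \<open>q \<in> C\<close> that] le[OF \<open>q \<in> C\<close> that] by simp
      then have "restrict (\<lambda>x. INF q\<in>C. q x) (carrier V) \<in> A"
        using Inf by (intro inA)
      moreover have "P a (restrict (\<lambda>x. INF q\<in>C. q x) (carrier V))" if "a \<in> C" for a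
        using Inf_le[OF that] by (simp add: P_def)
      ultimately show ?thesis
        by blast
    qed
  qed
  then obtain m where m: "m \<in> A" and max: "\<And>a. a \<in> A \<Longrightarrow> P m a \<Longrightarrow> a = m"
    by blast
  show thesis
  proof (rule that)
    show "sublinear m" and le: "\<And>x. x \<in> carrier V \<Longrightarrow> m x \<le> N x"
      using m by (auto simp: A_def)
    fix q' x assume q': "sublinear q'" "\<And>x. x \<in> carrier V \<Longrightarrow> q' x \<le> m x" and x: "x \<in> carrier V"
    have "restrict q' (carrier V) \<in> A"
      using q' le by (intro inA) (auto intro: order_trans)
    moreover have "P m (restrict q' (carrier V))"
      using q' by (simp add: P_def)
    ultimately have "restrict q' (carrier V) = m"
      by (rule max)
    then show "q' x = m x"
      using x by (metis restrict_apply')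
  qed
qed

text \<open>
  The functional \<open>qa x = inf\<^sub>t (q (x + t a) - t q a)\<close> over \<open>t \<ge> 0\<close> is the largest sublinear one below \<open>q\<close>
  that agrees with \<open>q\<close> at \<open>a\<close> and is linear along \<open>a\<close>. If \<open>q\<close> is minimal, then \<open>qa = q\<close>, and \<open>t = 1\<close> yields
  \<open>q x + q a \<le> q (x + a)\<close>.
\<close>

lemma sublinear_decrease:
  assumes q: "sublinear q" and a: "a \<in> carrier V"
  defines "qa \<equiv> \<lambda>x. INF t\<in>{0..}. q (x \<oplus> complex_of_real t \<odot> a) - t * q a"
  shows "sublinear qa" and "x \<in> carrier V \<Longrightarrow> t \<ge> 0 \<Longrightarrow> qa x \<le> q (x \<oplus> complex_of_real t \<odot> a) - t * q a"
proof -
  have low: "- q (\<ominus> x) \<le> q (x \<oplus> complex_of_real t \<odot> a) - t * q a" if x: "x \<in> carrier V"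
      and t: "t \<ge> 0" for x t
  proof -
    have "complex_of_real t \<odot> a = (x \<oplus> complex_of_real t \<odot> a) \<oplus> \<ominus> x"
      using x a by (simp flip: a_minus_def)
    then have "q (complex_of_real t \<odot> a) \<le> q (x \<oplus> complex_of_real t \<odot> a) + q (\<ominus> x)"
      using x a sublinearD(1)[OF q, of "x \<oplus> complex_of_real t \<odot> a" "\<ominus> x"] by simp
    then show ?thesis
      using sublinearD(2)[OF q t a] by simp
  qed
  show lower: "qa x \<le> q (x \<oplus> complex_of_real t \<odot> a) - t * q a" if x: "x \<in> carrier V"
      and t: "t \<ge> 0" for x t
    unfolding qa_def
  proof (rule cINF_lower)
    show "bdd_below ((\<lambda>t. q (x \<oplus> complex_of_real t \<odot> a) - t * q a) ` {0..})"
      using low[OF x] by (intro bdd_belowI2[where m = "- q (\<ominus> x)"]) auto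
  qed (use t in auto)
  have greatest: "l \<le> qa x" if "\<And>t. t \<ge> 0 \<Longrightarrow> l \<le> q (x \<oplus> complex_of_real t \<odot> a) - t * q a" for l x
    unfolding qa_def using that by (intro cINF_greatest) auto
  show "sublinear qa"
  proof (rule sublinearI)
    fix x y assume x: "x \<in> carrier V" and y: "y \<in> carrier V"
    have 1: "qa (x \<oplus> y) \<le> (q (x \<oplus> complex_of_real s \<odot> a) - s * q a) + (q (y \<oplus> complex_of_real t \<odot>
        a) - t * q a)"
      if s: "s \<ge> 0" and t: "t \<ge> 0" for s t
    proof -
      have "(x \<oplus> y) \<oplus> complex_of_real (s + t) \<odot> a =
          (x \<oplus> complex_of_real s \<odot> a) \<oplus> (y \<oplus> complex_of_real t \<odot> a)"
        using x y a by (simp add: smult_plus M.a_ac)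
      then show ?thesis
        using lower[of "x \<oplus> y" "s + t"] x y a s t
          sublinearD(1)[OF q, of "x \<oplus> complex_of_real s \<odot> a" "y \<oplus> complex_of_real t \<odot> a"]
        by (simp add: algebra_simps del: of_real_add)
    qed
    have "qa (x \<oplus> y) - (q (y \<oplus> complex_of_real t \<odot> a) - t * q a) \<le> qa x" if "t \<ge> 0" for t
      using 1[of _ t] that by (intro greatest) (simp add: algebra_simps)
    then have "qa (x \<oplus> y) - qa x \<le> qa y"
      by (intro greatest) (simp add: algebra_simps)
    then show "qa (x \<oplus> y) \<le> qa x + qa y"
      by simp
  next
    have "(\<lambda>t. q (\<zero> \<oplus> complex_of_real t \<odot> a) - t * q a) ` {0..} = {0}"
      using a sublinearD(2)[OF q] by (auto simp: image_iff)
    then show "qa \<zero> = 0"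
      by (simp add: qa_def)
  next
    fix c :: real and x assume c: "c > 0" and x: "x \<in> carrier V"
    have "qa (complex_of_real c \<odot> x) / c \<le> qa x"
    proof (rule greatest)
      fix t :: real assume t: "t \<ge> 0"
      have "complex_of_real c \<odot> x \<oplus> complex_of_real (c * t) \<odot> a =
          complex_of_real c \<odot> (x \<oplus> complex_of_real t \<odot> a)"
        using x a by (simp add: smult_distrib smult_smult)
      then show "qa (complex_of_real c \<odot> x) / c \<le> q (x \<oplus> complex_of_real t \<odot> a) - t * q a"
        using lower[of "complex_of_real c \<odot> x" "c * t"] c t x a sublinearD(2)[OF q, of c "x \<oplus>
            complex_of_real t \<odot> a"]
        by (simp add: field_simps del: of_real_mult)
    qed
    then show "qa (complex_of_real c \<odot> x) \<le> c * qa x"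
      using c by (simp add: field_simps)
  qed
qed

text \<open>
  A minimal sublinear functional \<open>u\<close> is sought below the decrease of \<open>N\<close> along \<open>a\<close> and not just below \<open>N\<close>:
  that decrease takes a value \<open>\<le> - N a\<close> at \<open>-a\<close>, so that \<open>u a = - u (-a) \<ge> N a\<close>.
\<close>

lemma Hahn_Banach_real:
  assumes N: "sublinear N" and a: "a \<in> carrier V"
  obtains u where "\<And>x y. x \<in> carrier V \<Longrightarrow> y \<in> carrier V \<Longrightarrow> u (x \<oplus> y) = u x + u y"
    "\<And>t x. x \<in> carrier V \<Longrightarrow> u (complex_of_real t \<odot> x) = t * u x"
    "\<And>x. x \<in> carrier V \<Longrightarrow> u x \<le> N x" "u a = N a"
proof -
  note dec = sublinear_decrease[OF N a]
  obtain u where u: "sublinear u"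
    and le: "\<And>x. x \<in> carrier V \<Longrightarrow> u x \<le> (INF t\<in>{0..}. N (x \<oplus> complex_of_real t \<odot> a) - t * N a)"
    and min: "\<And>q' x. sublinear q' \<Longrightarrow> (\<And>x. x \<in> carrier V \<Longrightarrow> q' x \<le> u x) \<Longrightarrow> x \<in> carrier V \<Longrightarrow> q' x = u x"
    using exists_minimal_sublinear[OF dec(1)] by blast
  have add: "u (x \<oplus> y) = u x + u y" if x: "x \<in> carrier V" and y: "y \<in> carrier V" for x y
  proof -
    note decu = sublinear_decrease[OF u y]
    have "u x = (INF t\<in>{0..}. u (x \<oplus> complex_of_real t \<odot> y) - t * u y)"
      using decu(2)[of _ 0] y by (intro min[OF decu(1), symmetric] x) auto
    also have "\<dots> \<le> u (x \<oplus> y) - u y"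
      using decu(2)[OF x, of 1] y by simp
    finally show ?thesis
      using sublinearD(1)[OF u x y] by simp
  qed
  have neg: "u (\<ominus> x) = - u x" if x: "x \<in> carrier V" for x
    using add[of x "\<ominus> x"] x sublinear_zero[OF u] by (simp add: M.r_neg)
  show thesis
  proof (rule that)
    show "u (x \<oplus> y) = u x + u y" if "x \<in> carrier V" "y \<in> carrier V" for x y
      using that by (rule add)
    show "u (complex_of_real t \<odot> x) = t * u x" if x: "x \<in> carrier V" for t x
    proof (cases "t \<ge> 0")
      case False
      then have "u (complex_of_real (- t) \<odot> x) = - t * u x"
        using sublinearD(2)[OF u, of "-t" x] x by simp
      moreover have "complex_of_real (- t) \<odot> x = \<ominus> (complex_of_real t \<odot> x)"
        using x by (simp add: uminus_eq smult_smult)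
      ultimately show ?thesis
        using neg[of "complex_of_real t \<odot> x"] x by simp
    qed (use sublinearD(2)[OF u] x in auto)
    show le_N: "u x \<le> N x" if x: "x \<in> carrier V" for x
      using le[OF x] dec(2)[OF x, of 0] x a by simp
    have "u (\<ominus> a) \<le> - N a"
      using le[of "\<ominus> a"] dec(2)[of "\<ominus> a" 1] a sublinear_zero[OF N] by (simp add: M.l_neg)
    then show "u a = N a"
      using neg[OF a] le_N[OF a] by simp
  qed
qed

text \<open>
  The usual complexification \<open>\<psi> x = u x - \<i> u (\<i> x)\<close> of a real functional \<open>u\<close>; the bound on its modulus
  follows by rotating \<open>x\<close> until \<open>\<psi> x\<close> is nonnegative.
\<close>

lemma Hahn_Banach_complex:
  assumes N_add: "\<And>x y. x \<in> carrier V \<Longrightarrow> y \<in> carrier V \<Longrightarrow> N (x \<oplus> y) \<le> N x + N y"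
    and N_smult: "\<And>c x. x \<in> carrier V \<Longrightarrow> N (c \<odot> x) = cmod c * N x"
    and a: "a \<in> carrier V"
  obtains \<psi> where "\<And>x y. x \<in> carrier V \<Longrightarrow> y \<in> carrier V \<Longrightarrow> \<psi> (x \<oplus> y) = \<psi> x + \<psi> y"
    "\<And>c x. x \<in> carrier V \<Longrightarrow> \<psi> (c \<odot> x) = c * \<psi> x"
    "\<And>x. x \<in> carrier V \<Longrightarrow> cmod (\<psi> x) \<le> N x" "N a \<le> cmod (\<psi> a)"
proof -
  have "sublinear N"
    using N_add N_smult by (simp add: sublinear_def)
  then obtain u where add: "\<And>x y. x \<in> carrier V \<Longrightarrow> y \<in> carrier V \<Longrightarrow> u (x \<oplus> y) = u x + u y"
    and scale: "\<And>t x. x \<in> carrier V \<Longrightarrow> u (complex_of_real t \<odot> x) = t * u x"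
    and le: "\<And>x. x \<in> carrier V \<Longrightarrow> u x \<le> N x" and ua: "u a = N a"
    using Hahn_Banach_real[OF _ a] by metis
  define \<psi> where "\<psi> = (\<lambda>x. Complex (u x) (- u (\<i> \<odot> x)))"
  have smult: "\<psi> (c \<odot> x) = c * \<psi> x" if x: "x \<in> carrier V" for c x
  proof -
    have "c \<odot> x = (complex_of_real (Re c) + complex_of_real (Im c) * \<i>) \<odot> x"
      by (rule arg_cong[where f = "\<lambda>c. c \<odot> x"]) (simp add: complex_eq_iff)
    then have c: "c \<odot> x = complex_of_real (Re c) \<odot> x \<oplus> complex_of_real (Im c) \<odot> (\<i> \<odot> x)"
      using x by (simp only: smult_plus smult_smult)
    have "\<i> \<odot> (c \<odot> x) = (complex_of_real (- Im c) + complex_of_real (Re c) * \<i>) \<odot> x"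
      unfolding smult_smult[OF x]
      by (rule arg_cong[where f = "\<lambda>c. c \<odot> x"]) (simp add: complex_eq_iff)
    then have ic: "\<i> \<odot> (c \<odot> x) = complex_of_real (- Im c) \<odot> x \<oplus> complex_of_real (Re c) \<odot> (\<i> \<odot> x)"
      using x by (simp only: smult_plus smult_smult)
    show ?thesis
      unfolding \<psi>_def ic unfolding c using x
      by (simp add: add scale complex_eq_iff del: of_real_minus)
  qed
  show thesis
  proof (rule that)
    show "\<psi> (x \<oplus> y) = \<psi> x + \<psi> y" if "x \<in> carrier V" "y \<in> carrier V" for x y
      using that by (simp add: \<psi>_def add smult_distrib complex_eq_iff)
    show "\<psi> (c \<odot> x) = c * \<psi> x" if "x \<in> carrier V" for c x
      using that by (rule smult)
    show "cmod (\<psi> x) \<le> N x" if x: "x \<in> carrier V" for x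
    proof -
      define c where "c = (if \<psi> x = 0 then 1 else complex_of_real (cmod (\<psi> x)) / \<psi> x)"
      have c: "cmod c = 1" "c * \<psi> x = cmod (\<psi> x)"
        by (auto simp: c_def norm_divide)
      have "cmod (\<psi> x) = Re (\<psi> (c \<odot> x))"
        using c x by (simp add: smult)
      also have "\<dots> \<le> N (c \<odot> x)"
        using le x by (simp add: \<psi>_def)
      finally show ?thesis
        using c x by (simp add: N_smult)
    qed
    show "N a \<le> cmod (\<psi> a)"
      using ua complex_Re_le_cmod[of "\<psi> a"] by (simp add: \<psi>_def)
  qed
qed

definition absolutely_convex :: "'a set \<Rightarrow> bool" where
  "absolutely_convex C \<longleftrightarrow> C \<subseteq> carrier V \<and> C \<noteq> {} \<and>
    (\<forall>x\<in>C. \<forall>y\<in>C. \<forall>a b. cmod a + cmod b \<le> 1 \<longrightarrow> a \<odot> x \<oplus> b \<odot> y \<in> C)"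

lemma absolutely_convexD:
  assumes "absolutely_convex C"
  shows "x \<in> C \<Longrightarrow> x \<in> carrier V"
    and "x \<in> C \<Longrightarrow> y \<in> C \<Longrightarrow> cmod a + cmod b \<le> 1 \<Longrightarrow> a \<odot> x \<oplus> b \<odot> y \<in> C"
    and "x \<in> C \<Longrightarrow> cmod a \<le> 1 \<Longrightarrow> a \<odot> x \<in> C"
    and "\<zero> \<in> C"
proof -
  show C: "x \<in> carrier V" if "x \<in> C" for x
    using that assms by (auto simp: absolutely_convex_def)
  show 1: "a \<odot> x \<oplus> b \<odot> y \<in> C" if "x \<in> C" "y \<in> C" "cmod a + cmod b \<le> 1" for a b x y
    using that assms by (auto simp: absolutely_convex_def)
  show 2: "a \<odot> x \<in> C" if "x \<in> C" "cmod a \<le> 1" for a x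
    using 1[of x x a 0] C that by simp
  obtain x where "x \<in> C"
    using assms by (auto simp: absolutely_convex_def)
  then show "\<zero> \<in> C"
    using 2[of x 0] C by simp
qed

text \<open>
  A closed absolutely convex set contains its bipolar: for \<open>y\<close> outside \<open>C\<close>, a seminorm that is \<open>\<le> 1\<close>
  on \<open>C\<close> and \<open>> 1\<close> at \<open>y\<close> is turned into a functional with these properties.
\<close>

lemma bipolar:
  assumes closed: "closedin (vtopology V) C" and C: "absolutely_convex C" and y: "y \<in> carrier V"
    and polar: "\<And>\<psi>. bounded_operator V complex_space \<psi> \<Longrightarrow>
      (\<And>x. x \<in> C \<Longrightarrow> cmod (\<psi> x) \<le> 1) \<Longrightarrow> cmod (\<psi> y) \<le> 1"
  shows "y \<in> C"
proof (rule ccontr)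
  assume yC: "y \<notin> C"
  note Cin = absolutely_convexD(1)[OF C]
  \<comment> \<open>Shrinking \<open>y\<close> a little keeps it outside the closed set \<open>C\<close>. The factor \<open>s < 1\<close> turns the bound
    \<open>\<ge> 1\<close> at the shrunk vector into a bound \<open>> 1\<close> at \<open>y\<close>.\<close>
  obtain s :: real where s: "0 < s" "s < 1" "complex_of_real s \<odot> y \<notin> C"
  proof -
    define t where "t = (\<lambda>n. 1 - 1 / (real n + 2))"
    have t: "0 < t n" "t n < 1" for n
      by (auto simp: t_def field_simps)
    have "(\<lambda>n. vnorm V (complex_of_real (t n) \<odot> y \<ominus> y)) \<longlonglongrightarrow> 0"
    proof -
      have "complex_of_real (t n) \<odot> y \<ominus> y = complex_of_real (t n - 1) \<odot> y" for n
        using y smult_diff[of y "complex_of_real (t n)" 1] by simp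
      then have "vnorm V (complex_of_real (t n) \<odot> y \<ominus> y) = \<bar>t n - 1\<bar> * vnorm V y" for n
        using vnorm_smult[OF y, of "complex_of_real (t n - 1)"] by (simp only: norm_of_real)
      then have "vnorm V (complex_of_real (t n) \<odot> y \<ominus> y) = 1 / (real n + 2) * vnorm V y" for n
        by (simp add: t_def)
      moreover have "(\<lambda>n. 1 / (real n + 2) * vnorm V y) \<longlonglongrightarrow> 0"
        by real_asymp
      ultimately show ?thesis
        by simp
    qed
    then have "limitin (vtopology V) (\<lambda>n. complex_of_real (t n) \<odot> y) y sequentially"
      using y by (intro limitinI) auto
    then have "\<not> range (\<lambda>n. complex_of_real (t n) \<odot> y) \<subseteq> C"
      using closed yC unfolding closedin_sequentially by blast
    then show thesis
      using that t by blast
  qed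
  let ?y = "complex_of_real s \<odot> y"
  obtain \<epsilon> where \<epsilon>: "\<epsilon> > 0" "\<And>x. x \<in> C \<Longrightarrow> \<epsilon> \<le> vnorm V (x \<ominus> ?y)"
    using closedin_dist[OF closed _ s(3)] y by auto
  \<comment> \<open>The infimum of \<open>D v\<close> defines the largest seminorm below both the gauge of \<open>C\<close> and the norm
    divided by \<open>\<epsilon>\<close>.\<close>
  define D where "D = (\<lambda>v. {t + vnorm V (v \<ominus> complex_of_real t \<odot> c) / \<epsilon> |t c. t \<ge> 0 \<and> c \<in> C})"
  define N where "N = (\<lambda>v. Inf (D v))"
  have D0: "r \<ge> 0" if "r \<in> D v" "v \<in> carrier V" for r v
    using that Cin \<epsilon> by (auto simp: D_def intro!: add_nonneg_nonneg divide_nonneg_pos vnorm_nonneg)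
  have Dne: "D v \<noteq> {}" for v
    using absolutely_convexD(4)[OF C] order_refl[of "0 :: real"] unfolding D_def by blast
  have N_le: "N v \<le> t + vnorm V (v \<ominus> complex_of_real t \<odot> c) / \<epsilon>"
      if "v \<in> carrier V" "t \<ge> 0" "c \<in> C" for v t c
    unfolding N_def
  proof (rule cInf_lower)
    show "t + vnorm V (v \<ominus> complex_of_real t \<odot> c) / \<epsilon> \<in> D v"
      using that unfolding D_def by blast
    show "bdd_below (D v)"
      using D0 that by (intro bdd_belowI[where m = 0])
  qed
  have N_ge: "l \<le> N v" if "\<And>t c. t \<ge> 0 \<Longrightarrow> c \<in> C \<Longrightarrow> l \<le> t + vnorm V (v \<ominus> complex_of_real t \<odot> c) / \<epsilon>"
      for l v
    unfolding N_def using that by (intro cInf_greatest Dne) (auto simp: D_def)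
  have N_add: "N (v \<oplus> w) \<le> N v + N w" if v: "v \<in> carrier V" and w: "w \<in> carrier V" for v w
  proof -
    have 1: "N (v \<oplus> w) \<le> (t + vnorm V (v \<ominus> complex_of_real t \<odot> c) / \<epsilon>) + (t' + vnorm V (w \<ominus>
        complex_of_real t' \<odot> c') / \<epsilon>)"
      if t: "t \<ge> 0" "t' \<ge> 0" and c: "c \<in> C" "c' \<in> C" for t t' c c'
    proof (cases "t + t' = 0")
      case True
      then have "t = 0" "t' = 0"
        using t by auto
      then show ?thesis
        using N_le[of "v \<oplus> w" 0 c] v w c Cin \<epsilon> vnorm_triangle[OF v w]
        by (simp add: field_simps)
    next
      case False
      then have tt: "t + t' > 0"
        using t by simp
      let ?c = "complex_of_real (t / (t + t')) \<odot> c \<oplus> complex_of_real (t' / (t + t')) \<odot> c'"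
      have cC: "?c \<in> C"
        using t tt by (intro absolutely_convexD(2)[OF C] c) (simp add: norm_divide field_simps
            del: of_real_add of_real_divide)
      have eq: "complex_of_real (t + t') \<odot> ?c = complex_of_real t \<odot> c \<oplus> complex_of_real t' \<odot> c'"
        using c Cin tt by (simp add: smult_distrib smult_smult del: of_real_add of_real_divide
            flip: of_real_mult)
      have "vnorm V ((v \<oplus> w) \<ominus> complex_of_real (t + t') \<odot> ?c) \<le>
          vnorm V (v \<ominus> complex_of_real t \<odot> c) + vnorm V (w \<ominus> complex_of_real t' \<odot> c')"
        unfolding eq using v w c Cin by (simp add: plus_minus_plus vnorm_triangle)
      then have "vnorm V ((v \<oplus> w) \<ominus> complex_of_real (t + t') \<odot> ?c) / \<epsilon> \<le>
          vnorm V (v \<ominus> complex_of_real t \<odot> c) / \<epsilon> + vnorm V (w \<ominus> complex_of_real t' \<odot> c') / \<epsilon>"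
        using \<epsilon> by (simp add: divide_right_mono flip: add_divide_distrib)
      then show ?thesis
        using N_le[of "v \<oplus> w" "t + t'" ?c] v w t cC by simp
    qed
    have "N (v \<oplus> w) - (t' + vnorm V (w \<ominus> complex_of_real t' \<odot> c') / \<epsilon>) \<le> N v" if "t' \<ge> 0" "c' \<in> C"
        for t' c'
      using 1[of _ t' _ c'] that by (intro N_ge) (simp add: diff_le_eq)
    then have "N (v \<oplus> w) - N v \<le> N w"
      by (intro N_ge) (simp add: algebra_simps)
    then show ?thesis
      by simp
  qed
  have N_smult_le: "N (k \<odot> v) \<le> cmod k * N v" if v: "v \<in> carrier V" and k: "k \<noteq> 0" for k v
  proof -
    have "N (k \<odot> v) / cmod k \<le> N v"
    proof (rule N_ge)
      fix t :: real and c assume t: "t \<ge> 0" and c: "c \<in> C"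
      have sC: "sgn k \<odot> c \<in> C"
        using c k by (intro absolutely_convexD(3)[OF C]) (auto simp: norm_sgn)
      have sgn: "complex_of_real (cmod k) * sgn k = k"
        by (simp add: sgn_div_norm scaleR_conv_of_real k)
      have "complex_of_real (cmod k * t) \<odot> (sgn k \<odot> c) =
          (complex_of_real (cmod k) * sgn k * complex_of_real t) \<odot> c"
        using c Cin by (simp add: smult_smult mult_ac)
      also have "\<dots> = k \<odot> (complex_of_real t \<odot> c)"
        unfolding sgn using c Cin by (simp add: smult_smult)
      finally have "k \<odot> v \<ominus> complex_of_real (cmod k * t) \<odot> (sgn k \<odot> c) =
          k \<odot> (v \<ominus> complex_of_real t \<odot> c)"
        using v c Cin by (simp add: smult_minus del: of_real_mult)
      then have "N (k \<odot> v) \<le> cmod k * t + cmod k * vnorm V (v \<ominus> complex_of_real t \<odot> c) / \<epsilon>"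
        using N_le[of "k \<odot> v" "cmod k * t" "sgn k \<odot> c"] v t c Cin sC
            by (simp add: vnorm_smult del: of_real_mult)
      then show "N (k \<odot> v) / cmod k \<le> t + vnorm V (v \<ominus> complex_of_real t \<odot> c) / \<epsilon>"
        using k \<epsilon> by (simp add: field_simps)
    qed
    then show ?thesis
      using k by (simp add: field_simps)
  qed
  have N0: "0 \<le> N v" if "v \<in> carrier V" for v
    using that Cin \<epsilon> by (intro N_ge) (auto intro!: add_nonneg_nonneg divide_nonneg_pos vnorm_nonneg)
  have N_norm: "N v \<le> (1 / \<epsilon>) * vnorm V v" if "v \<in> carrier V" for v
    using N_le[OF that, of 0 "\<zero>"] absolutely_convexD(4)[OF C] that by simp
  have N_smult: "N (k \<odot> v) = cmod k * N v" if v: "v \<in> carrier V" for k v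
  proof (cases "k = 0")
    case True
    then show ?thesis
      using v N0[of "\<zero>"] N_norm[of "\<zero>"] by (simp add: vnorm_zero)
  next
    case False
    then have "N v \<le> N (k \<odot> v) / cmod k"
      using N_smult_le[of "k \<odot> v" "inverse k"] v
          by (simp add: smult_smult norm_inverse divide_inverse mult.commute)
    then show ?thesis
      using N_smult_le[OF v False] False by (simp add: field_simps)
  qed
  have N_C: "N c \<le> 1" if "c \<in> C" for c
    using N_le[OF Cin, of c 1 c] that Cin by (simp add: vnorm_zero)
  have Ny: "1 \<le> N ?y"
  proof (rule N_ge)
    fix t :: real and c assume t: "t \<ge> 0" and c: "c \<in> C"
    show "1 \<le> t + vnorm V (?y \<ominus> complex_of_real t \<odot> c) / \<epsilon>"
    proof (cases "t \<ge> 1")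
      case True
      have "vnorm V (?y \<ominus> complex_of_real t \<odot> c) / \<epsilon> \<ge> 0"
        using y c Cin \<epsilon> by (intro divide_nonneg_pos vnorm_nonneg) auto
      then show ?thesis
        using True by simp
    next
      case False
      then have "complex_of_real t \<odot> c \<in> C"
        using t c by (intro absolutely_convexD(3)[OF C]) auto
      then have "\<epsilon> \<le> vnorm V (?y \<ominus> complex_of_real t \<odot> c)"
        using \<epsilon>(2) vnorm_minus_commute[of ?y "complex_of_real t \<odot> c"] y c Cin by simp
      then have "1 \<le> vnorm V (?y \<ominus> complex_of_real t \<odot> c) / \<epsilon>"
        using \<epsilon> by simp
      then show ?thesis
        using t by simp
    qed
  qed
  obtain \<psi> where \<psi>: "\<And>x y. x \<in> carrier V \<Longrightarrow> y \<in> carrier V \<Longrightarrow> \<psi> (x \<oplus> y) = \<psi> x + \<psi> y"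
    "\<And>c x. x \<in> carrier V \<Longrightarrow> \<psi> (c \<odot> x) = c * \<psi> x"
    "\<And>x. x \<in> carrier V \<Longrightarrow> cmod (\<psi> x) \<le> N x" "N y \<le> cmod (\<psi> y)"
    using Hahn_Banach_complex[OF N_add N_smult y] by blast
  have "linear_operator V complex_space \<psi>"
    by (rule linear_operatorI) (simp_all add: complex_space_def \<psi>(1,2))
  moreover have "vnorm complex_space (\<psi> v) \<le> (1 / \<epsilon>) * vnorm V v" if "v \<in> carrier V" for v
    using \<psi>(3)[OF that] N_norm[OF that] by (simp add: complex_space_def)
  ultimately have "bounded_operator V complex_space \<psi>"
    unfolding bounded_operator_def by blast
  then have "cmod (\<psi> y) \<le> 1"
  proof (rule polar)
    show "cmod (\<psi> x) \<le> 1" if "x \<in> C" for x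
      using \<psi>(3)[OF Cin[OF that]] N_C[OF that] by simp
  qed
  then have "s * N y \<le> s * 1"
    using \<psi>(4) s by (intro mult_left_mono) auto
  moreover have "1 \<le> s * N y"
    using Ny N_smult[of y "complex_of_real s"] y s by simp
  ultimately show False
    using s(2) by linarith
qed

end

section \<open>Lifting holomorphic mappings through injective operators\<close>

text \<open>
  Cauchy's estimates on discs of radius \<open>R / 2\<close> about \<open>0\<close> for the first derivative and of radius
  \<open>R / 4\<close> about the points of the half disc for the second one, followed by Taylor's formula.
\<close>

lemma bounded_holomorphic_estimates:
  fixes \<phi> :: "complex \<Rightarrow> complex"
  assumes R: "R > 0" and hol: "\<phi> holomorphic_on ball 0 R"
    and le: "\<And>z. cmod z < R \<Longrightarrow> cmod (\<phi> z) \<le> 1"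
  shows "cmod (deriv \<phi> 0) \<le> 2 / R"
    and "cmod z < R / 2 \<Longrightarrow> cmod (\<phi> z - \<phi> 0 - z * deriv \<phi> 0) \<le> 32 / R\<^sup>2 * (cmod z)\<^sup>2"
proof -
  have Cauchy: "cmod ((deriv ^^ n) \<phi> w) \<le> fact n * 1 / r ^ n" if "cmod w + r < R" "r > 0" for n w r
  proof (rule Cauchy_inequality)
    have sub: "cball w r \<subseteq> ball 0 R"
    proof
      fix v assume "v \<in> cball w r"
      then show "v \<in> ball 0 R"
        using that norm_triangle_sub[of v w] by (simp add: dist_norm norm_minus_commute)
    qed
    then show "\<phi> holomorphic_on ball w r"
      using hol ball_subset_cball holomorphic_on_subset by blast
    show "continuous_on (cball w r) \<phi>"
      using hol sub holomorphic_on_imp_continuous_on holomorphic_on_subset by blast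
    show "cmod (\<phi> v) \<le> 1" if "cmod (w - v) = r" for v
      using sub that by (intro le) (force simp: dist_norm)
  qed (rule that)
  show "cmod (deriv \<phi> 0) \<le> 2 / R"
    using Cauchy[of 0 "R / 2" 1] R by simp
  assume z: "cmod z < R / 2"
  have "cmod ((deriv ^^ 0) \<phi> z - (\<Sum>i\<le>1. (deriv ^^ i) \<phi> 0 * (z - 0) ^ i / fact i))
      \<le> 32 / R\<^sup>2 * cmod (z - 0) ^ Suc 1 / fact 1"
  proof (rule complex_Taylor[of "ball 0 (R / 2)"])
    fix i and w :: complex assume w: "w \<in> ball 0 (R / 2)"
    have "(deriv ^^ i) \<phi> holomorphic_on ball 0 R"
      using hol by (rule holomorphic_higher_deriv) simp
    moreover have "w \<in> ball 0 R"
      using w R by simp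
    ultimately have "((deriv ^^ i) \<phi> has_field_derivative deriv ((deriv ^^ i) \<phi>) w) (at w)"
      by (rule holomorphic_derivI[OF _ open_ball])
    then show "((deriv ^^ i) \<phi> has_field_derivative (deriv ^^ Suc i) \<phi> w) (at w within ball 0 (R /
        2))"
      by (simp add: has_field_derivative_at_within)
    show "cmod ((deriv ^^ Suc 1) \<phi> w) \<le> 32 / R\<^sup>2"
      using Cauchy[of w "R / 4" 2] w R by (simp add: numeral_2_eq_2[symmetric] power_divide)
  qed (use z R in auto)
  then show "cmod (\<phi> z - \<phi> 0 - z * deriv \<phi> 0) \<le> 32 / R\<^sup>2 * (cmod z)\<^sup>2"
    by (simp add: diff_diff_eq mult.commute power2_eq_square)
qed

definition frechet_derivative ::
  "'a cnspace \<Rightarrow> 'a set \<Rightarrow> 'b cnspace \<Rightarrow> ('a \<Rightarrow> 'b) \<Rightarrow> 'a \<Rightarrow> ('a \<Rightarrow> 'b) \<Rightarrow> bool" where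
  "frechet_derivative X U Y f x L \<longleftrightarrow> bounded_operator X Y L \<and>
     (\<forall>\<epsilon> > 0. \<exists>\<delta> > 0. \<forall>y \<in> U. vnorm X (y \<ominus>\<^bsub>X\<^esub> x) < \<delta> \<longrightarrow>
        vnorm Y (f y \<ominus>\<^bsub>Y\<^esub> f x \<ominus>\<^bsub>Y\<^esub> L (y \<ominus>\<^bsub>X\<^esub> x)) \<le> \<epsilon> * vnorm X (y \<ominus>\<^bsub>X\<^esub> x))"

lemma holomorphic_map_iff:
  "holomorphic_map X U Y f \<longleftrightarrow> f \<in> U \<rightarrow> carrier Y \<and> (\<forall>x\<in>U. \<exists>L. frechet_derivative X U Y f x L)"
  by (simp add: holomorphic_map_def frechet_derivative_def)

lemma bounded_functionalD:
  assumes "bounded_operator V complex_space \<psi>"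
  shows "x \<in> carrier V \<Longrightarrow> y \<in> carrier V \<Longrightarrow> \<psi> (x \<oplus>\<^bsub>V\<^esub> y) = \<psi> x + \<psi> y"
    and "x \<in> carrier V \<Longrightarrow> \<psi> (c \<odot>\<^bsub>V\<^esub> x) = c * \<psi> x"
  using assms linear_operatorD[of V complex_space \<psi>]
  by (auto simp: bounded_operator_def complex_space_def)

text \<open>
  Composing a holomorphic mapping with a complex line and a functional gives a holomorphic function
  of one variable. All of complex analysis enters through this reduction.
\<close>

lemma functional_along_line:
  assumes E: "complex_normed_space E" and F: "complex_normed_space F"
    and f: "holomorphic_map E U F f"
    and x: "x \<in> carrier E" and h: "h \<in> carrier E"
    and line: "\<And>z. cmod z < R \<Longrightarrow> x \<oplus>\<^bsub>E\<^esub> z \<odot>\<^bsub>E\<^esub> h \<in> U"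
    and \<psi>: "bounded_operator F complex_space \<psi>"
  shows "(\<lambda>z. \<psi> (f (x \<oplus>\<^bsub>E\<^esub> z \<odot>\<^bsub>E\<^esub> h))) holomorphic_on ball 0 R"
    and "R > 0 \<Longrightarrow> frechet_derivative E U F f x L \<Longrightarrow>
      deriv (\<lambda>z. \<psi> (f (x \<oplus>\<^bsub>E\<^esub> z \<odot>\<^bsub>E\<^esub> h))) 0 = \<psi> (L h)"
proof -
  interpret E: complex_normed_space E by (rule E)
  interpret F: complex_normed_space F by (rule F)
  note \<psi>D = bounded_functionalD[OF \<psi>]
  obtain B where \<psi>_le: "\<And>v. v \<in> carrier F \<Longrightarrow> cmod (\<psi> v) \<le> B * vnorm F v"
    using \<psi> by (auto simp: bounded_operator_def complex_space_def)
  let ?\<phi> = "\<lambda>z. \<psi> (f (x \<oplus>\<^bsub>E\<^esub> z \<odot>\<^bsub>E\<^esub> h))"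
  have \<psi>_minus: "\<psi> (a \<ominus>\<^bsub>F\<^esub> b) = \<psi> a - \<psi> b" if "a \<in> carrier F" "b \<in> carrier F" for a b
    using that by (simp add: F.minus_eq_smult \<psi>D)
  have fU: "f u \<in> carrier F" if "u \<in> U" for u
    using f that by (auto simp: holomorphic_map_def)
  have deriv: "(?\<phi> has_field_derivative \<psi> (L h)) (at z within ball 0 R)"
    if z: "cmod z < R" and L: "frechet_derivative E U F f (x \<oplus>\<^bsub>E\<^esub> z \<odot>\<^bsub>E\<^esub> h) L" for z L
    unfolding has_field_derivative_def has_derivative_within_alt
  proof (intro conjI allI impI)
    show "bounded_linear ((*) (\<psi> (L h)))"
      by (rule bounded_linear_mult_right)
    fix e :: real assume e: "e > 0"
    have lin: "linear_operator E F L"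
      using L by (simp add: frechet_derivative_def bounded_operator_def)
    \<comment> \<open>Adding \<open>1\<close> keeps the denominator positive for \<open>B = 0\<close> and \<open>h = 0\<close>.\<close>
    define \<epsilon> where "\<epsilon> = e / ((\<bar>B\<bar> + 1) * (vnorm E h + 1))"
    have h0: "vnorm E h \<ge> 0"
      using h by (rule E.vnorm_nonneg)
    then have \<epsilon>: "\<epsilon> > 0"
      using e by (simp add: \<epsilon>_def)
    obtain \<delta> where \<delta>: "\<delta> > 0" "\<And>y. y \<in> U \<Longrightarrow> vnorm E (y \<ominus>\<^bsub>E\<^esub> (x \<oplus>\<^bsub>E\<^esub> z \<odot>\<^bsub>E\<^esub> h)) < \<delta> \<Longrightarrow>
        vnorm F (f y \<ominus>\<^bsub>F\<^esub> f (x \<oplus>\<^bsub>E\<^esub> z \<odot>\<^bsub>E\<^esub> h) \<ominus>\<^bsub>F\<^esub> L (y \<ominus>\<^bsub>E\<^esub> (x \<oplus>\<^bsub>E\<^esub> z \<odot>\<^bsub>E\<^esub> h)))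
          \<le> \<epsilon> * vnorm E (y \<ominus>\<^bsub>E\<^esub> (x \<oplus>\<^bsub>E\<^esub> z \<odot>\<^bsub>E\<^esub> h))"
      using L \<epsilon> unfolding frechet_derivative_def by meson
    show "\<exists>d>0. \<forall>w\<in>ball 0 R. norm (w - z) < d \<longrightarrow>
        norm (?\<phi> w - ?\<phi> z - \<psi> (L h) * (w - z)) \<le> e * norm (w - z)"
    proof (intro exI[of _ "\<delta> / (vnorm E h + 1)"] conjI ballI impI)
      show "\<delta> / (vnorm E h + 1) > 0"
        using \<delta> h0 by simp
      fix w :: complex assume w: "w \<in> ball 0 R" and wz: "norm (w - z) < \<delta> / (vnorm E h + 1)"
      let ?y = "x \<oplus>\<^bsub>E\<^esub> w \<odot>\<^bsub>E\<^esub> h" and ?x = "x \<oplus>\<^bsub>E\<^esub> z \<odot>\<^bsub>E\<^esub> h"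
      have yU: "?y \<in> U" and xU: "?x \<in> U"
        using w z by (auto intro: line)
      have diff: "?y \<ominus>\<^bsub>E\<^esub> ?x = (w - z) \<odot>\<^bsub>E\<^esub> h"
        using x h by (simp add: E.plus_minus_plus E.smult_diff)
      have nd: "vnorm E (?y \<ominus>\<^bsub>E\<^esub> ?x) = cmod (w - z) * vnorm E h"
        unfolding diff using h by (rule E.vnorm_smult)
      have "cmod (w - z) * vnorm E h \<le> cmod (w - z) * (vnorm E h + 1)"
        by (simp add: mult_left_mono)
      also have "\<dots> < \<delta>"
        using wz h0 by (simp add: field_simps)
      finally have le: "vnorm F (f ?y \<ominus>\<^bsub>F\<^esub> f ?x \<ominus>\<^bsub>F\<^esub> L (?y \<ominus>\<^bsub>E\<^esub> ?x)) \<le> \<epsilon> * (cmod (w - z) * vnorm E h)"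
        using \<delta>(2)[OF yU] nd by simp
      have Lin: "L (?y \<ominus>\<^bsub>E\<^esub> ?x) = (w - z) \<odot>\<^bsub>F\<^esub> L h" and Lh: "L h \<in> carrier F"
        unfolding diff using h lin by (simp_all add: linear_operatorD)
      let ?v = "f ?y \<ominus>\<^bsub>F\<^esub> f ?x \<ominus>\<^bsub>F\<^esub> L (?y \<ominus>\<^bsub>E\<^esub> ?x)"
      have v: "?v \<in> carrier F"
        unfolding Lin using fU[OF yU] fU[OF xU] Lh by simp
      have eq: "?\<phi> w - ?\<phi> z - \<psi> (L h) * (w - z) = \<psi> ?v"
        unfolding Lin using fU[OF yU] fU[OF xU] Lh by (simp add: \<psi>_minus \<psi>D)
      have 1: "cmod (\<psi> ?v) \<le> (\<bar>B\<bar> + 1) * vnorm F ?v"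
      proof (rule order_trans[OF \<psi>_le[OF v]])
        show "B * vnorm F ?v \<le> (\<bar>B\<bar> + 1) * vnorm F ?v"
          using F.vnorm_nonneg[OF v] by (intro mult_right_mono) auto
      qed
      have "cmod (w - z) * vnorm E h \<le> cmod (w - z) * (vnorm E h + 1)"
        by (simp add: mult_left_mono)
      then have 2: "vnorm F ?v \<le> \<epsilon> * (cmod (w - z) * (vnorm E h + 1))"
        using \<epsilon> by (intro order_trans[OF le] mult_left_mono) auto
      have "\<epsilon> * ((\<bar>B\<bar> + 1) * (vnorm E h + 1)) = e"
        using h0 by (simp add: \<epsilon>_def)
      then have 3: "(\<bar>B\<bar> + 1) * (\<epsilon> * (cmod (w - z) * (vnorm E h + 1))) = e * cmod (w - z)"
        by (metis mult.assoc mult.commute)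
      have "(\<bar>B\<bar> + 1) * vnorm F ?v \<le> (\<bar>B\<bar> + 1) * (\<epsilon> * (cmod (w - z) * (vnorm E h + 1)))"
        using 2 by (intro mult_left_mono) auto
      then show "norm (?\<phi> w - ?\<phi> z - \<psi> (L h) * (w - z)) \<le> e * norm (w - z)"
        unfolding eq 3 by (rule order_trans[OF 1])
    qed
  qed
  show "?\<phi> holomorphic_on ball 0 R"
    unfolding holomorphic_on_def
  proof
    fix z :: complex assume "z \<in> ball 0 R"
    then have z: "cmod z < R"
      by simp
    obtain L where "frechet_derivative E U F f (x \<oplus>\<^bsub>E\<^esub> z \<odot>\<^bsub>E\<^esub> h) L"
      using f line[OF z] unfolding holomorphic_map_iff by blast
    then show "?\<phi> field_differentiable at z within ball 0 R"
      using deriv[OF z] field_differentiable_def by blast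
  qed
  assume R: "R > 0" and "frechet_derivative E U F f x L"
  then have "(?\<phi> has_field_derivative \<psi> (L h)) (at 0 within ball 0 R)"
    using x h by (intro deriv) simp_all
  then show "deriv ?\<phi> 0 = \<psi> (L h)"
    using R by (intro DERIV_imp_deriv) (simp add: at_within_open[OF _ open_ball])
qed

text \<open>
  The inverse of \<open>J\<close> on its range is in general unbounded, so differentiability does not simply
  carry over from \<open>f = J \<circ> g\<close> to \<open>g\<close>. It does because \<open>f\<close> takes values in the closed absolutely convex set
  \<open>J ` K\<close>: a functional bounded by \<open>1\<close> on that set turns \<open>f\<close> on a complex line into a function bounded by
  \<open>1\<close>, for which the one-variable estimates hold. By the bipolar theorem, the derivative of \<open>f\<close> in a unit
  direction lies in \<open>(2 / R) J ` K\<close> and the first-order remainder in \<open>(32 |z|\<^sup>2 / R\<^sup>2) J ` K\<close>. Their preimages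
  lie in the same multiples of \<open>K\<close>, hence of the unit ball of \<open>X\<close>, and are the derivative and the
  remainder of \<open>g\<close>.
\<close>

lemma holomorphic_lift:
  assumes E: "complex_normed_space E" and X: "complex_normed_space X"
      and F: "complex_normed_space F"
    and U: "openin (vtopology E) U" and f: "holomorphic_map E U F f"
    and J: "linear_operator X F J" and inj: "inj_on J (carrier X)"
    and K: "K \<subseteq> unit_ball X" and closed: "closedin (vtopology F) (J ` K)"
    and absconv: "complex_normed_space.absolutely_convex F (J ` K)"
    and fK: "f ` U \<subseteq> J ` K"
    and g: "\<And>u. u \<in> U \<Longrightarrow> g u \<in> carrier X \<and> J (g u) = f u"
  shows "holomorphic_map E U X g"
proof -
  interpret E: complex_normed_space E by (rule E)
  interpret F: complex_normed_space F by (rule F)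
  interpret X: complex_normed_space X by (rule X)
  interpret J: linear_operator_between X F J by standard (rule J)
  have KX: "k \<in> carrier X" "vnorm X k \<le> 1" if "k \<in> K" for k
    using K that by (auto simp: unit_ball_def)
  have fU: "f u \<in> carrier F" if "u \<in> U" for u
    using f that by (auto simp: holomorphic_map_def)
  have "\<exists>L. frechet_derivative E U X g x L" if xU: "x \<in> U" for x
  proof -
    have x: "x \<in> carrier E"
      using U xU openin_subset by fastforce
    obtain R where R: "R > 0" "\<And>y. y \<in> carrier E \<Longrightarrow> vnorm E (y \<ominus>\<^bsub>E\<^esub> x) < R \<Longrightarrow> y \<in> U"
      using E.openin_ball[OF U xU] by metis
    obtain L where L: "frechet_derivative E U F f x L"
      using f xU unfolding holomorphic_map_iff by blast
    interpret L: linear_operator_between E F L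
      using L by unfold_locales (simp add: frechet_derivative_def bounded_operator_def)
    have line: "x \<oplus>\<^bsub>E\<^esub> z \<odot>\<^bsub>E\<^esub> h \<in> U" if h: "h \<in> unit_ball E" and z: "cmod z < R" for h z
    proof (rule R(2))
      have h': "h \<in> carrier E" "vnorm E h \<le> 1"
        using h by (auto simp: unit_ball_def)
      show "x \<oplus>\<^bsub>E\<^esub> z \<odot>\<^bsub>E\<^esub> h \<in> carrier E"
        using x h' by simp
      have "cmod z * vnorm E h \<le> cmod z"
        using h' by (simp add: mult_left_le)
      then show "vnorm E (x \<oplus>\<^bsub>E\<^esub> z \<odot>\<^bsub>E\<^esub> h \<ominus>\<^bsub>E\<^esub> x) < R"
        using x h' z by (simp add: E.vnorm_smult)
    qed
    have deriv_in: "complex_of_real (R / 2) \<odot>\<^bsub>F\<^esub> L h \<in> J ` K"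
      and rem_in: "\<And>z. cmod z < R / 2 \<Longrightarrow> z \<noteq> 0 \<Longrightarrow>
        complex_of_real (R\<^sup>2 / (32 * (cmod z)\<^sup>2)) \<odot>\<^bsub>F\<^esub>
          (f (x \<oplus>\<^bsub>E\<^esub> z \<odot>\<^bsub>E\<^esub> h) \<ominus>\<^bsub>F\<^esub> f x \<ominus>\<^bsub>F\<^esub> L (z \<odot>\<^bsub>E\<^esub> h)) \<in> J ` K"
      if h: "h \<in> unit_ball E" for h
    proof -
      have h': "h \<in> carrier E"
        using h by (auto simp: unit_ball_def)
      note line = line[OF h]
      have est: "cmod (\<psi> (L h)) \<le> 2 / R \<and> (\<forall>z. cmod z < R / 2 \<longrightarrow>
          cmod (\<psi> (f (x \<oplus>\<^bsub>E\<^esub> z \<odot>\<^bsub>E\<^esub> h) \<ominus>\<^bsub>F\<^esub> f x \<ominus>\<^bsub>F\<^esub> L (z \<odot>\<^bsub>E\<^esub> h))) \<le> 32 / R\<^sup>2 * (cmod z)\<^sup>2)"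
        if \<psi>: "bounded_operator F complex_space \<psi>"
          and \<psi>K: "\<And>y. y \<in> J ` K \<Longrightarrow> cmod (\<psi> y) \<le> 1" for \<psi>
      proof -
        let ?\<phi> = "\<lambda>z. \<psi> (f (x \<oplus>\<^bsub>E\<^esub> z \<odot>\<^bsub>E\<^esub> h))"
        have hol: "?\<phi> holomorphic_on ball 0 R"
          by (rule functional_along_line(1)[OF E F f x h' _ \<psi>]) (fact line)
        have le: "cmod (?\<phi> z) \<le> 1" if "cmod z < R" for z
          using line[OF that] fK by (intro \<psi>K) auto
        have d: "deriv ?\<phi> 0 = \<psi> (L h)"
          by (rule functional_along_line(2)[OF E F f x h' _ \<psi> R(1) L]) (fact line)
        have eq: "?\<phi> z - ?\<phi> 0 - z * deriv ?\<phi> 0 =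
            \<psi> (f (x \<oplus>\<^bsub>E\<^esub> z \<odot>\<^bsub>E\<^esub> h) \<ominus>\<^bsub>F\<^esub> f x \<ominus>\<^bsub>F\<^esub> L (z \<odot>\<^bsub>E\<^esub> h))" if "cmod z < R / 2" for z
        proof -
          have "x \<oplus>\<^bsub>E\<^esub> z \<odot>\<^bsub>E\<^esub> h \<in> U"
            using that R(1) by (intro line) simp
          then show ?thesis
            using fU xU x h' unfolding d by (simp add: F.minus_eq_smult bounded_functionalD[OF \<psi>]
                L.smult)
        qed
        have "cmod (deriv ?\<phi> 0) \<le> 2 / R"
          by (rule bounded_holomorphic_estimates(1)[OF R(1) hol]) (fact le)
        moreover have "cmod (?\<phi> z - ?\<phi> 0 - z * deriv ?\<phi> 0) \<le> 32 / R\<^sup>2 * (cmod z)\<^sup>2"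
            if "cmod z < R / 2" for z
          by (rule bounded_holomorphic_estimates(2)[OF R(1) hol]) (fact le that)+
        ultimately show ?thesis
          using d eq by simp
      qed
      show "complex_of_real (R / 2) \<odot>\<^bsub>F\<^esub> L h \<in> J ` K"
      proof (rule F.bipolar[OF closed absconv])
        show "complex_of_real (R / 2) \<odot>\<^bsub>F\<^esub> L h \<in> carrier F"
          using h' by simp
        fix \<psi>
        assume \<psi>: "bounded_operator F complex_space \<psi>"
          and \<psi>K: "\<And>y. y \<in> J ` K \<Longrightarrow> cmod (\<psi> y) \<le> 1"
        have "cmod (\<psi> (L h)) \<le> 2 / R"
          by (rule conjunct1[OF est[OF \<psi>]]) (fact \<psi>K)
        then have "R / 2 * cmod (\<psi> (L h)) \<le> R / 2 * (2 / R)"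
          using R(1) by (intro mult_left_mono) auto
        then show "cmod (\<psi> (complex_of_real (R / 2) \<odot>\<^bsub>F\<^esub> L h)) \<le> 1"
          using R(1) h' by (simp add: bounded_functionalD(2)[OF \<psi>] norm_mult norm_divide)
      qed
      fix z :: complex assume z: "cmod z < R / 2" "z \<noteq> 0"
      let ?w = "f (x \<oplus>\<^bsub>E\<^esub> z \<odot>\<^bsub>E\<^esub> h) \<ominus>\<^bsub>F\<^esub> f x \<ominus>\<^bsub>F\<^esub> L (z \<odot>\<^bsub>E\<^esub> h)" and ?s = "R\<^sup>2 / (32 * (cmod z)\<^sup>2)"
      have "x \<oplus>\<^bsub>E\<^esub> z \<odot>\<^bsub>E\<^esub> h \<in> U"
        using z R(1) by (intro line) simp
      then have w: "?w \<in> carrier F"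
        using fU xU h' by simp
      have s: "?s > 0"
        using R(1) z by simp
      show "complex_of_real ?s \<odot>\<^bsub>F\<^esub> ?w \<in> J ` K"
      proof (rule F.bipolar[OF closed absconv])
        show "complex_of_real ?s \<odot>\<^bsub>F\<^esub> ?w \<in> carrier F"
          using w by (rule F.smult_in)
        fix \<psi>
        assume \<psi>: "bounded_operator F complex_space \<psi>"
          and \<psi>K: "\<And>y. y \<in> J ` K \<Longrightarrow> cmod (\<psi> y) \<le> 1"
        have "\<forall>z. cmod z < R / 2 \<longrightarrow>
            cmod (\<psi> (f (x \<oplus>\<^bsub>E\<^esub> z \<odot>\<^bsub>E\<^esub> h) \<ominus>\<^bsub>F\<^esub> f x \<ominus>\<^bsub>F\<^esub> L (z \<odot>\<^bsub>E\<^esub> h))) \<le> 32 / R\<^sup>2 * (cmod z)\<^sup>2"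
          by (rule conjunct2[OF est[OF \<psi>]]) (fact \<psi>K)
        then have "?s * cmod (\<psi> ?w) \<le> ?s * (32 / R\<^sup>2 * (cmod z)\<^sup>2)"
          using s z by (intro mult_left_mono) auto
        also have "\<dots> = 1"
          using R(1) z by simp
        finally show "cmod (\<psi> (complex_of_real ?s \<odot>\<^bsub>F\<^esub> ?w)) \<le> 1"
          unfolding bounded_functionalD(2)[OF \<psi> w] norm_mult norm_of_real abs_of_pos[OF s] .
      qed
    qed
    have in_range: "\<exists>v\<in>carrier X. J v = L h" if h: "h \<in> carrier E" for h
    proof (cases "h = \<zero>\<^bsub>E\<^esub>")
      case True
      then show ?thesis
        using L.zero J.zero by (intro bexI[of _ "\<zero>\<^bsub>X\<^esub>"]) auto
    next
      case False
      then have n: "vnorm E h > 0"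
        using E.vnorm_zero_iff[OF h] E.vnorm_nonneg[OF h] by linarith
      let ?h = "complex_of_real (1 / vnorm E h) \<odot>\<^bsub>E\<^esub> h"
      have "?h \<in> unit_ball E"
        using h n by (simp add: unit_ball_def E.vnorm_smult norm_divide)
      then obtain k where k: "k \<in> K" "J k = complex_of_real (R / 2) \<odot>\<^bsub>F\<^esub> L ?h"
        using deriv_in by (metis imageE)
      have "J (complex_of_real (2 * vnorm E h / R) \<odot>\<^bsub>X\<^esub> k) =
          complex_of_real (2 * vnorm E h / R) \<odot>\<^bsub>F\<^esub> J k"
        using KX k by (simp add: J.smult)
      also have "\<dots> = L h"
        unfolding k(2) using h n R(1) by (simp add: L.smult F.smult_smult)
      finally show ?thesis
        using KX[OF k(1)] by (intro bexI[of _ "complex_of_real (2 * vnorm E h / R) \<odot>\<^bsub>X\<^esub> k"]) auto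
    qed
    define G where "G = (\<lambda>h. the_inv_into (carrier X) J (L h))"
    have G: "G h \<in> carrier X" "J (G h) = L h" if "h \<in> carrier E" for h
    proof -
      have "L h \<in> J ` carrier X"
        using in_range[OF that] by force
      then show "G h \<in> carrier X" "J (G h) = L h"
        using inj by (auto simp: G_def f_the_inv_into_f intro: the_inv_into_into)
    qed
    have injD: "v = w" if "J v = J w" "v \<in> carrier X" "w \<in> carrier X" for v w
      using inj that by (rule inj_onD)
    have linG: "linear_operator E X G"
      by (rule linear_operatorI) (auto intro!: injD simp: G J.add J.smult L.add L.smult)
    interpret G: linear_operator_between E X G
      by standard (rule linG)
    have "vnorm X (G h) \<le> 2 / R * vnorm E h" if "h \<in> carrier E" for h
    proof (rule G.vnorm_le_of_unit_ball[OF _ that])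
      fix h assume h: "h \<in> unit_ball E"
      then have h': "h \<in> carrier E"
        by (simp add: unit_ball_def)
      obtain k where k: "k \<in> K" "J k = complex_of_real (R / 2) \<odot>\<^bsub>F\<^esub> L h"
        using deriv_in[OF h] by force
      have "k = complex_of_real (R / 2) \<odot>\<^bsub>X\<^esub> G h"
        using k h' KX by (intro injD) (simp_all add: J.smult G)
      then have "vnorm X k = R / 2 * vnorm X (G h)"
        using h' R(1) by (simp add: X.vnorm_smult norm_divide)
      then show "vnorm X (G h) \<le> 2 / R"
        using KX(2)[OF k(1)] R(1) by (simp add: field_simps)
    qed
    then have bG: "bounded_operator E X G"
      using linG unfolding bounded_operator_def by blast
    have "\<exists>\<delta> > 0. \<forall>y \<in> U. vnorm E (y \<ominus>\<^bsub>E\<^esub> x) < \<delta> \<longrightarrow>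
           vnorm X (g y \<ominus>\<^bsub>X\<^esub> g x \<ominus>\<^bsub>X\<^esub> G (y \<ominus>\<^bsub>E\<^esub> x)) \<le> \<epsilon> * vnorm E (y \<ominus>\<^bsub>E\<^esub> x)"
      if \<epsilon>: "\<epsilon> > 0" for \<epsilon>
    proof (intro exI[of _ "min (R / 2) (\<epsilon> * R\<^sup>2 / 32)"] conjI ballI impI)
      show "min (R / 2) (\<epsilon> * R\<^sup>2 / 32) > 0"
        using R(1) \<epsilon> by simp
      fix y assume yU: "y \<in> U" and lt: "vnorm E (y \<ominus>\<^bsub>E\<^esub> x) < min (R / 2) (\<epsilon> * R\<^sup>2 / 32)"
      have y: "y \<in> carrier E"
        using U yU openin_subset by fastforce
      define n where "n = vnorm E (y \<ominus>\<^bsub>E\<^esub> x)"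
      show "vnorm X (g y \<ominus>\<^bsub>X\<^esub> g x \<ominus>\<^bsub>X\<^esub> G (y \<ominus>\<^bsub>E\<^esub> x)) \<le> \<epsilon> * vnorm E (y \<ominus>\<^bsub>E\<^esub> x)"
      proof (cases "y = x")
        case True
        then show ?thesis
          using g[OF xU] x by (simp add: G.zero E.vnorm_zero X.vnorm_zero)
      next
        case False
        then have n: "n > 0"
          using x y E.vnorm_nonneg[of "y \<ominus>\<^bsub>E\<^esub> x"] E.vnorm_zero_iff[of "y \<ominus>\<^bsub>E\<^esub> x"]
              E.minus_eq_zero_iff[of y x]
          by (simp add: n_def less_le)
        define h where "h = complex_of_real (1 / n) \<odot>\<^bsub>E\<^esub> (y \<ominus>\<^bsub>E\<^esub> x)"
        have h: "h \<in> unit_ball E" and h': "h \<in> carrier E"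
          using x y n by (simp_all add: h_def unit_ball_def E.vnorm_smult norm_divide n_def)
        have nh: "complex_of_real n \<odot>\<^bsub>E\<^esub> h = y \<ominus>\<^bsub>E\<^esub> x"
          using x y n by (simp add: h_def E.smult_smult)
        have "x \<oplus>\<^bsub>E\<^esub> complex_of_real n \<odot>\<^bsub>E\<^esub> h = y"
          unfolding nh using x y by (subst E.M.a_comm) simp_all
        then have "complex_of_real (R\<^sup>2 / (32 * n\<^sup>2)) \<odot>\<^bsub>F\<^esub> (f y \<ominus>\<^bsub>F\<^esub> f x \<ominus>\<^bsub>F\<^esub> L (y \<ominus>\<^bsub>E\<^esub> x)) \<in> J ` K"
          using rem_in[OF h, of "complex_of_real n"] n lt nh by (simp add: n_def)
        then obtain k where k: "k \<in> K"
          "J k = complex_of_real (R\<^sup>2 / (32 * n\<^sup>2)) \<odot>\<^bsub>F\<^esub> (f y \<ominus>\<^bsub>F\<^esub> f x \<ominus>\<^bsub>F\<^esub> L (y \<ominus>\<^bsub>E\<^esub> x))"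
          by force
        let ?w = "g y \<ominus>\<^bsub>X\<^esub> g x \<ominus>\<^bsub>X\<^esub> G (y \<ominus>\<^bsub>E\<^esub> x)"
        have w: "?w \<in> carrier X"
          using g[OF yU] g[OF xU] x y by simp
        have Jw: "J ?w = f y \<ominus>\<^bsub>F\<^esub> f x \<ominus>\<^bsub>F\<^esub> L (y \<ominus>\<^bsub>E\<^esub> x)"
          using g[OF yU] g[OF xU] x y by (simp add: J.minus G)
        have "k = complex_of_real (R\<^sup>2 / (32 * n\<^sup>2)) \<odot>\<^bsub>X\<^esub> ?w"
          using k KX w Jw by (intro injD) (simp_all add: J.smult)
        then have "vnorm X k = R\<^sup>2 / (32 * n\<^sup>2) * vnorm X ?w"
          using w by (simp only: X.vnorm_smult norm_of_real) simp
        then have "R\<^sup>2 / (32 * n\<^sup>2) * vnorm X ?w \<le> 1"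
          using KX(2)[OF k(1)] by simp
        then have "vnorm X ?w \<le> 32 * n\<^sup>2 / R\<^sup>2"
          using R(1) n by (simp add: field_simps)
        also have "\<dots> = (32 * n / R\<^sup>2) * n"
          by (simp add: power2_eq_square)
        also have "\<dots> \<le> \<epsilon> * n"
          using lt n R(1) by (intro mult_right_mono) (auto simp: n_def field_simps)
        finally show ?thesis
          by (simp add: n_def)
      qed
    qed
    then show ?thesis
      using bG unfolding frechet_derivative_def by blast
  qed
  then show ?thesis
    using g by (auto simp: holomorphic_map_iff)
qed

section \<open>Quotient spaces\<close>

lemma (in complex_banach_space) summable_increments_limitin:
  assumes x: "\<And>k. x k \<in> carrier V"
    and c: "\<And>k. vnorm V (x (Suc k) \<ominus> x k) \<le> c k" "summable c"
  shows "\<exists>l. limitin (vtopology V) x l sequentially"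
proof (rule Cauchy_limitin)
  have le: "vnorm V (x (n + j) \<ominus> x n) \<le> sum c {n..<n + j}" for n j
  proof (induction j)
    case 0
    then show ?case
      using x by (simp add: vnorm_zero)
  next
    case (Suc j)
    have "vnorm V (x (n + Suc j) \<ominus> x n) \<le>
        vnorm V (x (Suc (n + j)) \<ominus> x (n + j)) + vnorm V (x (n + j) \<ominus> x n)"
      using x vnorm_minus_triangle by simp
    then show ?case
      using Suc c(1)[of "n + j"] by simp
  qed
  show "\<forall>\<epsilon>>0. \<exists>N. \<forall>m\<ge>N. \<forall>n\<ge>N. vnorm V (x m \<ominus> x n) < \<epsilon>"
  proof (intro allI impI)
    fix \<epsilon> :: real assume "\<epsilon> > 0"
    then obtain N where N: "\<And>m n. m \<ge> N \<Longrightarrow> \<bar>sum c {m..<n}\<bar> < \<epsilon>"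
      using c(2) unfolding summable_Cauchy real_norm_def by metis
    have half: "vnorm V (x m \<ominus> x n) < \<epsilon>" if "n \<ge> N" "n \<le> m" for m n
      using le[of n "m - n"] N[OF that(1), of m] that by simp
    have "vnorm V (x m \<ominus> x n) < \<epsilon>" if "m \<ge> N" "n \<ge> N" for m n
      using half[of n m] half[of m n] that x vnorm_minus_commute[of "x m" "x n"] by (cases "n \<le>
          m") auto
    then show "\<exists>N. \<forall>m\<ge>N. \<forall>n\<ge>N. vnorm V (x m \<ominus> x n) < \<epsilon>"
      by blast
  qed
qed (use x in auto)

text \<open>
  A surjective linear map \<open>\<pi>\<close> that carries the quotient norm to \<open>W\<close> and has closed kernel. The coset
  space is one instance; the other one is a copy of a quotient with its carrier in a prescribed type.
\<close>

locale quotient_map = V: complex_banach_space V for V :: "'a cnspace" and W :: "'b cnspace"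
    and \<pi> :: "'a \<Rightarrow> 'b" +
  assumes carrier_eq: "carrier W = \<pi> ` carrier V"
    and add: "\<And>x y. x \<in> carrier V \<Longrightarrow> y \<in> carrier V \<Longrightarrow> \<pi> (x \<oplus>\<^bsub>V\<^esub> y) = \<pi> x \<oplus>\<^bsub>W\<^esub> \<pi> y"
    and smult: "\<And>c x. x \<in> carrier V \<Longrightarrow> \<pi> (c \<odot>\<^bsub>V\<^esub> x) = c \<odot>\<^bsub>W\<^esub> \<pi> x"
    and zero: "\<pi> \<zero>\<^bsub>V\<^esub> = \<zero>\<^bsub>W\<^esub>"
    and vnorm_eq: "\<And>x. x \<in> carrier V \<Longrightarrow>
      vnorm W (\<pi> x) = Inf (vnorm V ` {y \<in> carrier V. \<pi> y = \<pi> x})"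
    and kernel_closed: "closedin (vtopology V) {x \<in> carrier V. \<pi> x = \<zero>\<^bsub>W\<^esub>}"
begin

lemma vnorm_le:
  assumes "x \<in> carrier V"
  shows "vnorm W (\<pi> x) \<le> vnorm V x"
  unfolding vnorm_eq[OF assms]
  using assms V.vnorm_nonneg by (intro cInf_lower bdd_belowI[where m = 0]) auto

lemma le_vnorm:
  assumes "x \<in> carrier V" "\<And>y. y \<in> carrier V \<Longrightarrow> \<pi> y = \<pi> x \<Longrightarrow> r \<le> vnorm V y"
  shows "r \<le> vnorm W (\<pi> x)"
  unfolding vnorm_eq[OF assms(1)] using assms by (intro cInf_greatest) auto

lemma lift:
  assumes "A \<in> carrier W" "vnorm W A < r"
  obtains x where "x \<in> carrier V" "\<pi> x = A" "vnorm V x < r"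
proof -
  obtain z where z: "z \<in> carrier V" "A = \<pi> z"
    using assms(1) carrier_eq by auto
  have "\<exists>x. x \<in> carrier V \<and> \<pi> x = A \<and> vnorm V x < r"
  proof (rule ccontr)
    assume "\<nexists>x. x \<in> carrier V \<and> \<pi> x = A \<and> vnorm V x < r"
    then have "r \<le> vnorm W (\<pi> z)"
      using z by (intro le_vnorm) force+
    then show False
      using assms(2) z by simp
  qed
  then show thesis
    using that by blast
qed

lemma complex_normed_space: "complex_normed_space W"
proof (rule complex_normed_spaceI)
  have rep: "\<exists>x\<in>carrier V. A = \<pi> x" if "A \<in> carrier W" for A
    using that carrier_eq by auto
  have in_W: "\<pi> x \<in> carrier W" if "x \<in> carrier V" for x
    using that carrier_eq by auto
  show "\<zero>\<^bsub>W\<^esub> \<in> carrier W"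
    using in_W zero[symmetric] by simp
  fix A assume "A \<in> carrier W"
  then obtain x where x: "x \<in> carrier V" and A: "A = \<pi> x"
    using rep by blast
  show "c \<odot>\<^bsub>W\<^esub> A \<in> carrier W" for c
    using x in_W by (simp add: A flip: smult)
  show "\<zero>\<^bsub>W\<^esub> \<oplus>\<^bsub>W\<^esub> A = A" "0 \<odot>\<^bsub>W\<^esub> A = \<zero>\<^bsub>W\<^esub>" "1 \<odot>\<^bsub>W\<^esub> A = A"
    using x by (simp_all add: A flip: zero add smult)
  show "(a + b) \<odot>\<^bsub>W\<^esub> A = a \<odot>\<^bsub>W\<^esub> A \<oplus>\<^bsub>W\<^esub> b \<odot>\<^bsub>W\<^esub> A" "(a * b) \<odot>\<^bsub>W\<^esub> A = a \<odot>\<^bsub>W\<^esub> (b \<odot>\<^bsub>W\<^esub> A)" for a b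
    using x by (simp_all add: A V.smult_plus V.smult_smult flip: zero add smult)
  have norm_smult_le: "vnorm W (\<pi> (c \<odot>\<^bsub>V\<^esub> x)) \<le> cmod c * vnorm W (\<pi> x)" if c: "c \<noteq> 0"
      and x: "x \<in> carrier V" for c x
  proof -
    have "vnorm W (\<pi> (c \<odot>\<^bsub>V\<^esub> x)) / cmod c \<le> vnorm W (\<pi> x)"
    proof (rule le_vnorm[OF x])
      fix y assume y: "y \<in> carrier V" "\<pi> y = \<pi> x"
      have "\<pi> (c \<odot>\<^bsub>V\<^esub> x) = \<pi> (c \<odot>\<^bsub>V\<^esub> y)"
        using x y by (simp add: smult)
      then show "vnorm W (\<pi> (c \<odot>\<^bsub>V\<^esub> x)) / cmod c \<le> vnorm V y"
        using vnorm_le[of "c \<odot>\<^bsub>V\<^esub> y"] y c by (simp add: V.vnorm_smult field_simps)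
    qed
    then show ?thesis
      using c by (simp add: field_simps)
  qed
  show "vnorm W (c \<odot>\<^bsub>W\<^esub> A) = cmod c * vnorm W A" for c
  proof (cases "c = 0")
    case True
    have "vnorm W (\<pi> \<zero>\<^bsub>V\<^esub>) = 0"
    proof (rule antisym)
      show "vnorm W (\<pi> \<zero>\<^bsub>V\<^esub>) \<le> 0"
        using vnorm_le[of "\<zero>\<^bsub>V\<^esub>"] by (simp add: V.vnorm_zero)
      show "0 \<le> vnorm W (\<pi> \<zero>\<^bsub>V\<^esub>)"
        by (rule le_vnorm) (auto intro: V.vnorm_nonneg)
    qed
    then show ?thesis
      using True x by (simp add: A flip: smult)
  next
    case False
    have "vnorm W (\<pi> (inverse c \<odot>\<^bsub>V\<^esub> (c \<odot>\<^bsub>V\<^esub> x))) \<le> cmod (inverse c) * vnorm W (\<pi> (c \<odot>\<^bsub>V\<^esub> x))"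
      using False x by (intro norm_smult_le) auto
    then have "cmod c * vnorm W (\<pi> x) \<le> vnorm W (\<pi> (c \<odot>\<^bsub>V\<^esub> x))"
      using False x by (simp add: V.smult_smult norm_divide field_simps)
    then show ?thesis
      using norm_smult_le[OF False x] x by (simp add: A flip: smult)
  qed
  show "A = \<zero>\<^bsub>W\<^esub>" if "vnorm W A = 0"
  proof -
    have "\<exists>y. y \<in> carrier V \<and> \<pi> y = A \<and> vnorm V y < 1 / (real n + 1)" for n
    proof -
      have "vnorm W A < 1 / (real n + 1)"
        using that by simp
      then show ?thesis
        using lift[OF \<open>A \<in> carrier W\<close>] by blast
    qed
    then obtain y where y: "\<And>n. y n \<in> carrier V" "\<And>n. \<pi> (y n) =
        A" "\<And>n. vnorm V (y n) < 1 / (real n + 1)"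
      by metis
    have "(\<lambda>n. vnorm V (x \<ominus>\<^bsub>V\<^esub> y n \<ominus>\<^bsub>V\<^esub> x)) \<longlonglongrightarrow> 0"
    proof (rule tendsto_sandwich[OF _ _ tendsto_const])
      have "x \<ominus>\<^bsub>V\<^esub> y n \<ominus>\<^bsub>V\<^esub> x = \<ominus>\<^bsub>V\<^esub> y n" for n
        using x y(1)[of n] by (simp add: a_minus_def[of V] V.M.a_ac V.M.r_neg1 V.M.r_neg2)
      then show "\<forall>\<^sub>F n in sequentially. vnorm V (x \<ominus>\<^bsub>V\<^esub> y n \<ominus>\<^bsub>V\<^esub> x) \<le> 1 / (real n + 1)"
        using y by (simp add: V.vnorm_uminus less_imp_le)
      show "(\<lambda>n. 1 / (real n + 1)) \<longlonglongrightarrow> 0"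
        by real_asymp
    qed (use x y in \<open>auto simp: V.vnorm_nonneg\<close>)
    then have "limitin (vtopology V) (\<lambda>n. x \<ominus>\<^bsub>V\<^esub> y n) x sequentially"
      using x y by (intro V.limitinI) auto
    moreover have "\<pi> (x \<ominus>\<^bsub>V\<^esub> y n) = \<zero>\<^bsub>W\<^esub>" for n
    proof -
      have "\<pi> (x \<ominus>\<^bsub>V\<^esub> y n) = \<pi> x \<oplus>\<^bsub>W\<^esub> (- 1) \<odot>\<^bsub>W\<^esub> \<pi> (y n)"
        using x y(1) by (simp add: V.minus_eq_smult add smult)
      also have "\<dots> = \<pi> x \<oplus>\<^bsub>W\<^esub> (- 1) \<odot>\<^bsub>W\<^esub> \<pi> x"
        using A y(2) by simp
      also have "\<dots> = \<pi> (x \<ominus>\<^bsub>V\<^esub> x)"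
        using x by (simp add: V.minus_eq_smult add smult del: V.minus_self)
      finally show ?thesis
        using x by (simp add: zero)
    qed
    ultimately have "x \<in> {x \<in> carrier V. \<pi> x = \<zero>\<^bsub>W\<^esub>}"
      using kernel_closed x y unfolding V.closedin_sequentially
      by (metis (mono_tags, lifting) V.minus_in image_subsetI mem_Collect_eq)
    then show ?thesis
      by (simp add: A)
  qed
  fix B assume "B \<in> carrier W"
  then obtain y where y: "y \<in> carrier V" and B: "B = \<pi> y"
    using rep by blast
  show "A \<oplus>\<^bsub>W\<^esub> B \<in> carrier W" "A \<oplus>\<^bsub>W\<^esub> B = B \<oplus>\<^bsub>W\<^esub> A"
    using x y in_W by (simp_all add: A B V.M.a_comm flip: add)
  show "a \<odot>\<^bsub>W\<^esub> (A \<oplus>\<^bsub>W\<^esub> B) = a \<odot>\<^bsub>W\<^esub> A \<oplus>\<^bsub>W\<^esub> a \<odot>\<^bsub>W\<^esub> B" for a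
    using x y by (simp add: A B V.smult_distrib flip: add smult)
  show "vnorm W (A \<oplus>\<^bsub>W\<^esub> B) \<le> vnorm W A + vnorm W B"
  proof (rule field_le_epsilon)
    fix e :: real assume "e > 0"
    obtain v where v: "v \<in> carrier V" "\<pi> v = A" "vnorm V v < vnorm W A + e / 2"
      using lift[of A "vnorm W A + e / 2"] \<open>A \<in> carrier W\<close> \<open>e > 0\<close> by auto
    obtain w where w: "w \<in> carrier V" "\<pi> w = B" "vnorm V w < vnorm W B + e / 2"
      using lift[of B "vnorm W B + e / 2"] \<open>B \<in> carrier W\<close> \<open>e > 0\<close> by auto
    show "vnorm W (A \<oplus>\<^bsub>W\<^esub> B) \<le> vnorm W A + vnorm W B + e"
      using vnorm_le[of "v \<oplus>\<^bsub>V\<^esub> w"] V.vnorm_triangle[of v w] v w by (simp add: add)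
  qed
  fix C assume "C \<in> carrier W"
  then obtain z where z: "z \<in> carrier V" and C: "C = \<pi> z"
    using rep by blast
  show "(A \<oplus>\<^bsub>W\<^esub> B) \<oplus>\<^bsub>W\<^esub> C = A \<oplus>\<^bsub>W\<^esub> (B \<oplus>\<^bsub>W\<^esub> C)"
    using x y z by (simp add: A B C V.M.a_assoc flip: add)
qed

sublocale W: complex_normed_space W
  by (rule complex_normed_space)

lemma linear_operator: "linear_operator V W \<pi>"
  by (rule linear_operatorI) (use carrier_eq in \<open>auto simp: add smult\<close>)

sublocale \<pi>: linear_operator_between V W \<pi>
  by standard (rule linear_operator)

lemma limitin_quotient:
  "range s \<subseteq> carrier V \<Longrightarrow> limitin (vtopology V) s l sequentially \<Longrightarrow>
    limitin (vtopology W) (\<lambda>n. \<pi> (s n)) (\<pi> l) sequentially"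
  using \<pi>.limitin_image[of 1 s l] vnorm_le by simp

text \<open>
  A Cauchy sequence has a subsequence whose increments are below \<open>(1/2)\<^sup>k\<close> in norm. These increments lift
  to vectors of \<open>V\<close> with the same bound, whose sums converge.
\<close>

lemma complex_banach_space: "complex_banach_space W"
proof (rule W.complex_banach_spaceI)
  fix s :: "nat \<Rightarrow> 'b"
  assume sW: "range s \<subseteq> carrier W" and Cauchy: "\<forall>\<epsilon>>0. \<exists>N. \<forall>m\<ge>N. \<forall>n\<ge>N. vnorm W (s m \<ominus>\<^bsub>W\<^esub> s n) < \<epsilon>"
  have s: "s n \<in> carrier W" for n
    using sW by auto
  have "\<exists>N. \<forall>m\<ge>N. \<forall>n\<ge>N. vnorm W (s m \<ominus>\<^bsub>W\<^esub> s n) < (1 / 2) ^ k" for k :: nat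
    using Cauchy by simp
  then obtain N where N: "\<And>k m n. m \<ge> N k \<Longrightarrow> n \<ge> N k \<Longrightarrow> vnorm W (s m \<ominus>\<^bsub>W\<^esub> s n) < (1 / 2) ^ k"
    by metis
  \<comment> \<open>Summing the bounds makes \<open>r k\<close> strictly increasing and at least \<open>N k\<close>.\<close>
  define r where "r = (\<lambda>k. k + (\<Sum>i\<le>k. N i))"
  have r: "strict_mono r"
    by (rule strict_monoI_Suc) (simp add: r_def)
  have rN: "r k \<ge> N k" "r (Suc k) \<ge> N k" for k
  proof -
    have "N k \<le> (\<Sum>i\<le>k. N i)"
      by (rule member_le_sum) auto
    then show "r k \<ge> N k" "r (Suc k) \<ge> N k"
      by (simp_all add: r_def)
  qed
  have "\<exists>d. d \<in> carrier V \<and> \<pi> d = s (r (Suc k)) \<ominus>\<^bsub>W\<^esub> s (r k) \<and> vnorm V d < (1 / 2) ^ k" for k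
    using lift[OF _ N[OF rN(2) rN(1)]] s by (metis W.minus_in)
  then obtain d where d: "\<And>k. d k \<in> carrier V" "\<And>k. \<pi> (d k) = s (r (Suc k)) \<ominus>\<^bsub>W\<^esub> s (r k)"
    "\<And>k. vnorm V (d k) < (1 / 2) ^ k"
    by metis
  obtain x0 where x0: "x0 \<in> carrier V" "\<pi> x0 = s (r 0)"
    using s[of "r 0"] carrier_eq by auto
  define x where "x = rec_nat x0 (\<lambda>k y. y \<oplus>\<^bsub>V\<^esub> d k)"
  have xS: "x 0 = x0" "x (Suc k) = x k \<oplus>\<^bsub>V\<^esub> d k" for k
    by (simp_all add: x_def)
  have x: "x k \<in> carrier V" for k
    by (induction k) (use x0 d in \<open>auto simp: xS\<close>)
  have \<pi>x: "\<pi> (x k) = s (r k)" for k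
  proof (induction k)
    case (Suc k)
    then show ?case
      using x d s by (simp add: xS add W.M.a_comm[of "s (r k)"])
  qed (simp add: xS x0)
  obtain l where l: "limitin (vtopology V) x l sequentially"
    using V.summable_increments_limitin[of x "\<lambda>k. (1 / 2) ^ k"] x d
    by (auto simp: xS less_imp_le summable_geometric)
  have "limitin (vtopology W) (\<lambda>k. \<pi> (x k)) (\<pi> l) sequentially"
    using x l by (intro limitin_quotient) auto
  then have "limitin (vtopology W) (s \<circ> r) (\<pi> l) sequentially"
    by (simp add: \<pi>x comp_def)
  moreover have "Metric_space.MCauchy (carrier W) (vdist W) s"
    using sW Cauchy by (simp add: W.MCauchy_vdist)
  ultimately have "limitin (vtopology W) s (\<pi> l) sequentially"
    using r Metric_space.MCauchy_convergent_subsequence[OF W.Metric_space_vdist]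
    unfolding vtopology_def by blast
  then show "\<exists>l. limitin (vtopology W) s l sequentially"
    by blast
qed

lemma induced_operator:
  assumes Y: "complex_normed_space Y" and \<phi>: "linear_operator V Y \<phi>"
    and ker: "\<And>x. x \<in> carrier V \<Longrightarrow> \<pi> x = \<zero>\<^bsub>W\<^esub> \<Longrightarrow> \<phi> x = \<zero>\<^bsub>Y\<^esub>"
  obtains \<psi> where "linear_operator W Y \<psi>" "\<And>x. x \<in> carrier V \<Longrightarrow> \<psi> (\<pi> x) = \<phi> x"
proof -
  interpret Y: complex_normed_space Y by (rule Y)
  interpret \<phi>: linear_operator_between V Y \<phi> by standard (rule \<phi>)
  define \<psi> where "\<psi> = (\<lambda>A. \<phi> (inv_into (carrier V) \<pi> A))"
  have \<psi>: "\<psi> (\<pi> x) = \<phi> x" if x: "x \<in> carrier V" for x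
  proof -
    let ?y = "inv_into (carrier V) \<pi> (\<pi> x)"
    have y: "?y \<in> carrier V" "\<pi> ?y = \<pi> x"
      using x by (auto intro: inv_into_into f_inv_into_f)
    have "\<phi> (?y \<ominus>\<^bsub>V\<^esub> x) = \<zero>\<^bsub>Y\<^esub>"
      using x y by (intro ker) (auto simp: \<pi>.minus)
    then show ?thesis
      using x y by (simp add: \<psi>_def \<phi>.minus Y.minus_eq_zero_iff)
  qed
  have "linear_operator W Y \<psi>"
    by (rule linear_operatorI) (auto simp: carrier_eq \<psi> \<phi>.add \<phi>.smult simp flip: add smult)
  then show thesis
    using \<psi> that by blast
qed

end

lemma quotient_space_quotient_map:
  assumes V: "complex_banach_space V" and M: "closed_subspace M V"
  shows "quotient_map V (quotient_space V M) (\<lambda>x. M +>\<^bsub>V\<^esub> x)"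
    and "x \<in> carrier V \<Longrightarrow> M +>\<^bsub>V\<^esub> x = \<zero>\<^bsub>quotient_space V M\<^esub> \<longleftrightarrow> x \<in> M"
proof -
  interpret V: complex_banach_space V by (rule V)
  have sub: "submodule M complex_field V" and closed: "closedin (vtopology V) M"
    using M by (auto simp: closed_subspace_def)
  note subD = V.submoduleE[OF sub]
  interpret abelian_subgroup M V
    using submodule.axioms(1)[OF sub]
    by (intro abelian_subgroupI3 additive_subgroup.intro) (auto intro: V.M.abelian_group_axioms)
  have MC: "m \<in> carrier V" if "m \<in> M" for m
    using that subD(1) by blast
  have coset_iff: "y \<in> M +>\<^bsub>V\<^esub> x \<longleftrightarrow> y \<in> carrier V \<and> y \<ominus>\<^bsub>V\<^esub> x \<in> M" if "x \<in> carrier V" for x y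
  proof -
    have "y \<in> M +>\<^bsub>V\<^esub> x \<longleftrightarrow> (\<exists>m\<in>M. y = m \<oplus>\<^bsub>V\<^esub> x)"
      by (auto simp: a_r_coset_def')
    also have "\<dots> \<longleftrightarrow> y \<in> carrier V \<and> y \<ominus>\<^bsub>V\<^esub> x \<in> M"
      using that MC by (metis V.M.a_closed V.minus_plus_cancel V.plus_minus_cancel)
    finally show ?thesis .
  qed
  have self: "x \<in> M +>\<^bsub>V\<^esub> x" if "x \<in> carrier V" for x
    using that coset_iff[OF that] zero_closed by simp
  have eq_iff: "M +>\<^bsub>V\<^esub> y = M +>\<^bsub>V\<^esub> x \<longleftrightarrow> y \<in> M +>\<^bsub>V\<^esub> x" if "x \<in> carrier V" "y \<in> carrier V" for x y
    using V.M.a_repr_independence[OF _ that(1) submodule.axioms(1)[OF sub], of y] self[OF that(2)]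
        by metis
  have M0: "M +>\<^bsub>V\<^esub> \<zero>\<^bsub>V\<^esub> = M"
  proof (rule Set.set_eqI)
    show "y \<in> M +>\<^bsub>V\<^esub> \<zero>\<^bsub>V\<^esub> \<longleftrightarrow> y \<in> M" for y
      using MC[of y] by (subst coset_iff) auto
  qed
  show ker: "M +>\<^bsub>V\<^esub> x = \<zero>\<^bsub>quotient_space V M\<^esub> \<longleftrightarrow> x \<in> M" if "x \<in> carrier V" for x
    using eq_iff[of "\<zero>\<^bsub>V\<^esub>" x] M0 that by (simp add: quotient_space_def)
  show "quotient_map V (quotient_space V M) (\<lambda>x. M +>\<^bsub>V\<^esub> x)"
  proof (unfold_locales)
    show "carrier (quotient_space V M) = (\<lambda>x. M +>\<^bsub>V\<^esub> x) ` carrier V"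
      by (auto simp: quotient_space_def A_RCOSETS_def')
    show "M +>\<^bsub>V\<^esub> (x \<oplus>\<^bsub>V\<^esub> y) = (M +>\<^bsub>V\<^esub> x) \<oplus>\<^bsub>quotient_space V M\<^esub> (M +>\<^bsub>V\<^esub> y)"
      if "x \<in> carrier V" "y \<in> carrier V" for x y
      using that by (simp add: quotient_space_def a_rcos_sum)
    show "M +>\<^bsub>V\<^esub> \<zero>\<^bsub>V\<^esub> = \<zero>\<^bsub>quotient_space V M\<^esub>"
      using M0 by (simp add: quotient_space_def)
    show "M +>\<^bsub>V\<^esub> (c \<odot>\<^bsub>V\<^esub> x) = c \<odot>\<^bsub>quotient_space V M\<^esub> (M +>\<^bsub>V\<^esub> x)" if x: "x \<in> carrier V" for c x
    proof -
      have "M +>\<^bsub>V\<^esub> (c \<odot>\<^bsub>V\<^esub> x) = M <+>\<^bsub>V\<^esub> (\<lambda>a. c \<odot>\<^bsub>V\<^esub> a) ` (M +>\<^bsub>V\<^esub> x)"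
      proof (intro equalityI subsetI)
        fix y assume "y \<in> M +>\<^bsub>V\<^esub> (c \<odot>\<^bsub>V\<^esub> x)"
        then show "y \<in> M <+>\<^bsub>V\<^esub> (\<lambda>a. c \<odot>\<^bsub>V\<^esub> a) ` (M +>\<^bsub>V\<^esub> x)"
          using self[OF x] by (auto simp: a_r_coset_def'[of _ M "c \<odot>\<^bsub>V\<^esub> x"] set_add_def')
      next
        fix y assume "y \<in> M <+>\<^bsub>V\<^esub> (\<lambda>a. c \<odot>\<^bsub>V\<^esub> a) ` (M +>\<^bsub>V\<^esub> x)"
        then obtain m m' where m: "m \<in> M" "m' \<in> M" and y: "y = m \<oplus>\<^bsub>V\<^esub> c \<odot>\<^bsub>V\<^esub> (m' \<oplus>\<^bsub>V\<^esub> x)"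
          by (auto simp: a_r_coset_def' set_add_def')
        have "y = (m \<oplus>\<^bsub>V\<^esub> c \<odot>\<^bsub>V\<^esub> m') \<oplus>\<^bsub>V\<^esub> c \<odot>\<^bsub>V\<^esub> x"
          using m x MC by (simp add: y V.smult_distrib V.M.a_assoc)
        moreover have "m \<oplus>\<^bsub>V\<^esub> c \<odot>\<^bsub>V\<^esub> m' \<in> M"
          using m subD by simp
        ultimately show "y \<in> M +>\<^bsub>V\<^esub> (c \<odot>\<^bsub>V\<^esub> x)"
          by (auto simp: a_r_coset_def')
      qed
      then show ?thesis
        by (simp add: quotient_space_def)
    qed
    show "vnorm (quotient_space V M) (M +>\<^bsub>V\<^esub> x) = Inf (vnorm V ` {y \<in> carrier V. M +>\<^bsub>V\<^esub> y = M +>\<^bsub>V\<^esub> x})"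
      if x: "x \<in> carrier V" for x
    proof -
      have "{y \<in> carrier V. M +>\<^bsub>V\<^esub> y = M +>\<^bsub>V\<^esub> x} = M +>\<^bsub>V\<^esub> x"
        using eq_iff[OF x] coset_iff[OF x] by auto
      then show ?thesis
        by (simp add: quotient_space_def)
    qed
    have "{x \<in> carrier V. M +>\<^bsub>V\<^esub> x = \<zero>\<^bsub>quotient_space V M\<^esub>} = M"
    proof (rule Set.set_eqI)
      fix x
      show "x \<in> {x \<in> carrier V. M +>\<^bsub>V\<^esub> x = \<zero>\<^bsub>quotient_space V M\<^esub>} \<longleftrightarrow> x \<in> M"
      proof (cases "x \<in> carrier V")
        case True
        show ?thesis
          unfolding mem_Collect_eq ker[OF True] using True by blast
      next
        case False
        then show ?thesis
          using MC by blast
      qed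
    qed
    then show "closedin (vtopology V) {x \<in> carrier V. M +>\<^bsub>V\<^esub> x = \<zero>\<^bsub>quotient_space V M\<^esub>}"
      using closed by simp
  qed
qed

text \<open>
  A copy of the quotient of \<open>V\<close> by the fibres of \<open>\<pi>\<close>, with the values of \<open>\<pi>\<close> as points. The operations
  go through an arbitrary choice of representatives.
\<close>

definition quotient_along :: "'a cnspace \<Rightarrow> ('a \<Rightarrow> 'b) \<Rightarrow> 'b cnspace" where
  "quotient_along V \<pi> =
     \<lparr>carrier = \<pi> ` carrier V, mult = undefined, one = undefined, zero = \<pi> \<zero>\<^bsub>V\<^esub>,
      add = (\<lambda>A B. \<pi> (inv_into (carrier V) \<pi> A \<oplus>\<^bsub>V\<^esub> inv_into (carrier V) \<pi> B)),
      smult = (\<lambda>c A. \<pi> (c \<odot>\<^bsub>V\<^esub> inv_into (carrier V) \<pi> A)),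
      vnorm = (\<lambda>A. Inf (vnorm V ` {y \<in> carrier V. \<pi> y = A}))\<rparr>"

lemma quotient_along_quotient_map:
  assumes V: "complex_banach_space V" and Y: "complex_normed_space Y" and \<phi>: "linear_operator V Y \<phi>"
    and C: "\<And>x. x \<in> carrier V \<Longrightarrow> vnorm Y (\<phi> x) \<le> C * vnorm V x"
    and \<pi>: "\<And>x y. x \<in> carrier V \<Longrightarrow> y \<in> carrier V \<Longrightarrow> \<pi> x = \<pi> y \<longleftrightarrow> \<phi> x = \<phi> y"
  shows "quotient_map V (quotient_along V \<pi>) \<pi>"
    and "x \<in> carrier V \<Longrightarrow> \<pi> x = \<zero>\<^bsub>quotient_along V \<pi>\<^esub> \<longleftrightarrow> \<phi> x = \<zero>\<^bsub>Y\<^esub>"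
proof -
  interpret V: complex_banach_space V by (rule V)
  interpret Y: complex_normed_space Y by (rule Y)
  interpret \<phi>: linear_operator_between V Y \<phi> by standard (rule \<phi>)
  have inv: "inv_into (carrier V) \<pi> (\<pi> x) \<in> carrier V" "\<phi> (inv_into (carrier V) \<pi> (\<pi> x)) = \<phi> x"
    if x: "x \<in> carrier V" for x
  proof -
    show *: "inv_into (carrier V) \<pi> (\<pi> x) \<in> carrier V"
      using x by (simp add: inv_into_into)
    show "\<phi> (inv_into (carrier V) \<pi> (\<pi> x)) = \<phi> x"
      using \<pi>[OF * x] x by (simp add: f_inv_into_f)
  qed
  show ker: "\<pi> x = \<zero>\<^bsub>quotient_along V \<pi>\<^esub> \<longleftrightarrow> \<phi> x = \<zero>\<^bsub>Y\<^esub>" if "x \<in> carrier V" for x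
    using that \<pi>[of x "\<zero>\<^bsub>V\<^esub>"] by (simp add: quotient_along_def \<phi>.zero)
  show "quotient_map V (quotient_along V \<pi>) \<pi>"
  proof unfold_locales
    have "{x \<in> carrier V. \<pi> x = \<zero>\<^bsub>quotient_along V \<pi>\<^esub>} = {x \<in> carrier V. \<phi> x = \<zero>\<^bsub>Y\<^esub>}"
      using ker by auto
    then show "closedin (vtopology V) {x \<in> carrier V. \<pi> x = \<zero>\<^bsub>quotient_along V \<pi>\<^esub>}"
      using \<phi>.closed_subspace_kernel[OF C] by (simp add: closed_subspace_def)
    show "\<pi> (x \<oplus>\<^bsub>V\<^esub> y) = \<pi> x \<oplus>\<^bsub>quotient_along V \<pi>\<^esub> \<pi> y" if "x \<in> carrier V" "y \<in> carrier V" for x y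
      using that inv by (simp add: quotient_along_def \<pi> \<phi>.add)
    show "\<pi> (c \<odot>\<^bsub>V\<^esub> x) = c \<odot>\<^bsub>quotient_along V \<pi>\<^esub> \<pi> x" if "x \<in> carrier V" for c x
      using that inv by (simp add: quotient_along_def \<pi> \<phi>.smult)
  qed (auto simp: quotient_along_def)
qed

section \<open>Solid spaces of scalar sequences\<close>

text \<open>
  The properties shared by \<open>\<ell>\<^sub>q\<close> for \<open>1 \<le> q\<close> and \<open>c\<^sub>0\<close> that the construction uses: a solid norm that
  dominates the coordinates and is order continuous (tails tend to \<open>0\<close>), and membership of every
  sequence whose truncations are Cauchy. The last property is what makes these spaces complete.
\<close>

locale sequence_space =
  fixes Q :: "(nat \<Rightarrow> complex) cnspace"
  assumes normed: "complex_normed_space Q"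
    and ops: "zero Q = (\<lambda>n. 0)" "add Q = (\<lambda>a b n. a n + b n)" "Module.smult Q = (\<lambda>c a n. c * a n)"
    and coord_le: "\<And>a n. a \<in> carrier Q \<Longrightarrow> cmod (a n) \<le> vnorm Q a"
    and solid: "\<And>a b. b \<in> carrier Q \<Longrightarrow> (\<And>n. cmod (a n) \<le> cmod (b n)) \<Longrightarrow>
      a \<in> carrier Q \<and> vnorm Q a \<le> vnorm Q b"
    and tail: "\<And>a. a \<in> carrier Q \<Longrightarrow> (\<lambda>n. vnorm Q (\<lambda>k. if k < n then 0 else a k)) \<longlonglongrightarrow> 0"
    and finite_in: "\<And>a n. (\<lambda>k. if k < n then a k else 0) \<in> carrier Q"
    and Cauchy_in: "\<And>a. (\<And>\<epsilon>. \<epsilon> > 0 \<Longrightarrow> \<exists>N. \<forall>n. vnorm Q (\<lambda>k. if N \<le> k \<and> k < n then a k else 0) \<le> \<epsilon>) \<Longrightarrow>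
      a \<in> carrier Q"
begin

sublocale complex_normed_space Q
  by (rule normed)

lemma add_in: "a \<in> carrier Q \<Longrightarrow> b \<in> carrier Q \<Longrightarrow> (\<lambda>n. a n + b n) \<in> carrier Q"
  using M.a_closed[of a b] by (simp add: ops)

lemma smult_in': "a \<in> carrier Q \<Longrightarrow> (\<lambda>n. c * a n) \<in> carrier Q"
  using smult_in[of a c] by (simp add: ops)

lemma minus_eq: "a \<in> carrier Q \<Longrightarrow> b \<in> carrier Q \<Longrightarrow> a \<ominus>\<^bsub>Q\<^esub> b = (\<lambda>n. a n - b n)"
  by (simp add: minus_eq_smult ops)

lemma diff_in: "a \<in> carrier Q \<Longrightarrow> b \<in> carrier Q \<Longrightarrow> (\<lambda>n. a n - b n) \<in> carrier Q"
  using minus_in[of a b] by (simp add: minus_eq)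

lemma vnorm_add: "a \<in> carrier Q \<Longrightarrow> b \<in> carrier Q \<Longrightarrow> vnorm Q (\<lambda>n. a n + b n) \<le> vnorm Q a + vnorm Q b"
  using vnorm_triangle[of a b] by (simp add: ops)

lemma vnorm_scale: "a \<in> carrier Q \<Longrightarrow> vnorm Q (\<lambda>n. c * a n) = cmod c * vnorm Q a"
  using vnorm_smult[of a c] by (simp add: ops)

lemma restrict_in: "a \<in> carrier Q \<Longrightarrow> (\<lambda>k. if P k then a k else 0) \<in> carrier Q"
  and restrict_le: "a \<in> carrier Q \<Longrightarrow> vnorm Q (\<lambda>k. if P k then a k else 0) \<le> vnorm Q a"
  using solid[of a "\<lambda>k. if P k then a k else 0"] by auto

lemma restrict_mono:
  assumes "\<And>k. P k \<Longrightarrow> R k" "(\<lambda>k. if R k then a k else 0) \<in> carrier Q"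
  shows "(\<lambda>k. if P k then a k else 0) \<in> carrier Q"
    and "vnorm Q (\<lambda>k. if P k then a k else 0) \<le> vnorm Q (\<lambda>k. if R k then a k else 0)"
  using solid[OF assms(2), of "\<lambda>k. if P k then a k else 0"] assms(1) by auto

lemma tail_in: "a \<in> carrier Q \<Longrightarrow> (\<lambda>k. if k < n then 0 else a k) \<in> carrier Q"
  using solid[of a "\<lambda>k. if k < n then 0 else a k"] by auto

lemma vnorm_split:
  assumes "a \<in> carrier Q"
  shows "vnorm Q a \<le> vnorm Q (\<lambda>k. if k < n then a k else 0) + vnorm Q (\<lambda>k.
      if k < n then 0 else a k)"
proof -
  have "(\<lambda>k. (if k < n then a k else 0) + (if k < n then 0 else a k)) = a"
    by (intro ext) auto
  then show ?thesis
    using vnorm_add[OF finite_in[of n a] tail_in[OF assms, of n]] by simp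
qed

lemma vnorm_finite_le:
  "vnorm Q (\<lambda>k. if k < n then a k else 0) \<le>
    (\<Sum>i<n. cmod (a i) * vnorm Q (\<lambda>k. if k = i then 1 else 0))"
proof (induction n)
  case 0
  then show ?case
    using vnorm_zero by (simp add: ops)
next
  case (Suc n)
  have e: "(\<lambda>k. if k = n then 1 else 0) \<in> carrier Q"
  proof -
    have "(\<lambda>k. if k < Suc n then (if k = n then 1 else 0) else 0) \<in> carrier Q"
      by (rule finite_in)
    also have "(\<lambda>k. if k < Suc n then (if k = n then 1 else 0) else 0) = (\<lambda>k. if k =
        n then 1 else (0::complex))"
      by (intro ext) (auto simp: less_Suc_eq)
    finally show ?thesis .
  qed
  have "(\<lambda>k. if k < Suc n then a k else 0) = (\<lambda>k. (if k < n then a k else 0) + a n * (if k =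
      n then 1 else 0))"
    by (intro ext) (auto simp: less_Suc_eq)
  then have "vnorm Q (\<lambda>k. if k < Suc n then a k else 0) \<le>
      vnorm Q (\<lambda>k. if k < n then a k else 0) + cmod (a n) * vnorm Q (\<lambda>k. if k = n then 1 else 0)"
    using vnorm_add[OF finite_in[of n a] smult_in'[OF e, of "a n"]] vnorm_scale[OF e, of "a n"]
        by simp
  then show ?case
    using Suc by simp
qed

lemma finite_tendsto_zero:
  assumes "\<And>i. (\<lambda>l. b l i) \<longlonglongrightarrow> 0"
  shows "(\<lambda>l. vnorm Q (\<lambda>k. if k < n then b l k else 0)) \<longlonglongrightarrow> 0"
proof (rule tendsto_sandwich[OF _ _ tendsto_const])
  have "(\<lambda>l. cmod (b l i) * vnorm Q (\<lambda>k. if k = i then 1 else 0)) \<longlonglongrightarrow> 0" for i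
    using assms[of i] by (intro tendsto_mult_left_zero tendsto_norm_zero)
  then show "(\<lambda>l. \<Sum>i<n. cmod (b l i) * vnorm Q (\<lambda>k. if k = i then 1 else 0)) \<longlonglongrightarrow> 0"
    by (intro tendsto_null_sum)
qed (simp_all add: vnorm_nonneg finite_in vnorm_finite_le)

text \<open>
  The coordinatewise limit is the limit in norm: truncated to finitely many coordinates, a
  coordinatewise null sequence is a norm null sequence, so the Cauchy estimate passes to the limit
  uniformly over all truncations.
\<close>

lemma complex_banach_space: "complex_banach_space Q"
proof (rule complex_banach_spaceI)
  fix s :: "nat \<Rightarrow> nat \<Rightarrow> complex"
  assume sQ: "range s \<subseteq> carrier Q" and Cauchy: "\<forall>\<epsilon>>0. \<exists>N. \<forall>m\<ge>N. \<forall>n\<ge>N. vnorm Q (s m \<ominus>\<^bsub>Q\<^esub> s n) < \<epsilon>"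
  have s: "s k \<in> carrier Q" for k
    using sQ by auto
  note dQ = diff_in[OF s s]
  have Cauchy: "\<exists>N. \<forall>m\<ge>N. \<forall>n\<ge>N. vnorm Q (\<lambda>i. s m i - s n i) < \<epsilon>" if "\<epsilon> > 0" for \<epsilon>
    using Cauchy that s by (simp add: minus_eq)
  have "Cauchy (\<lambda>k. s k i)" for i
    unfolding Cauchy_def dist_norm
  proof (intro allI impI)
    fix \<epsilon> :: real assume "\<epsilon> > 0"
    then obtain N where "\<forall>m\<ge>N. \<forall>n\<ge>N. vnorm Q (\<lambda>i. s m i - s n i) < \<epsilon>"
      using Cauchy by blast
    then show "\<exists>N. \<forall>m\<ge>N. \<forall>n\<ge>N. cmod (s m i - s n i) < \<epsilon>"
      using coord_le[OF dQ] by (meson le_less_trans)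
  qed
  then have "\<exists>l. (\<lambda>k. s k i) \<longlonglongrightarrow> l" for i
    by (simp add: Cauchy_convergent_iff convergent_def)
  then obtain a where a: "\<And>i. (\<lambda>k. s k i) \<longlonglongrightarrow> a i"
    by metis
  have P: "\<exists>N. \<forall>k\<ge>N. \<forall>n. vnorm Q (\<lambda>i. if i < n then s k i - a i else 0) \<le> \<epsilon>" if \<epsilon>: "\<epsilon> > 0" for \<epsilon>
  proof -
    obtain N where N: "\<forall>m\<ge>N. \<forall>n\<ge>N. vnorm Q (\<lambda>i. s m i - s n i) < \<epsilon>"
      using Cauchy[OF \<epsilon>] by blast
    have "vnorm Q (\<lambda>i. if i < n then s k i - a i else 0) \<le> \<epsilon>" if k: "k \<ge> N" for k n
    proof -
      have "(\<lambda>l. \<epsilon> + vnorm Q (\<lambda>i. if i < n then s l i - a i else 0)) \<longlonglongrightarrow> \<epsilon> + 0"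
        using a by (intro tendsto_add tendsto_const finite_tendsto_zero) (simp add: LIM_zero_iff)
      moreover have "vnorm Q (\<lambda>i. if i < n then s k i - a i else 0) \<le> \<epsilon> + vnorm Q (\<lambda>i.
          if i < n then s l i - a i else 0)"
        if l: "l \<ge> N" for l
      proof -
        have "(\<lambda>i. if i < n then s k i - a i else 0) =
            (\<lambda>i. (if i < n then s k i - s l i else 0) + (if i < n then s l i - a i else 0))"
          by (intro ext) (auto simp: less_Suc_eq)
        then have "vnorm Q (\<lambda>i. if i < n then s k i - a i else 0) \<le>
            vnorm Q (\<lambda>i. if i < n then s k i - s l i else 0) + vnorm Q (\<lambda>i.
                if i < n then s l i - a i else 0)"
          using vnorm_add[OF finite_in finite_in] by simp
        also have "vnorm Q (\<lambda>i. if i < n then s k i - s l i else 0) \<le> vnorm Q (\<lambda>i. s k i - s l i)"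
          by (rule restrict_le[OF dQ])
        also have "\<dots> \<le> \<epsilon>"
          using N k l by (simp add: less_imp_le)
        finally show ?thesis
          by simp
      qed
      ultimately show ?thesis
        by (intro tendsto_lowerbound[of _ "\<epsilon> + 0" sequentially, simplified])
          (auto simp: eventually_sequentially)
    qed
    then show ?thesis
      by blast
  qed
  have aQ: "a \<in> carrier Q"
  proof (rule Cauchy_in)
    fix \<epsilon> :: real assume \<epsilon>: "\<epsilon> > 0"
    then obtain K where K: "\<And>n. vnorm Q (\<lambda>i. if i < n then s K i - a i else 0) \<le> \<epsilon> / 2"
      using P[of "\<epsilon> / 2"] by auto
    have "\<forall>\<^sub>F N in sequentially. vnorm Q (\<lambda>k. if k < N then 0 else s K k) < \<epsilon> / 2"
      using \<epsilon> by (intro order_tendstoD(2)[OF tail[OF s]]) simp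
    then obtain N where N: "vnorm Q (\<lambda>k. if k < N then 0 else s K k) < \<epsilon> / 2"
      by (auto simp: eventually_sequentially)
    have "vnorm Q (\<lambda>k. if N \<le> k \<and> k < n then a k else 0) \<le> \<epsilon>" for n
    proof -
      let ?u = "\<lambda>k. if N \<le> k \<and> k < n then s K k else 0" and ?v = "\<lambda>k. if N \<le>
          k \<and> k < n then s K k - a k else 0"
      have u: "?u \<in> carrier Q"
        by (rule restrict_in[OF s])
      have v: "?v \<in> carrier Q" "vnorm Q ?v \<le> \<epsilon> / 2"
        using restrict_mono[of "\<lambda>k. N \<le> k \<and> k < n" "\<lambda>k. k < n" "\<lambda>k. s K k - a k"] finite_in K[of n]
        by (auto intro: order_trans)
      have "(\<lambda>k. if k < N then 0 else s K k) = (\<lambda>k. if N \<le> k then s K k else 0)"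
        by (intro ext) (auto simp: less_Suc_eq)
      then have "vnorm Q ?u \<le> \<epsilon> / 2"
        using restrict_mono[of "\<lambda>k. N \<le> k \<and> k < n" "\<lambda>k. N \<le> k" "s K"] restrict_in[OF s] N
        by (auto intro: order_trans less_imp_le)
      moreover have "(\<lambda>k. if N \<le> k \<and> k < n then a k else 0) = (\<lambda>k. ?u k - ?v k)"
        by (intro ext) (auto simp: less_Suc_eq)
      ultimately show ?thesis
        using vnorm_minus_le[OF u v(1)] v(2) by (simp add: minus_eq[OF u v(1)])
    qed
    then show "\<exists>N. \<forall>n. vnorm Q (\<lambda>k. if N \<le> k \<and> k < n then a k else 0) \<le> \<epsilon>"
      by blast
  qed
  have "(\<lambda>k. vnorm Q (s k \<ominus>\<^bsub>Q\<^esub> a)) \<longlonglongrightarrow> 0"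
    unfolding LIMSEQ_def dist_norm
  proof (intro allI impI)
    fix r :: real assume r: "r > 0"
    then obtain N where N: "\<And>k n. k \<ge> N \<Longrightarrow> vnorm Q (\<lambda>i. if i < n then s k i - a i else 0) \<le> r / 2"
      using P[of "r / 2"] by auto
    have "vnorm Q (s k \<ominus>\<^bsub>Q\<^esub> a) \<le> r / 2" if k: "k \<ge> N" for k
    proof -
      have d: "(\<lambda>i. s k i - a i) \<in> carrier Q"
        using s aQ by (rule diff_in)
      have "(\<lambda>n. r / 2 + vnorm Q (\<lambda>i. if i < n then 0 else s k i - a i)) \<longlonglongrightarrow> r / 2 + 0"
        by (intro tendsto_add tendsto_const tail d)
      moreover have "vnorm Q (\<lambda>i. s k i - a i) \<le> r / 2 + vnorm Q (\<lambda>i.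
          if i < n then 0 else s k i - a i)" for n
        using vnorm_split[OF d, of n] N[OF k, of n] by simp
      ultimately have "vnorm Q (\<lambda>i. s k i - a i) \<le> r / 2"
        using LIMSEQ_le_const by (metis (no_types, lifting) add.right_neutral)
      then show ?thesis
        by (simp add: minus_eq s aQ)
    qed
    then show "\<exists>N. \<forall>n\<ge>N. norm (vnorm Q (s n \<ominus>\<^bsub>Q\<^esub> a) - 0) < r"
      using r s aQ by (intro exI[of _ N]) (fastforce simp: vnorm_nonneg)
  qed
  then have "limitin (vtopology Q) s a sequentially"
    using s aQ by (intro limitinI)
  then show "\<exists>l. limitin (vtopology Q) s l sequentially"
    by blast
qed

lemma limitin_truncation:
  assumes "a \<in> carrier Q"
  shows "limitin (vtopology Q) (\<lambda>n k. if k < n then a k else 0) a sequentially"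
proof (rule limitinI)
  have "(\<lambda>k. if k < n then a k else 0) \<ominus>\<^bsub>Q\<^esub> a = (\<lambda>k. (- 1) * (if k < n then 0 else a k))" for n
    using assms by (auto simp: minus_eq finite_in)
  moreover have "(\<lambda>k. if k < n then 0 else a k) \<in> carrier Q" for n
    using solid[OF assms, of "\<lambda>k. if k < n then 0 else a k"] by auto
  ultimately have "vnorm Q ((\<lambda>k. if k < n then a k else 0) \<ominus>\<^bsub>Q\<^esub> a) = vnorm Q (\<lambda>k.
      if k < n then 0 else a k)" for n
    using vnorm_scale[of "\<lambda>k. if k < n then 0 else a k" "- 1"] by simp
  then show "(\<lambda>n. vnorm Q ((\<lambda>k. if k < n then a k else 0) \<ominus>\<^bsub>Q\<^esub> a)) \<longlonglongrightarrow> 0"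
    using tail[OF assms] by simp
qed (use assms finite_in in auto)

lemma separable: "separable_space (vtopology Q)"
proof -
  obtain D :: "complex set" where D: "countable D" "\<And>X. open X \<Longrightarrow> X \<noteq> {} \<Longrightarrow> \<exists>d\<in>D. d \<in> X"
    using countable_dense_setE by metis
  define S where "S = (\<lambda>l k. if k < length l then l ! k else 0) ` lists D"
  have "countable S"
    using D(1) by (simp add: S_def countable_lists)
  moreover have SQ: "S \<subseteq> carrier Q"
    using finite_in by (auto simp: S_def)
  moreover have "vtopology Q closure_of S = topspace (vtopology Q)"
  proof (intro equalityI closure_of_subset_topspace subsetI)
    fix a assume "a \<in> topspace (vtopology Q)"
    then have a: "a \<in> carrier Q"
      by simp
    have "\<exists>b\<in>S. vnorm Q (b \<ominus>\<^bsub>Q\<^esub> a) < \<epsilon>" if \<epsilon>: "\<epsilon> > 0" for \<epsilon>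
    proof -
      obtain N where N: "vnorm Q (\<lambda>k. if k < N then 0 else a k) < \<epsilon> / 2"
        using order_tendstoD(2)[OF tail[OF a], of "\<epsilon> / 2"] \<epsilon> by (auto simp: eventually_sequentially)
      define C where "C = (\<Sum>i<N. vnorm Q (\<lambda>k. if k = i then 1 else 0)) + 1"
      have e: "0 \<le> vnorm Q (\<lambda>k. if k = i then 1 else 0)" for i
        using vnorm_nonneg[OF finite_in[of "Suc i" "\<lambda>k. if k = i then 1 else 0"]]
        by (rule order_trans) (auto intro!: eq_refl arg_cong[where f = "vnorm Q"])
      have C: "C > 0"
        unfolding C_def using e by (intro add_nonneg_pos sum_nonneg) auto
      have "\<exists>d\<in>D. cmod (d - a i) < \<epsilon> / (2 * C)" for i
      proof -
        have "a i \<in> ball (a i) (\<epsilon> / (2 * C))"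
          using \<epsilon> C by simp
        then have "\<exists>d\<in>D. d \<in> ball (a i) (\<epsilon> / (2 * C))"
          by (intro D(2)) auto
        then show ?thesis
          by (metis dist_commute dist_norm mem_ball)
      qed
      then obtain d where d: "\<And>i. d i \<in> D" "\<And>i. cmod (d i - a i) < \<epsilon> / (2 * C)"
        by metis
      let ?b = "\<lambda>k. if k < N then d k else 0"
      have "?b = (\<lambda>l k. if k < length l then l ! k else 0) (map d [0..<N])"
        by (intro ext) (auto simp: less_Suc_eq)
      then have bS: "?b \<in> S"
        unfolding S_def using d(1) by (intro image_eqI[of _ _ "map d [0..<N]"]) auto
      have b: "?b \<in> carrier Q" "(\<lambda>k. ?b k - a k) \<in> carrier Q"
        using a by (auto intro: finite_in diff_in)
      have tl: "(\<lambda>k. if k < N then 0 else a k) \<in> carrier Q"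
        using solid[OF a, of "\<lambda>k. if k < N then 0 else a k"] by auto
      have "(\<lambda>k. if k < N then 0 else ?b k - a k) = (\<lambda>k. (- 1) * (if k < N then 0 else a k))"
        by (intro ext) (auto simp: less_Suc_eq)
      then have tail_eq: "vnorm Q (\<lambda>k. if k < N then 0 else ?b k - a k) = vnorm Q (\<lambda>k.
          if k < N then 0 else a k)"
        using vnorm_scale[OF tl, of "- 1"] by simp
      have "vnorm Q (\<lambda>k. if k < N then ?b k - a k else 0) \<le>
          (\<Sum>i<N. cmod (?b i - a i) * vnorm Q (\<lambda>k. if k = i then 1 else 0))"
        by (rule vnorm_finite_le)
      also have "\<dots> \<le> (\<Sum>i<N. \<epsilon> / (2 * C) * vnorm Q (\<lambda>k. if k = i then 1 else 0))"
        using d(2) e by (intro sum_mono mult_right_mono) (auto intro: less_imp_le)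
      also have "\<dots> = \<epsilon> / (2 * C) * (C - 1)"
        by (simp add: C_def sum_distrib_left)
      also have "\<dots> \<le> \<epsilon> / (2 * C) * C"
        using C \<epsilon> by (intro mult_left_mono) auto
      also have "\<dots> = \<epsilon> / 2"
        using C by simp
      finally have "vnorm Q (\<lambda>k. ?b k - a k) < \<epsilon>"
        using vnorm_split[OF b(2), of N] tail_eq N by linarith
      then show ?thesis
        using bS a b(1) by (auto simp: minus_eq intro!: bexI[of _ ?b])
    qed
    then have "\<forall>n. \<exists>b\<in>S. vnorm Q (b \<ominus>\<^bsub>Q\<^esub> a) < inverse (real (Suc n))"
      by (simp add: del: of_nat_Suc)
    then obtain b where b: "\<And>n. b n \<in> S" "\<And>n. vnorm Q (b n \<ominus>\<^bsub>Q\<^esub> a) < inverse (real (Suc n))"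
      by metis
    have bQ: "b n \<in> carrier Q" for n
      using b(1) SQ by blast
    have "(\<lambda>n. vnorm Q (b n \<ominus>\<^bsub>Q\<^esub> a)) \<longlonglongrightarrow> 0"
      using b(2) bQ a
      by (intro tendsto_sandwich[OF _ _ tendsto_const LIMSEQ_inverse_real_of_nat])
        (auto simp: vnorm_nonneg less_imp_le simp del: of_nat_Suc)
    then have "limitin (vtopology Q) b a sequentially"
      using bQ a by (intro limitinI)
    then show "a \<in> vtopology Q closure_of S"
      using a b(1) bQ unfolding closure_of_sequentially by blast
  qed
  ultimately show ?thesis
    unfolding separable_space_def by auto
qed

lemma diagonal_in:
  assumes a: "a \<in> carrier Q" and \<beta>: "\<And>n. \<bar>\<beta> n\<bar> \<le> 1"
  shows "(\<lambda>n. complex_of_real (\<beta> n) * a n) \<in> carrier Q"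
    and "vnorm Q (\<lambda>n. complex_of_real (\<beta> n) * a n) \<le> vnorm Q a"
proof -
  have "cmod (complex_of_real (\<beta> n) * a n) \<le> cmod (a n)" for n
    using \<beta>[of n] by (simp add: norm_mult mult_left_le_one_le)
  then show "(\<lambda>n. complex_of_real (\<beta> n) * a n) \<in> carrier Q"
    "vnorm Q (\<lambda>n. complex_of_real (\<beta> n) * a n) \<le> vnorm Q a"
    using solid[OF a, of "\<lambda>n. complex_of_real (\<beta> n) * a n"] by auto
qed

text \<open>
  Multiplication by a null sequence is a compact operator. A bounded sequence of vectors has a
  coordinatewise convergent subsequence; after multiplication the tails are uniformly small, and the
  finitely many other coordinates converge.
\<close>

lemma diagonal_compact:
  assumes a: "\<And>k. a k \<in> carrier Q" "\<And>k. vnorm Q (a k) \<le> C"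
    and \<beta>: "\<And>n. \<bar>\<beta> n\<bar> \<le> 1" "\<beta> \<longlonglongrightarrow> 0"
  obtains r :: "nat \<Rightarrow> nat" where "strict_mono r"
    "\<And>\<epsilon>. \<epsilon> > 0 \<Longrightarrow> \<exists>N. \<forall>k\<ge>N. \<forall>l\<ge>N.
      vnorm Q (\<lambda>n. complex_of_real (\<beta> n) * (a (r k) n - a (r l) n)) < \<epsilon>"
proof -
  have "norm (a k n) \<le> C" for k n
    using coord_le[OF a(1)] a(2) order_trans by blast
  then have "\<exists>r :: nat \<Rightarrow> nat. strict_mono r \<and> (\<forall>n. \<exists>l. (\<lambda>k. a (r k) n) \<longlonglongrightarrow> l)"
    using function_convergent_subsequence[of "UNIV :: nat set" a C]
    by (metis UNIV_I countableI_type)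
  then obtain r :: "nat \<Rightarrow> nat" where r: "strict_mono r" "\<And>n. \<exists>l. (\<lambda>k. a (r k) n) \<longlonglongrightarrow> l"
    by blast
  have C: "C \<ge> 0"
    by (rule order_trans[OF vnorm_nonneg[OF a(1)] a(2)])
  have "\<exists>N. \<forall>k\<ge>N. \<forall>l\<ge>N. vnorm Q (\<lambda>n. complex_of_real (\<beta> n) * (a (r k) n - a (r l) n)) < \<epsilon>"
    if \<epsilon>: "\<epsilon> > 0" for \<epsilon>
  proof -
    define \<eta> where "\<eta> = \<epsilon> / (4 * (C + 1))"
    have \<eta>: "\<eta> > 0"
      using \<epsilon> C by (simp add: \<eta>_def)
    obtain M where M: "\<And>n. n \<ge> M \<Longrightarrow> \<bar>\<beta> n\<bar> < \<eta>"
      using \<beta>(2) \<eta> unfolding LIMSEQ_def by (auto simp: dist_norm)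
    define S where "S = (\<Sum>i<M. vnorm Q (\<lambda>k. if k = i then 1 else 0)) + 1"
    have e: "0 \<le> vnorm Q (\<lambda>k. if k = i then 1 else 0)" for i
      using vnorm_nonneg[OF finite_in[of "Suc i" "\<lambda>k. if k = i then 1 else 0"]]
      by (rule order_trans) (auto intro!: eq_refl arg_cong[where f = "vnorm Q"])
    have S: "S > 0"
      unfolding S_def using e by (intro add_nonneg_pos sum_nonneg) auto
    have "Cauchy (\<lambda>k. a (r k) n)" for n
      using r(2) by (simp add: Cauchy_convergent_iff convergent_def)
    then have "\<exists>N. \<forall>k\<ge>N. \<forall>l\<ge>N. cmod (a (r k) n - a (r l) n) < \<epsilon> / (2 * S)" for n
      using \<epsilon> S by (auto simp: Cauchy_def dist_norm)
    then obtain N where N: "\<And>n k l. k \<ge> N n \<Longrightarrow> l \<ge> N n \<Longrightarrow> cmod (a (r k) n - a (r l) n) < \<epsilon> / (2 * S)"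
      by metis
    have "vnorm Q (\<lambda>n. complex_of_real (\<beta> n) * (a (r k) n - a (r l) n)) < \<epsilon>"
      if kl: "k \<ge> (\<Sum>i<M. N i)" "l \<ge> (\<Sum>i<M. N i)" for k l
    proof -
      let ?d = "\<lambda>n. a (r k) n - a (r l) n"
      let ?b = "\<lambda>n. complex_of_real (\<beta> n) * ?d n"
      have d: "?d \<in> carrier Q"
        by (intro diff_in a(1))
      have dC: "vnorm Q ?d \<le> 2 * C"
        using vnorm_minus_le[OF a(1) a(1), of "r k" "r l"] a(2)[of "r k"] a(2)[of "r l"] a(1)
        by (simp add: minus_eq)
      have b: "?b \<in> carrier Q"
        using d \<beta>(1) by (rule diagonal_in)
      have "cmod (if n < M then 0 else ?b n) \<le> cmod (complex_of_real \<eta> * ?d n)" for n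
        using M[of n] \<eta> by (auto simp: norm_mult intro!: mult_right_mono)
      then have "vnorm Q (\<lambda>n. if n < M then 0 else ?b n) \<le> vnorm Q (\<lambda>n. complex_of_real \<eta> * ?d n)"
        using solid[OF smult_in'[OF d, of "complex_of_real \<eta>"], of "\<lambda>n.
            if n < M then 0 else ?b n"] by blast
      also have "\<dots> = \<eta> * vnorm Q ?d"
        using vnorm_scale[OF d] \<eta> by simp
      also have "\<dots> \<le> \<eta> * (2 * C)"
        using dC \<eta> by (intro mult_left_mono) auto
      also have "\<dots> < \<epsilon> / 2"
        using C \<epsilon> by (simp add: \<eta>_def field_simps)
      finally have 1: "vnorm Q (\<lambda>n. if n < M then 0 else ?b n) < \<epsilon> / 2" .
      have le: "cmod (?b i) \<le> \<epsilon> / (2 * S)" if "i < M" for i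
      proof -
        have "N i \<le> (\<Sum>i<M. N i)"
          using that by (intro member_le_sum) auto
        then have "cmod (?d i) < \<epsilon> / (2 * S)"
          using kl by (intro N) auto
        moreover have "cmod (?b i) \<le> cmod (?d i)"
          using \<beta>(1)[of i] by (simp add: norm_mult mult_left_le_one_le)
        ultimately show ?thesis
          by simp
      qed
      have "vnorm Q (\<lambda>n. if n < M then ?b n else 0) \<le>
          (\<Sum>i<M. cmod (?b i) * vnorm Q (\<lambda>k. if k = i then 1 else 0))"
        by (rule vnorm_finite_le)
      also have "\<dots> \<le> (\<Sum>i<M. \<epsilon> / (2 * S) * vnorm Q (\<lambda>k. if k = i then 1 else 0))"
        using le e by (intro sum_mono mult_right_mono) auto
      also have "\<dots> = \<epsilon> / (2 * S) * (S - 1)"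
        by (simp add: S_def sum_distrib_left)
      also have "\<dots> \<le> \<epsilon> / (2 * S) * S"
        using S \<epsilon> by (intro mult_left_mono) auto
      also have "\<dots> = \<epsilon> / 2"
        using S by simp
      finally show ?thesis
        using vnorm_split[OF b, of M] 1 by linarith
    qed
    then show ?thesis
      by blast
  qed
  then show thesis
    using r(1) that by blast
qed

end

section \<open>The spaces \<open>\<ell>\<^sub>q\<close> and \<open>c\<^sub>0\<close>\<close>

lemma summable_dominated:
  fixes f g :: "nat \<Rightarrow> real"
  assumes "summable g" "\<And>n. 0 \<le> f n" "\<And>n. f n \<le> g n"
  shows "summable f"
  by (rule summable_comparison_test'[where N = 0 and g = g]) (use assms in auto)

lemma powr_convex_nonneg:
  fixes u v t q :: real
  assumes "u \<ge> 0" "v \<ge> 0" "0 \<le> t" "t \<le> 1" "q \<ge> 1"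
  shows "(t * u + (1 - t) * v) powr q \<le> t * u powr q + (1 - t) * v powr q"
proof (cases "u = 0 \<or> v = 0")
  case True
  have scale: "(s * w) powr q \<le> s * w powr q" if "0 \<le> s" "s \<le> 1" "w \<ge> 0" for s w :: real
  proof -
    have "s powr q \<le> s"
      using that powr_mono'[of 1 q s] assms(5) by simp
    then show ?thesis
      using that by (simp add: powr_mult mult_right_mono)
  qed
  show ?thesis
    using True scale[of t u] scale[of "1 - t" v] assms by auto
next
  case False
  then show ?thesis
    using convex_onD[OF powr_convex[OF assms(5)], of "1 - t" u v] assms by (simp add: algebra_simps)
qed

abbreviation scalar_lp :: "real \<Rightarrow> (nat \<Rightarrow> complex) cnspace" where
  "scalar_lp q \<equiv> lp_space q complex_space"

lemma scalar_lp_simps: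
  "carrier (scalar_lp q) = {a. summable (\<lambda>n. cmod (a n) powr q)}"
  "zero (scalar_lp q) = (\<lambda>n. 0)" "add (scalar_lp q) = (\<lambda>a b n. a n + b n)"
  "Module.smult (scalar_lp q) = (\<lambda>c a n. c * a n)"
  "vnorm (scalar_lp q) a = (\<Sum>n. cmod (a n) powr q) powr (1 / q)"
  by (auto simp: lp_space_def complex_space_def)

lemma vnorm_lp_le_iff:
  fixes q r :: real and f :: "nat \<Rightarrow> real"
  assumes "q \<ge> 1" "r \<ge> 0" "\<And>n. f n \<ge> 0" "summable (\<lambda>n. f n powr q)"
  shows "(\<Sum>n. f n powr q) powr (1 / q) \<le> r \<longleftrightarrow> (\<Sum>n. f n powr q) \<le> r powr q"
proof -
  have S: "(\<Sum>n. f n powr q) \<ge> 0"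
    using assms by (intro suminf_nonneg) auto
  have "(\<Sum>n. f n powr q) = ((\<Sum>n. f n powr q) powr (1 / q)) powr q"
    using S assms by (simp add: powr_powr)
  moreover have "x powr q \<le> r powr q \<longleftrightarrow> x \<le> r" if "x \<ge> 0" for x
    using that assms powr_mono2[of q x r] powr_less_mono2[of q r x] by fastforce
  ultimately show ?thesis
    by (metis powr_ge_zero)
qed

text \<open>
  Minkowski's inequality. Working with any strict upper bounds \<open>a\<close> and \<open>b\<close> of the two norms avoids the case
  that one of them is \<open>0\<close>; the inequality is then convexity of \<open>x \<mapsto> x\<^sup>q\<close> with weights \<open>a / (a + b)\<close> and
  \<open>b / (a + b)\<close>.
\<close>

lemma lp_triangle:
  fixes q :: real and f g :: "nat \<Rightarrow> real"
  assumes q: "q \<ge> 1" and f: "\<And>n. f n \<ge> 0" "summable (\<lambda>n. f n powr q)"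
    and g: "\<And>n. g n \<ge> 0" "summable (\<lambda>n. g n powr q)"
  shows "summable (\<lambda>n. (f n + g n) powr q)"
    and "(\<Sum>n. (f n + g n) powr q) powr (1 / q) \<le>
      (\<Sum>n. f n powr q) powr (1 / q) + (\<Sum>n. g n powr q) powr (1 / q)"
proof -
  let ?A = "(\<Sum>n. f n powr q) powr (1 / q)" and ?B = "(\<Sum>n. g n powr q) powr (1 / q)"
  have main: "summable (\<lambda>n. (f n + g n) powr q) \<and> (\<Sum>n. (f n + g n) powr q) \<le> (a + b) powr q"
    if a: "a > 0" "?A \<le> a" and b: "b > 0" "?B \<le> b" for a b
  proof -
    define t where "t = a / (a + b)"
    have t: "0 \<le> t" "t \<le> 1" "(a + b) * t = a" "(a + b) * (1 - t) = b"
      using a b by (auto simp: t_def field_simps)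
    let ?h = "\<lambda>n. (a + b) powr q * (t / a powr q * f n powr q + (1 - t) / b powr q * g n powr q)"
    have le: "(f n + g n) powr q \<le> ?h n" for n
    proof -
      have "f n + g n = (a + b) * (t * (f n / a) + (1 - t) * (g n / b))"
        using a b t by (simp add: distrib_left flip: mult.assoc)
      then have "(f n + g n) powr q = (a + b) powr q * (t * (f n / a) + (1 - t) * (g n / b)) powr q"
        using a b t f g by (simp add: powr_mult)
      also have "\<dots> \<le> (a + b) powr q * (t * (f n / a) powr q + (1 - t) * (g n / b) powr q)"
        using a b t f g q by (intro mult_left_mono powr_convex_nonneg) auto
      finally show ?thesis
        using a b f g by (simp add: powr_divide)
    qed
    have sum: "summable ?h"
      by (intro summable_mult summable_add f g)
    have s: "summable (\<lambda>n. (f n + g n) powr q)"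
      using le by - (rule summable_dominated[OF sum], auto)
    have fa: "(\<Sum>n. f n powr q) \<le> a powr q" and gb: "(\<Sum>n. g n powr q) \<le> b powr q"
      using a b f g q vnorm_lp_le_iff[of q a f] vnorm_lp_le_iff[of q b g] by auto
    have "(\<Sum>n. (f n + g n) powr q) \<le> suminf ?h"
      using le s sum by (intro suminf_le) auto
    also have "\<dots> = (a + b) powr q * (t / a powr q * (\<Sum>n. f n powr q) + (1 - t) / b powr q * (\<Sum>n. g
        n powr q))"
      by (intro sums_unique[symmetric] sums_mult sums_add summable_sums f g)
    also have "\<dots> \<le> (a + b) powr q * (t / a powr q * a powr q + (1 - t) / b powr q * b powr q)"
      using fa gb t by (intro mult_left_mono add_mono) auto
    also have "\<dots> = (a + b) powr q"
      using a b by simp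
    finally show ?thesis
      using s by simp
  qed
  show s: "summable (\<lambda>n. (f n + g n) powr q)"
    using main[of "?A + 1" "?B + 1"] by (simp add: add_nonneg_pos)
  show "(\<Sum>n. (f n + g n) powr q) powr (1 / q) \<le> ?A + ?B"
  proof (rule field_le_epsilon)
    fix e :: real assume e: "e > 0"
    have pos: "?A + e / 2 > 0" "?B + e / 2 > 0"
      using e by (auto intro!: add_nonneg_pos)
    then have "(\<Sum>n. (f n + g n) powr q) \<le> ((?A + e / 2) + (?B + e / 2)) powr q"
      using main[of "?A + e / 2" "?B + e / 2"] e by simp
    then have "(\<Sum>n. (f n + g n) powr q) powr (1 / q) \<le> (?A + e / 2) + (?B + e / 2)"
      using s f g q pos by (subst vnorm_lp_le_iff) (auto intro: add_nonneg_nonneg less_imp_le)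
    then show "(\<Sum>n. (f n + g n) powr q) powr (1 / q) \<le> ?A + ?B + e"
      by simp
  qed
qed

lemma sequence_space_lp:
  assumes q: "q \<ge> 1"
  shows "sequence_space (scalar_lp q)"
proof -
  have solid: "a \<in> carrier (scalar_lp q) \<and> vnorm (scalar_lp q) a \<le> vnorm (scalar_lp q) b"
    if b: "b \<in> carrier (scalar_lp q)" and le: "\<And>n. cmod (a n) \<le> cmod (b n)" for a b
  proof -
    have le': "cmod (a n) powr q \<le> cmod (b n) powr q" for n
      using le q by (intro powr_mono2) auto
    have a: "summable (\<lambda>n. cmod (a n) powr q)"
      using b le' by - (rule summable_dominated[of "\<lambda>n. cmod (b n) powr q"], auto simp:
          scalar_lp_simps)
    have "(\<Sum>n. cmod (a n) powr q) \<le> (\<Sum>n. cmod (b n) powr q)"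
      using b le' a by (intro suminf_le) (auto simp: scalar_lp_simps)
    then have "vnorm (scalar_lp q) a \<le> vnorm (scalar_lp q) b"
      unfolding scalar_lp_simps using q a by (intro powr_mono2 suminf_nonneg) auto
    then show ?thesis
      using a by (simp add: scalar_lp_simps(1))
  qed
  have coord: "cmod (a n) \<le> vnorm (scalar_lp q) a" if "a \<in> carrier (scalar_lp q)" for a n
  proof -
    have "cmod (a n) = (cmod (a n) powr q) powr (1 / q)"
      using q by (simp add: powr_powr)
    also have "\<dots> \<le> vnorm (scalar_lp q) a"
      unfolding scalar_lp_simps using that q sum_le_suminf[of "\<lambda>n. cmod (a n) powr q" "{n}"]
      by (intro powr_mono2) (auto simp: scalar_lp_simps)
    finally show ?thesis .
  qed
  have fin: "summable (\<lambda>k. cmod (if P k then a k else 0) powr q)" if "finite {k. P k}" for P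
      and a :: "nat \<Rightarrow> complex"
    using that by (intro summable_finite[of "{k. P k}"]) auto
  show ?thesis
  proof (rule sequence_space.intro)
    show "\<zero>\<^bsub>scalar_lp q\<^esub> = (\<lambda>n. 0)" "(\<oplus>\<^bsub>scalar_lp q\<^esub>) = (\<lambda>a b n. a n + b n)"
      "(\<odot>\<^bsub>scalar_lp q\<^esub>) = (\<lambda>c a n. c * a n)"
      by (simp_all add: scalar_lp_simps)
    show "cmod (a n) \<le> vnorm (scalar_lp q) a" if "a \<in> carrier (scalar_lp q)" for a n
      using that by (rule coord)
    show "a \<in> carrier (scalar_lp q) \<and> vnorm (scalar_lp q) a \<le> vnorm (scalar_lp q) b"
      if "b \<in> carrier (scalar_lp q)" "\<And>n. cmod (a n) \<le> cmod (b n)" for a b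
      using that by (rule solid)
    show "complex_normed_space (scalar_lp q)"
    proof (rule complex_normed_spaceI)
      fix a assume a: "a \<in> carrier (scalar_lp q)"
      show "c \<odot>\<^bsub>scalar_lp q\<^esub> a \<in> carrier (scalar_lp q)" for c
        using a by (simp add: scalar_lp_simps norm_mult powr_mult summable_mult)
      show "vnorm (scalar_lp q) (c \<odot>\<^bsub>scalar_lp q\<^esub> a) = cmod c * vnorm (scalar_lp q) a" for c
        using a q by (simp add: scalar_lp_simps norm_mult powr_mult suminf_mult suminf_nonneg
            powr_powr)
      show "a = \<zero>\<^bsub>scalar_lp q\<^esub>" if "vnorm (scalar_lp q) a = 0"
        using coord[OF a] that by (auto simp: scalar_lp_simps)
      fix b assume b: "b \<in> carrier (scalar_lp q)"
      have ab: "summable (\<lambda>n. cmod (a n) powr q)" "summable (\<lambda>n. cmod (b n) powr q)"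
        using a b by (simp_all add: scalar_lp_simps)
      note tri = lp_triangle[of q "\<lambda>n. cmod (a n)" "\<lambda>n. cmod (b n)", OF q norm_ge_zero ab(1)
          norm_ge_zero ab(2)]
      have le: "cmod (a n + b n) powr q \<le> (cmod (a n) + cmod (b n)) powr q" for n
        using q by (intro powr_mono2 norm_triangle_ineq) auto
      have s: "summable (\<lambda>n. cmod (a n + b n) powr q)"
        using le by - (rule summable_dominated[OF tri(1)], auto)
      then show "a \<oplus>\<^bsub>scalar_lp q\<^esub> b \<in> carrier (scalar_lp q)"
        by (simp add: scalar_lp_simps)
      have "(\<Sum>n. cmod (a n + b n) powr q) powr (1 / q) \<le>
          (\<Sum>n. (cmod (a n) + cmod (b n)) powr q) powr (1 / q)"
        using q s suminf_le[OF le s tri(1)] by (intro powr_mono2 suminf_nonneg) auto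
      then show "vnorm (scalar_lp q) (a \<oplus>\<^bsub>scalar_lp q\<^esub> b) \<le>
          vnorm (scalar_lp q) a + vnorm (scalar_lp q) b"
        using tri(2) by (simp add: scalar_lp_simps)
    qed (auto simp: scalar_lp_simps algebra_simps)
    show "(\<lambda>n. vnorm (scalar_lp q) (\<lambda>k. if k < n then 0 else a k)) \<longlonglongrightarrow> 0"
      if "a \<in> carrier (scalar_lp q)" for a
    proof -
      let ?f = "\<lambda>k. cmod (a k) powr q"
      have f: "summable ?f"
        using that by (simp add: scalar_lp_simps)
      have tails: "(\<lambda>k. cmod (if k < n then 0 else a k) powr q) sums (suminf ?f - sum ?f {..<n})"
          for n
      proof -
        have "(\<lambda>k. if k \<in> {..<n} then 0 else ?f k) sums (suminf ?f + (\<Sum>k<n. 0 - ?f k))"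
          by (rule sums_If_finite_set'[OF summable_sums[OF f]]) (simp_all add: sum_negf)
        moreover have "(\<lambda>k. if k \<in> {..<n} then 0 else ?f k) =
            (\<lambda>k. cmod (if k < n then 0 else a k) powr q)"
          by (intro ext) auto
        ultimately show ?thesis
          by (simp add: sum_negf)
      qed
      have nonneg: "0 \<le> (\<Sum>k. cmod (if k < n then 0 else a k) powr q)" for n
        using tails[of n] by (intro suminf_nonneg) (auto simp: sums_iff)
      have "(\<lambda>n. suminf ?f - sum ?f {..<n}) \<longlonglongrightarrow> suminf ?f - suminf ?f"
        by (intro tendsto_diff tendsto_const summable_LIMSEQ f)
      then have lim: "(\<lambda>n. (\<Sum>k. cmod (if k < n then 0 else a k) powr q)) \<longlonglongrightarrow> 0"
        using sums_unique[OF tails] by simp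
      show ?thesis
        unfolding scalar_lp_simps
      proof (rule tendsto_zero_powrI[OF lim tendsto_const])
        show "\<forall>\<^sub>F n in sequentially. 0 \<le> (\<Sum>k. cmod (if k < n then 0 else a k) powr q)"
          using nonneg by (intro always_eventually allI)
        show "0 < 1 / q"
          using q by simp
      qed
    qed
    show "(\<lambda>k. if k < n then a k else 0) \<in> carrier (scalar_lp q)" for a n
      using fin[of "\<lambda>k. k < n" a] by (simp add: scalar_lp_simps)
    show "a \<in> carrier (scalar_lp q)"
      if Cauchy: "\<And>\<epsilon>. \<epsilon> > 0 \<Longrightarrow> \<exists>N. \<forall>n. vnorm (scalar_lp q) (\<lambda>k. if N \<le> k \<and> k < n then a k else 0) \<le>
          \<epsilon>" for a
    proof -
      obtain N where N: "\<And>n. vnorm (scalar_lp q) (\<lambda>k. if N \<le> k \<and> k < n then a k else 0) \<le> 1"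
        using Cauchy[of 1] by auto
      have "(\<Sum>k<n. cmod (a k) powr q) \<le> (\<Sum>k<N. cmod (a k) powr q) + 1" for n
      proof -
        let ?g = "\<lambda>k. cmod (if N \<le> k \<and> k < n then a k else 0)"
        have s: "summable (\<lambda>k. ?g k powr q)"
          by (intro fin) simp
        have "(\<Sum>k. ?g k powr q) \<le> 1 powr q"
          using N[of n] vnorm_lp_le_iff[of q 1 ?g] s q by (simp add: scalar_lp_simps)
        moreover have "(\<Sum>k\<in>{N..<n}. ?g k powr q) \<le> (\<Sum>k. ?g k powr q)"
          using s by (intro sum_le_suminf) auto
        ultimately have 1: "(\<Sum>k\<in>{N..<n}. cmod (a k) powr q) \<le> 1"
          by simp
        have "(\<Sum>k<n. cmod (a k) powr q) \<le> (\<Sum>k\<in>{..<N} \<union> {N..<n}. cmod (a k) powr q)"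
          by (intro sum_mono2) auto
        also have "\<dots> = (\<Sum>k<N. cmod (a k) powr q) + (\<Sum>k\<in>{N..<n}. cmod (a k) powr q)"
          by (intro sum.union_disjoint) auto
        finally show ?thesis
          using 1 by simp
      qed
      then have "summable (\<lambda>k. cmod (a k) powr q)"
        by (intro summableI_nonneg_bounded) auto
      then show ?thesis
        by (simp add: scalar_lp_simps)
    qed
  qed
qed

lemma sequence_space_c0: "sequence_space c0_space"
proof -
  have simps: "carrier c0_space = {a. a \<longlonglongrightarrow> 0}" "zero c0_space = (\<lambda>n. 0)"
    "add c0_space = (\<lambda>a b n. a n + b n)" "Module.smult c0_space = (\<lambda>c a n. c * a n)"
    "vnorm c0_space a = (SUP n. cmod (a n))" for a
    by (simp_all add: c0_space_def)
  have bdd: "bdd_above (range (\<lambda>n. cmod (a n)))" if "a \<longlonglongrightarrow> 0" for a :: "nat \<Rightarrow> complex"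
  proof -
    have "bounded (range a)"
      using that by (rule convergent_imp_bounded)
    then obtain B where "\<And>n. cmod (a n) \<le> B"
      unfolding bounded_iff by blast
    then show ?thesis
      by (rule bdd_aboveI2)
  qed
  have coord: "cmod (a n) \<le> vnorm c0_space a" if "a \<longlonglongrightarrow> 0" for a n
    unfolding simps using bdd[OF that] by (intro cSUP_upper) auto
  have least: "vnorm c0_space a \<le> r" if "\<And>n. cmod (a n) \<le> r" for a r
    unfolding simps using that by (intro cSUP_least) auto
  have fin: "(\<lambda>k. if P k then a k else 0) \<longlonglongrightarrow> 0" if finP: "finite {k. P k}" for P
      and a :: "nat \<Rightarrow> complex"
  proof -
    obtain n where "{k. P k} \<subseteq> {..<n}"
      using finP finite_nat_iff_bounded by blast
    then have "\<And>k. k \<ge> n \<Longrightarrow> \<not> P k"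
      by (auto simp: subset_iff dest: leD)
    then have "\<forall>\<^sub>F k in sequentially. (if P k then a k else 0) = 0"
      unfolding eventually_sequentially by (intro exI[of _ n]) auto
    then show ?thesis
      by (rule tendsto_eventually)
  qed
  show ?thesis
  proof (rule sequence_space.intro)
    show "\<zero>\<^bsub>c0_space\<^esub> = (\<lambda>n. 0)" "(\<oplus>\<^bsub>c0_space\<^esub>) = (\<lambda>a b n. a n + b n)"
      "(\<odot>\<^bsub>c0_space\<^esub>) = (\<lambda>c a n. c * a n)"
      by (simp_all add: simps)
    show "cmod (a n) \<le> vnorm c0_space a" if "a \<in> carrier c0_space" for a n
      using that by (simp add: coord simps(1))
    show "a \<in> carrier c0_space \<and> vnorm c0_space a \<le> vnorm c0_space b"
      if b: "b \<in> carrier c0_space" and le: "\<And>n. cmod (a n) \<le> cmod (b n)" for a b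
    proof
      show "a \<in> carrier c0_space"
        using b unfolding simps mem_Collect_eq
        by (intro Lim_null_comparison[OF always_eventually[OF allI[OF le]] tendsto_norm_zero])
      show "vnorm c0_space a \<le> vnorm c0_space b"
        using b le coord[of b] by (intro least) (auto simp: simps(1) intro: order_trans)
    qed
    show "complex_normed_space c0_space"
    proof (rule complex_normed_spaceI)
      fix a assume "a \<in> carrier c0_space"
      then have a: "a \<longlonglongrightarrow> 0"
        by (simp add: simps)
      have ca: "(\<lambda>n. c * a n) \<longlonglongrightarrow> 0" for c
        using a by (rule tendsto_mult_right_zero)
      then show "c \<odot>\<^bsub>c0_space\<^esub> a \<in> carrier c0_space" for c
        by (simp add: simps)
      show "vnorm c0_space (c \<odot>\<^bsub>c0_space\<^esub> a) = cmod c * vnorm c0_space a" for c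
      proof (cases "c = 0")
        case False
        have "vnorm c0_space a \<le> vnorm c0_space (\<lambda>n. c * a n) / cmod c"
          using coord[OF ca, of c] False by (intro least) (simp add: norm_mult field_simps)
        then have "cmod c * vnorm c0_space a \<le> vnorm c0_space (\<lambda>n. c * a n)"
          using False by (simp add: field_simps)
        moreover have "vnorm c0_space (\<lambda>n. c * a n) \<le> cmod c * vnorm c0_space a"
          using coord[OF a] by (intro least) (simp add: norm_mult mult_left_mono)
        ultimately show ?thesis
          by (simp add: simps(4))
      qed (simp add: simps)
      show "a = \<zero>\<^bsub>c0_space\<^esub>" if "vnorm c0_space a = 0"
        using coord[OF a] that by (auto simp: simps)
      fix b assume "b \<in> carrier c0_space"
      then have b: "b \<longlonglongrightarrow> 0"
        by (simp add: simps)
      then show "a \<oplus>\<^bsub>c0_space\<^esub> b \<in> carrier c0_space"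
        using a tendsto_add_zero by (simp add: simps)
      have "vnorm c0_space (\<lambda>n. a n + b n) \<le> vnorm c0_space a + vnorm c0_space b"
        using coord[OF a] coord[OF b] by (intro least) (meson add_mono norm_triangle_le)
      then show "vnorm c0_space (a \<oplus>\<^bsub>c0_space\<^esub> b) \<le> vnorm c0_space a + vnorm c0_space b"
        by (simp add: simps(3))
    qed (auto simp: simps algebra_simps)
    show "(\<lambda>n. vnorm c0_space (\<lambda>k. if k < n then 0 else a k)) \<longlonglongrightarrow> 0" if "a \<in> carrier c0_space" for a
      unfolding LIMSEQ_def
    proof (intro allI impI)
      fix r :: real assume r: "r > 0"
      have a: "a \<longlonglongrightarrow> 0"
        using that by (simp add: simps)
      then obtain N where N: "\<And>n. n \<ge> N \<Longrightarrow> cmod (a n) < r / 2"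
        using r unfolding LIMSEQ_def by (metis dist_0_norm dist_commute half_gt_zero)
      have "vnorm c0_space (\<lambda>k. if k < n then 0 else a k) \<le> r / 2" if "n \<ge> N" for n
        using N that r by (intro least) (auto intro: less_imp_le)
      moreover have "0 \<le> vnorm c0_space (\<lambda>k. if k < n then 0 else a k)" for n
      proof -
        have "(\<lambda>k. if k < n then 0 else a k) \<longlonglongrightarrow> 0"
          using a by (intro Lim_null_comparison[OF _ tendsto_norm_zero[OF a]]) auto
        then show ?thesis
          using coord[of "\<lambda>k. if k < n then 0 else a k" 0] norm_ge_zero order_trans by blast
      qed
      ultimately show "\<exists>N. \<forall>n\<ge>N. dist (vnorm c0_space (\<lambda>k. if k < n then 0 else a k)) 0 < r"
        using r by (intro exI[of _ N]) (fastforce simp: dist_norm)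
    qed
    show "(\<lambda>k. if k < n then a k else 0) \<in> carrier c0_space" for a n
      using fin[of "\<lambda>k. k < n" a] by (simp add: simps)
    show "a \<in> carrier c0_space"
      if Cauchy: "\<And>\<epsilon>. \<epsilon> > 0 \<Longrightarrow> \<exists>N. \<forall>n. vnorm c0_space (\<lambda>k. if N \<le> k \<and> k < n then a k else 0) \<le> \<epsilon>"
          for a
      unfolding simps mem_Collect_eq LIMSEQ_def
    proof (intro allI impI)
      fix r :: real assume r: "r > 0"
      then obtain N where N: "\<And>n. vnorm c0_space (\<lambda>k. if N \<le> k \<and> k < n then a k else 0) \<le> r / 2"
        using Cauchy[of "r / 2"] r by auto
      have "cmod (a k) \<le> r / 2" if "k \<ge> N" for k
        using coord[OF fin[of "\<lambda>j. N \<le> j \<and> j < Suc k" a], of k] N[of "Suc k"] that by simp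
      then show "\<exists>N. \<forall>n\<ge>N. dist (a n) 0 < r"
        using r by (intro exI[of _ N]) (fastforce simp: dist_norm)
    qed
  qed
qed

lemma sequence_space_conj_space:
  assumes "p \<ge> 1"
  shows "sequence_space (conj_space p)"
  using assms sequence_space_c0 sequence_space_lp[of "p / (p - 1)"]
  by (auto simp: conj_space_def)

section \<open>Operators into and on \<open>\<ell>\<^sub>1\<close>\<close>

lemma l1_simps:
  "carrier (scalar_lp 1) = {a. summable (\<lambda>n. cmod (a n))}"
  "a \<in> carrier (scalar_lp 1) \<Longrightarrow> vnorm (scalar_lp 1) a = (\<Sum>n. cmod (a n))"
  by (auto simp: scalar_lp_simps suminf_nonneg)

text \<open>
  Only continuity matters, so the crude inequality \<open>u v \<le> u\<^sup>p + v\<^sup>q\<close> replaces Hoelder's inequality.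
\<close>

lemma multiplication_into_l1:
  assumes p: "p \<ge> 1" and \<tau>: "\<And>n. \<tau> n \<ge> 0" "summable (\<lambda>n. \<tau> n powr p)"
  shows "linear_operator (conj_space p) (scalar_lp 1) (\<lambda>a n. complex_of_real (\<tau> n) * a n)"
    and "\<exists>C. \<forall>a \<in> carrier (conj_space p).
      vnorm (scalar_lp 1) (\<lambda>n. complex_of_real (\<tau> n) * a n) \<le> C * vnorm (conj_space p) a"
proof -
  interpret Q: sequence_space "conj_space p"
    using p by (rule sequence_space_conj_space)
  interpret L: sequence_space "scalar_lp 1"
    by (rule sequence_space_lp) simp
  have bound: "\<exists>g. summable g \<and> suminf g \<le>
      (\<Sum>n. \<tau> n powr p) + 1 \<and> (\<forall>n. cmod (complex_of_real (\<tau> n) * a n) \<le> g n)"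
    if a: "a \<in> unit_ball (conj_space p)" for a
  proof (cases "p = 1")
    case True
    have "cmod (a n) \<le> 1" for n
      using a Q.coord_le[of a n] by (auto simp: unit_ball_def)
    then show ?thesis
      using True \<tau> by (intro exI[of _ "\<lambda>n. \<tau> n powr p"]) (auto simp: norm_mult mult_left_le)
  next
    case False
    define q where "q = p / (p - 1)"
    have p1: "p > 1" and q: "q > 1"
      using p False by (auto simp: q_def)
    have Q: "conj_space p = scalar_lp q"
      using False by (simp add: conj_space_def q_def)
    have s: "summable (\<lambda>n. cmod (a n) powr q)" and "(\<Sum>n. cmod (a n) powr q) powr (1 / q) \<le> 1"
      using a by (auto simp: unit_ball_def Q scalar_lp_simps)
    then have le: "(\<Sum>n. cmod (a n) powr q) \<le> 1"
      using q vnorm_lp_le_iff[of q 1 "\<lambda>n. cmod (a n)"] by simp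
    have young: "u * v \<le> u powr p + v powr q" if "u \<ge> 0" "v \<ge> 0" for u v :: real
    proof (cases "v \<le> u powr (p - 1)")
      case True
      then have "u * v \<le> u * u powr (p - 1)"
        using that by (intro mult_left_mono)
      also have "\<dots> = u powr p"
        using that p1 powr_mult_base[of u "p - 1"] by simp
      finally show ?thesis
        by (simp add: add_increasing2)
    next
      case False
      then have "u powr (p - 1) \<le> v"
        by simp
      then have "(u powr (p - 1)) powr (1 / (p - 1)) \<le> v powr (1 / (p - 1))"
        using p1 by (intro powr_mono2) auto
      then have "u \<le> v powr (q - 1)"
        using p1 that by (simp add: powr_powr q_def field_simps)
      then have "u * v \<le> v powr (q - 1) * v"
        using that by (intro mult_right_mono)
      also have "\<dots> = v powr q"
        using that q powr_mult_base[of v "q - 1"] by (simp add: mult.commute)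
      finally show ?thesis
        by (simp add: add_increasing)
    qed
    have "suminf (\<lambda>n. \<tau> n powr p + cmod (a n) powr q) \<le> (\<Sum>n. \<tau> n powr p) + 1"
      using le suminf_add[OF \<tau>(2) s] by simp
    then show ?thesis
      using young \<tau> s by (intro exI[of _ "\<lambda>n. \<tau> n powr p + cmod (a n) powr q"])
        (auto simp: norm_mult intro: summable_add)
  qed
  have in_l1: "(\<lambda>n. complex_of_real (\<tau> n) * a n) \<in> carrier (scalar_lp 1)"
      if a: "a \<in> carrier (conj_space p)" for a
  proof -
    \<comment> \<open>Multiplication by \<open>t\<close> brings \<open>a\<close> into the unit ball, also for \<open>a = 0\<close>.\<close>
    define t where "t = complex_of_real (inverse (vnorm (conj_space p) a + 1))"
    have n0: "vnorm (conj_space p) a \<ge> 0"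
      using a by (rule Q.vnorm_nonneg)
    then have t: "t \<noteq> 0"
      by (simp add: t_def add_nonneg_eq_0_iff flip: of_real_add)
    have "vnorm (conj_space p) (\<lambda>n. t * a n) =
        inverse (vnorm (conj_space p) a + 1) * vnorm (conj_space p) a"
      using n0 by (simp add: Q.vnorm_scale[OF a] t_def norm_inverse flip: of_real_add)
    also have "\<dots> \<le> 1"
      using n0 by (simp add: field_simps)
    finally have "(\<lambda>n. t * a n) \<in> unit_ball (conj_space p)"
      using a Q.smult_in' by (simp add: unit_ball_def)
    then obtain g where "summable g" "\<And>n. cmod (complex_of_real (\<tau> n) * (t * a n)) \<le> g n"
      using bound by meson
    then have "summable (\<lambda>n. cmod (complex_of_real (\<tau> n) * (t * a n)))"
      by - (rule summable_dominated[of g], auto)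
    then have "summable (\<lambda>n. inverse (cmod t) * cmod (complex_of_real (\<tau> n) * (t * a n)))"
      by (rule summable_mult)
    then show ?thesis
      using t by (simp add: l1_simps norm_mult field_simps)
  qed
  show lin: "linear_operator (conj_space p) (scalar_lp 1) (\<lambda>a n. complex_of_real (\<tau> n) * a n)"
    by (rule linear_operatorI) (auto simp: in_l1 Q.ops L.ops distrib_left mult.left_commute)
  interpret T: linear_operator_between "conj_space p" "scalar_lp 1" "\<lambda>a n. complex_of_real (\<tau> n) *
      a n"
    by standard (rule lin)
  have "vnorm (scalar_lp 1) (\<lambda>n. complex_of_real (\<tau> n) * a n) \<le> (\<Sum>n. \<tau> n powr p) + 1"
    if a: "a \<in> unit_ball (conj_space p)" for a
  proof -
    obtain g where g: "summable g" "suminf g \<le> (\<Sum>n. \<tau> n powr p) + 1"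
      "\<And>n. cmod (complex_of_real (\<tau> n) * a n) \<le> g n"
      using bound[OF a] by blast
    have in1: "(\<lambda>n. complex_of_real (\<tau> n) * a n) \<in> carrier (scalar_lp 1)"
      using a by (intro in_l1) (simp add: unit_ball_def)
    then have "vnorm (scalar_lp 1) (\<lambda>n. complex_of_real (\<tau> n) * a n) =
        (\<Sum>n. cmod (complex_of_real (\<tau> n) * a n))"
      by (rule l1_simps)
    also have "\<dots> \<le> suminf g"
      using g in1 by (intro suminf_le) (auto simp: l1_simps(1))
    finally show ?thesis
      using g by simp
  qed
  then show "\<exists>C. \<forall>a \<in> carrier (conj_space p).
      vnorm (scalar_lp 1) (\<lambda>n. complex_of_real (\<tau> n) * a n) \<le> C * vnorm (conj_space p) a"
    using T.vnorm_le_of_unit_ball by blast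
qed

text \<open>
  A bounded sequence in a Banach space extends from the unit vectors to a contraction on \<open>\<ell>\<^sub>1\<close>.
\<close>

lemma l1_synthesis:
  assumes F: "complex_banach_space F" and e: "\<And>n. e n \<in> carrier F" "\<And>n. vnorm F (e n) \<le> 1"
  obtains \<Psi> where "linear_operator (scalar_lp 1) F \<Psi>"
    "\<And>b. b \<in> carrier (scalar_lp 1) \<Longrightarrow> vnorm F (\<Psi> b) \<le> vnorm (scalar_lp 1) b"
    "\<And>b. b \<in> carrier (scalar_lp 1) \<Longrightarrow>
      limitin (vtopology F) (\<lambda>N. finsum F (\<lambda>n. b n \<odot>\<^bsub>F\<^esub> e n) {..<N}) (\<Psi> b) sequentially"
proof -
  interpret F: complex_banach_space F by (rule F)
  interpret L: sequence_space "scalar_lp 1"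
    by (rule sequence_space_lp) simp
  define s where "s = (\<lambda>b N. finsum F (\<lambda>n. b n \<odot>\<^bsub>F\<^esub> e n) {..<N::nat})"
  have s0: "s b 0 = \<zero>\<^bsub>F\<^esub>" and sSuc: "s b (Suc N) = b N \<odot>\<^bsub>F\<^esub> e N \<oplus>\<^bsub>F\<^esub> s b N" for b N
    using e by (simp_all add: s_def lessThan_Suc)
  have sin: "s b N \<in> carrier F" for b N
    using e by (simp add: s_def F.M.finsum_closed)
  have sadd: "s (\<lambda>n. a n + b n) N = s a N \<oplus>\<^bsub>F\<^esub> s b N" for a b N
    by (induction N) (use e sin in \<open>simp_all add: s0 sSuc F.smult_plus F.M.a_ac\<close>)
  have ssmult: "s (\<lambda>n. c * b n) N = c \<odot>\<^bsub>F\<^esub> s b N" for c b N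
    by (induction N) (use e sin in \<open>simp_all add: s0 sSuc F.smult_distrib F.smult_smult\<close>)
  have snorm: "vnorm F (s b N) \<le> (\<Sum>n<N. cmod (b n))" for b N
  proof (induction N)
    case (Suc N)
    have "vnorm F (s b (Suc N)) \<le> vnorm F (b N \<odot>\<^bsub>F\<^esub> e N) + vnorm F (s b N)"
      unfolding sSuc using e sin by (intro F.vnorm_triangle) auto
    also have "vnorm F (b N \<odot>\<^bsub>F\<^esub> e N) \<le> cmod (b N)"
      using e by (simp add: F.vnorm_smult mult_left_le)
    finally show ?case
      using Suc by simp
  qed (simp add: s0 F.vnorm_zero)
  have "\<exists>l. limitin (vtopology F) (s b) l sequentially" if b: "b \<in> carrier (scalar_lp 1)" for b
  proof (rule F.summable_increments_limitin)
    show "vnorm F (s b (Suc k) \<ominus>\<^bsub>F\<^esub> s b k) \<le> cmod (b k)" for k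
      using e sin by (simp add: sSuc F.vnorm_smult mult_left_le)
    show "summable (\<lambda>k. cmod (b k))"
      using b by (simp add: l1_simps)
  qed (rule sin)
  then obtain \<Psi> where \<Psi>: "\<And>b. b \<in> carrier (scalar_lp 1) \<Longrightarrow>
      limitin (vtopology F) (s b) (\<Psi> b) sequentially"
    by metis
  have \<Psi>in: "\<Psi> b \<in> carrier F" if "b \<in> carrier (scalar_lp 1)" for b
    using limitin_topspace[OF \<Psi>[OF that]] by simp
  have lin: "linear_operator (scalar_lp 1) F \<Psi>"
  proof (rule linear_operatorI)
    fix a assume a: "a \<in> carrier (scalar_lp 1)"
    show "\<Psi> a \<in> carrier F"
      using a by (rule \<Psi>in)
    have "limitin (vtopology F) (\<lambda>N. c \<odot>\<^bsub>F\<^esub> s a N) (c \<odot>\<^bsub>F\<^esub> \<Psi> a) sequentially" for c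
      using sin \<Psi>[OF a] by (intro F.limitin_smult) auto
    then show "\<Psi> (c \<odot>\<^bsub>scalar_lp 1\<^esub> a) = c \<odot>\<^bsub>F\<^esub> \<Psi> a" for c
      using F.limitin_unique \<Psi>[OF L.smult_in'[OF a, of c]] by (auto simp: ssmult[abs_def] L.ops)
    fix b assume b: "b \<in> carrier (scalar_lp 1)"
    have "limitin (vtopology F) (\<lambda>N. s a N \<oplus>\<^bsub>F\<^esub> s b N) (\<Psi> a \<oplus>\<^bsub>F\<^esub> \<Psi> b) sequentially"
      using sin \<Psi>[OF a] \<Psi>[OF b] by (intro F.limitin_add) auto
    then show "\<Psi> (a \<oplus>\<^bsub>scalar_lp 1\<^esub> b) = \<Psi> a \<oplus>\<^bsub>F\<^esub> \<Psi> b"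
      using F.limitin_unique \<Psi>[OF L.add_in[OF a b]] by (auto simp: sadd[abs_def] L.ops)
  qed
  moreover have "vnorm F (\<Psi> b) \<le> vnorm (scalar_lp 1) b" if b: "b \<in> carrier (scalar_lp 1)" for b
  proof (rule LIMSEQ_le_const2)
    show "(\<lambda>N. vnorm F (s b N)) \<longlonglongrightarrow> vnorm F (\<Psi> b)"
      using sin \<Psi>[OF b] by (intro F.limitin_vnorm) auto
    have "(\<Sum>n<N. cmod (b n)) \<le> vnorm (scalar_lp 1) b" for N
      unfolding l1_simps(2)[OF b] using b by (intro sum_le_suminf) (auto simp: l1_simps)
    then show "\<exists>N. \<forall>n\<ge>N. vnorm F (s b n) \<le> vnorm (scalar_lp 1) b"
      using snorm[of b] order_trans by blast
  qed
  ultimately show thesis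
    using \<Psi> unfolding s_def by (intro that[of \<Psi>]) auto
qed

text \<open>
  A convergent series with nonnegative terms stays convergent after division by a suitable null
  sequence. With \<open>R n\<close> the remainder of the series from the index \<open>n\<close> on, dividing by \<open>sqrt (R n)\<close> works,
  since \<open>s n / sqrt (R n) \<le> 2 (sqrt (R n) - sqrt (R (n + 1)))\<close> telescopes. Starting the division late
  makes the additional cost as small as desired.
\<close>

lemma summable_null_multiplier:
  fixes s :: "nat \<Rightarrow> real"
  assumes s: "\<And>n. s n \<ge> 0" "summable s" and \<epsilon>: "\<epsilon> > 0"
  obtains d where "\<And>n. 0 < d n" "\<And>n. d n \<le> 1" "d \<longlonglongrightarrow> 0"
    "summable (\<lambda>n. s n / d n)" "(\<Sum>n. s n / d n) \<le> (\<Sum>n. s n) + \<epsilon>"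
proof -
  define R where "R = (\<lambda>n. suminf s - sum s {..<n})"
  have R0: "R n \<ge> 0" for n
    using sum_le_suminf[OF s(2), of "{..<n}"] s(1) by (simp add: R_def)
  have RS: "R (Suc n) = R n - s n" for n
    by (simp add: R_def)
  have "R \<longlonglongrightarrow> suminf s - suminf s"
    unfolding R_def by (intro tendsto_diff tendsto_const summable_LIMSEQ s)
  then have Rlim: "R \<longlonglongrightarrow> 0"
    by simp
  then have sqlim: "(\<lambda>n. sqrt (R n)) \<longlonglongrightarrow> 0"
    using tendsto_real_sqrt[of R 0] by simp
  obtain N where N: "\<And>n. n \<ge> N \<Longrightarrow> sqrt (R n) < min 1 (\<epsilon> / 2)"
    using order_tendstoD(2)[OF sqlim, of "min 1 (\<epsilon> / 2)"] \<epsilon> by (auto simp: eventually_sequentially)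
  \<comment> \<open>The maximum keeps \<open>d n\<close> positive if the remainder of the series vanishes from some index on.\<close>
  define d where "d = (\<lambda>n. if n < N then 1 else max (sqrt (R n)) (1 / (real n + 1)))"
  have d: "0 < d n" "d n \<le> 1" for n
    using N[of n] by (auto simp: d_def less_max_iff_disj)
  have dlim: "d \<longlonglongrightarrow> 0"
  proof -
    have "(\<lambda>n. sqrt (R n) + 1 / (real n + 1)) \<longlonglongrightarrow> 0 + 0"
      by (intro tendsto_add sqlim) real_asymp
    moreover have "\<forall>\<^sub>F n in sequentially. norm (d n) \<le> sqrt (R n) + 1 / (real n + 1)"
    proof -
      have "norm (d n) \<le> sqrt (R n) + 1 / (real n + 1)" if "n \<ge> N" for n
        using that R0[of n] by (simp add: d_def max_def)
      then show ?thesis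
        unfolding eventually_sequentially by blast
    qed
    ultimately show ?thesis
      by (intro Lim_null_comparison[of d]) auto
  qed
  have tele: "s n / d n \<le> 2 * (sqrt (R n) - sqrt (R (Suc n)))" if n: "n \<ge> N" for n
  proof (cases "R n = 0")
    case True
    then have "s n = 0" "R (Suc n) = 0"
      using RS[of n] R0[of "Suc n"] s(1)[of n] by auto
    then show ?thesis
      using True by simp
  next
    case False
    then have pos: "sqrt (R n) > 0"
      using R0[of n] by (simp add: less_le)
    have "s n / d n \<le> s n / sqrt (R n)"
      using n pos s(1) by (intro divide_left_mono) (auto simp: d_def less_max_iff_disj)
    also have "s n / sqrt (R n) = (sqrt (R n) - sqrt (R (Suc n))) * (sqrt (R n) + sqrt (R (Suc
        n))) / sqrt (R n)"
      using R0[of n] R0[of "Suc n"] RS[of n] by (simp add: algebra_simps)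
    also have "\<dots> \<le> (sqrt (R n) - sqrt (R (Suc n))) * (2 * sqrt (R n)) / sqrt (R n)"
      using pos RS[of n] s(1)[of n] R0 by (intro divide_right_mono mult_left_mono) auto
    also have "\<dots> = 2 * (sqrt (R n) - sqrt (R (Suc n)))"
      using pos by simp
    finally show ?thesis .
  qed
  have half: "2 * (a - b) \<le> e" if "a < e / 2" "0 \<le> b" for a b e :: real
    using that by (simp add: field_simps)
  have partial: "(\<Sum>n<m. s n / d n) \<le> (\<Sum>n. s n) + \<epsilon>" for m
  proof -
    have 0: "s n / d n \<ge> 0" for n
      using s d by (simp add: less_imp_le)
    have "(\<Sum>n<m. s n / d n) \<le> (\<Sum>n\<in>{..<N} \<union> {N..<N + m}. s n / d n)"
      using 0 by (intro sum_mono2) auto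
    also have "\<dots> = (\<Sum>n<N. s n / d n) + (\<Sum>n\<in>{N..<N + m}. s n / d n)"
      by (intro sum.union_disjoint) auto
    also have "(\<Sum>n<N. s n / d n) = (\<Sum>n<N. s n)"
      by (intro sum.cong) (auto simp: d_def)
    also have "(\<Sum>n<N. s n) \<le> suminf s"
      using s by (intro sum_le_suminf) auto
    also have "(\<Sum>n\<in>{N..<N + m}. s n / d n) \<le> 2 * (sqrt (R N) - sqrt (R (N + m)))"
    proof (induction m)
      case (Suc m)
      then show ?case
        using tele[of "N + m"] by simp
    qed simp
    also have "\<dots> \<le> \<epsilon>"
    proof -
      have "sqrt (R N) < \<epsilon> / 2"
        by (rule less_le_trans[OF N min.cobounded2]) simp
      then show ?thesis
        using half[OF _ real_sqrt_ge_zero[OF R0[of "N + m"]]] by blast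
    qed
    finally show ?thesis
      by simp
  qed
  have "summable (\<lambda>n. s n / d n)"
    using partial s d by (intro summableI_nonneg_bounded) (auto simp: less_imp_le)
  moreover from this have "(\<Sum>n. s n / d n) \<le> (\<Sum>n. s n) + \<epsilon>"
    using partial by (rule suminf_le_const)
  ultimately show thesis
    using that d dlim by blast
qed

section \<open>Relatively \<open>p\<close>-compact sets and factorizations\<close>

lemma lp_space_simps:
  "x \<in> carrier (lp_space p V) \<longleftrightarrow> (\<forall>n. x n \<in> carrier V) \<and> summable (\<lambda>n. vnorm V (x n) powr p)"
  "vnorm (lp_space p V) x = (\<Sum>n. vnorm V (x n) powr p) powr (1 / p)"
  by (auto simp: lp_space_def)

lemma lp_space_dominated:
  assumes p: "p \<ge> 1" and K: "K \<ge> 0" and x: "summable (\<lambda>n. \<sigma> n powr p)" "\<And>n. 0 \<le> \<sigma> n"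
    and F: "complex_normed_space F" and y: "\<And>n. y n \<in> carrier F" "\<And>n. vnorm F (y n) \<le> K * \<sigma> n"
  shows "y \<in> carrier (lp_space p F)"
    and "vnorm (lp_space p F) y \<le> K * (\<Sum>n. \<sigma> n powr p) powr (1 / p)"
proof -
  interpret F: complex_normed_space F by (rule F)
  have le: "vnorm F (y n) powr p \<le> K powr p * \<sigma> n powr p" for n
    using powr_mono2[of p "vnorm F (y n)" "K * \<sigma> n"] y F.vnorm_nonneg p K x by (simp add: powr_mult)
  have s: "summable (\<lambda>n. K powr p * \<sigma> n powr p)"
    using x by (intro summable_mult)
  have sy: "summable (\<lambda>n. vnorm F (y n) powr p)"
    using le by - (rule summable_dominated[OF s], auto)
  then show "y \<in> carrier (lp_space p F)"
    using y by (simp add: lp_space_simps)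
  have "(\<Sum>n. vnorm F (y n) powr p) \<le> K powr p * (\<Sum>n. \<sigma> n powr p)"
    using suminf_le[OF le sy s] x by (simp add: suminf_mult)
  then have "(\<Sum>n. vnorm F (y n) powr p) powr (1 / p) \<le> (K powr p * (\<Sum>n. \<sigma> n powr p)) powr (1 / p)"
    using p sy by (intro powr_mono2 suminf_nonneg) auto
  also have "\<dots> = K * (\<Sum>n. \<sigma> n powr p) powr (1 / p)"
    using K p x by (simp add: powr_mult powr_powr suminf_nonneg)
  finally show "vnorm (lp_space p F) y \<le> K * (\<Sum>n. \<sigma> n powr p) powr (1 / p)"
    by (simp add: lp_space_simps)
qed

lemma m_p_le:
  assumes "x \<in> carrier (lp_space p V)" "K \<subseteq> p_conv p V x"
  shows "m_p p V K \<le> vnorm (lp_space p V) x"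
  unfolding m_p_def using assms
  by (intro cInf_lower bdd_belowI[where m = 0]) (auto simp: lp_space_simps)

lemma m_p_nonneg: "relatively_p_compact p V K \<Longrightarrow> 0 \<le> m_p p V K"
  unfolding m_p_def relatively_p_compact_def
  by (intro cInf_greatest) (auto simp: lp_space_simps)

lemma m_p_less:
  assumes "relatively_p_compact p V K" "m_p p V K < r"
  obtains x where "x \<in> carrier (lp_space p V)" "K \<subseteq> p_conv p V x" "vnorm (lp_space p V) x < r"
proof -
  have "{vnorm (lp_space p V) x | x. x \<in> carrier (lp_space p V) \<and> K \<subseteq> p_conv p V x} \<noteq> {}"
    using assms(1) unfolding relatively_p_compact_def by auto
  from cInf_lessD[OF this assms(2)[unfolded m_p_def]] show thesis
    using that by auto
qed

lemma compact_operator_vnorm_le: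
  assumes X: "complex_normed_space X" and Y: "complex_normed_space Y"
      and S: "compact_operator X Y S"
  shows "0 \<le> operator_norm X Y S"
    and "x \<in> carrier X \<Longrightarrow> vnorm Y (S x) \<le> operator_norm X Y S * vnorm X x"
proof -
  have lin: "linear_operator X Y S" and comp: "relatively_compact Y (S ` unit_ball X)"
    using S by (auto simp: compact_operator_def)
  interpret X: complex_normed_space X by (rule X)
  interpret Y: complex_normed_space Y by (rule Y)
  interpret S: linear_operator_between X Y S by standard (rule lin)
  obtain B where "\<And>y. y \<in> S ` unit_ball X \<Longrightarrow> vnorm Y y \<le> B"
    using Y.relatively_compact_bounded[OF comp] by blast
  then have bdd: "bdd_above ((\<lambda>x. vnorm Y (S x)) ` unit_ball X)"
    by (intro bdd_aboveI2[where M = B]) auto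
  have le: "vnorm Y (S x) \<le> operator_norm X Y S" if "x \<in> unit_ball X" for x
    unfolding operator_norm_def using that bdd by (rule cSUP_upper)
  have "\<zero>\<^bsub>X\<^esub> \<in> unit_ball X"
    by (simp add: unit_ball_def X.vnorm_zero)
  from le[OF this] show "0 \<le> operator_norm X Y S"
    by (simp add: S.zero Y.vnorm_zero)
  show "vnorm Y (S x) \<le> operator_norm X Y S * vnorm X x" if "x \<in> carrier X" for x
    using le that by (rule S.vnorm_le_of_unit_ball)
qed

lemma sup_norm_bounds:
  assumes "f \<in> H_inf E U F"
  shows "0 \<le> sup_norm U F f" and "u \<in> U \<Longrightarrow> vnorm F (f u) \<le> sup_norm U F f"
proof -
  have bdd: "bdd_above (insert 0 ((\<lambda>x. vnorm F (f x)) ` U))"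
    using assms by (simp add: H_inf_def)
  show "0 \<le> sup_norm U F f"
    unfolding sup_norm_def using bdd by (intro cSup_upper) auto
  show "vnorm F (f u) \<le> sup_norm U F f" if "u \<in> U"
    unfolding sup_norm_def using bdd that by (intro cSup_upper) auto
qed

text \<open>
  If \<open>T\<close> maps the unit ball into the \<open>p\<close>-convex hull of \<open>x\<close>, then \<open>S \<circ> T\<close> maps a set of vectors of norm at
  most \<open>c\<close> into that of \<open>c S x\<close>: a continuous linear operator acts termwise on the convergent series.
\<close>

lemma p_conv_of_factorization:
  assumes p: "p \<ge> 1" and X: "complex_normed_space X" and G: "complex_normed_space G"
      and F: "complex_normed_space F"
    and T: "linear_operator X G T" and S: "linear_operator G F S"
    and s: "s \<ge> 0" "\<And>v. v \<in> carrier G \<Longrightarrow> vnorm F (S v) \<le> s * vnorm G v"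
    and x: "x \<in> carrier (lp_space p G)" "T ` unit_ball X \<subseteq> p_conv p G x"
    and c: "c > 0" and A: "\<And>a. a \<in> A \<Longrightarrow> a \<in> carrier X \<and> vnorm X a \<le> c"
  obtains y where "y \<in> carrier (lp_space p F)" "(\<lambda>a. S (T a)) ` A \<subseteq> p_conv p F y"
    "vnorm (lp_space p F) y \<le> c * s * vnorm (lp_space p G) x"
proof -
  interpret X: complex_normed_space X by (rule X)
  interpret G: complex_normed_space G by (rule G)
  interpret F: complex_normed_space F by (rule F)
  interpret T: linear_operator_between X G T by standard (rule T)
  interpret S: linear_operator_between G F S by standard (rule S)
  let ?R = "\<lambda>v. complex_of_real c \<odot>\<^bsub>F\<^esub> S v"
  have lin: "linear_operator G F ?R"
    by (rule linear_operatorI) (simp_all add: S.add S.smult F.smult_distrib F.smult_smult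
        mult.commute)
  interpret R: linear_operator_between G F ?R by standard (rule lin)
  have R_le: "vnorm F (?R v) \<le> (c * s) * vnorm G v" if "v \<in> carrier G" for v
    using s(2)[OF that] that c by (simp add: F.vnorm_smult mult.assoc)
  have xG: "x n \<in> carrier G" and xs: "summable (\<lambda>n. vnorm G (x n) powr p)" for n
    using x(1) by (auto simp: lp_space_simps)
  define y where "y = (\<lambda>n. ?R (x n))"
  have yF: "y n \<in> carrier F" for n
    unfolding y_def using xG by simp
  have "y \<in> carrier (lp_space p F)" "vnorm (lp_space p F) y \<le> (c * s) * vnorm (lp_space p G) x"
    using lp_space_dominated[OF p _ xs _ F yF, of "c * s"] R_le[OF xG] G.vnorm_nonneg[OF xG] c s(1)
    by (simp_all add: y_def lp_space_simps(2))
  moreover have "(\<lambda>a. S (T a)) ` A \<subseteq> p_conv p F y"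
  proof
    fix z assume "z \<in> (\<lambda>a. S (T a)) ` A"
    then obtain a where a: "a \<in> carrier X" "vnorm X a \<le> c" and z: "z = S (T a)"
      using A by blast
    let ?a = "complex_of_real (1 / c) \<odot>\<^bsub>X\<^esub> a"
    have "vnorm X ?a = vnorm X a / c"
      unfolding X.vnorm_smult[OF a(1)] norm_of_real using c by simp
    then have "?a \<in> unit_ball X"
      using a c by (simp add: unit_ball_def)
    then have "T ?a \<in> p_conv p G x"
      using x(2) by blast
    then obtain b where b: "b \<in> unit_ball (conj_space p)"
      and lim: "limitin (vtopology G) (\<lambda>N. finsum G (\<lambda>n. b n \<odot>\<^bsub>G\<^esub> x n) {..<N}) (T ?a) sequentially"
      by (auto simp: p_conv_def)
    have "limitin (vtopology F) (\<lambda>N. ?R (finsum G (\<lambda>n. b n \<odot>\<^bsub>G\<^esub> x n) {..<N})) (?R (T ?a))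
        sequentially"
      by (rule R.limitin_image[OF R_le _ lim]) (use xG in \<open>auto intro!: G.M.finsum_closed\<close>)
    moreover have "?R (T ?a) = z"
      using a(1) c by (simp add: z T.smult S.smult F.smult_smult flip: of_real_mult del:
          of_real_divide)
    moreover have "?R (finsum G (\<lambda>n. b n \<odot>\<^bsub>G\<^esub> x n) {..<N}) = finsum F (\<lambda>n. b n \<odot>\<^bsub>F\<^esub> y n) {..<N}" for N
      unfolding y_def using xG by (intro R.finsum_smult) auto
    ultimately show "z \<in> p_conv p F y"
      using b by (auto simp: p_conv_def)
  qed
  ultimately show thesis
    using that by blast
qed

text \<open>
  Both the bound for the range of \<open>g\<close> and the sequence for \<open>T\<close> are taken with a slack \<open>\<delta>\<close>, which also
  covers \<open>g = 0\<close> and an infimum in the definition of \<open>k_p\<close> that is not attained.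
\<close>

lemma factorization_imp_relatively_p_compact:
  assumes p: "p \<ge> 1" and F: "complex_normed_space F"
    and fact: "p_compact_factorization p E U F f M G T g S"
  shows "relatively_p_compact p F (f ` U)"
    and "m_p p F (f ` U) \<le> operator_norm G F S * k_p p (quotient_space (conj_space p) M) G T *
      sup_norm U (quotient_space (conj_space p) M) g"
    and "0 \<le> operator_norm G F S" "0 \<le> k_p p (quotient_space (conj_space p) M) G T"
    "0 \<le> sup_norm U (quotient_space (conj_space p) M) g"
proof -
  let ?X = "quotient_space (conj_space p) M"
  interpret Q: sequence_space "conj_space p"
    using p by (rule sequence_space_conj_space)
  have M: "closed_subspace M (conj_space p)" and Gb: "complex_banach_space G"
    and T: "p_compact_operator p ?X G T" and g: "g \<in> H_inf_K E U ?X" and S: "compact_operator G F S"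
    and f: "\<And>u. u \<in> U \<Longrightarrow> f u = S (T (g u))"
    using fact by (auto simp: p_compact_factorization_def)
  interpret X: quotient_map "conj_space p" ?X "\<lambda>x. M +>\<^bsub>conj_space p\<^esub> x"
    by (rule quotient_space_quotient_map[OF Q.complex_banach_space M])
  have G: "complex_normed_space G"
    using Gb by (rule complex_banach_space.axioms)
  have Tlin: "linear_operator ?X G T" and Tp: "relatively_p_compact p G (T ` unit_ball ?X)"
    using T by (auto simp: p_compact_operator_def)
  have Slin: "linear_operator G F S"
    using S by (simp add: compact_operator_def)
  have gH: "g \<in> H_inf E U ?X"
    using g by (simp add: H_inf_K_def)
  then have gX: "g u \<in> carrier ?X" if "u \<in> U" for u
    using that by (auto simp: H_inf_def holomorphic_map_def)
  let ?s = "operator_norm G F S" and ?k = "k_p p ?X G T" and ?c = "sup_norm U ?X g"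
  note s = compact_operator_vnorm_le[OF G F S]
  show "0 \<le> ?s" by (rule s)
  show "0 \<le> ?c" using gH by (rule sup_norm_bounds)
  show "0 \<le> ?k" unfolding k_p_def using Tp by (rule m_p_nonneg)
  have main: "\<exists>y. y \<in> carrier (lp_space p F) \<and> f ` U \<subseteq> p_conv p F y \<and>
      vnorm (lp_space p F) y \<le> (?c + \<delta>) * ?s * (?k + \<delta>)" if \<delta>: "\<delta> > 0" for \<delta>
  proof -
    obtain x where x: "x \<in> carrier (lp_space p G)" "T ` unit_ball ?X \<subseteq> p_conv p G x" "vnorm
        (lp_space p G) x < ?k + \<delta>"
      using m_p_less[OF Tp, of "?k + \<delta>"] \<delta> by (auto simp: k_p_def)
    have c: "?c + \<delta> > 0"
      using \<open>0 \<le> ?c\<close> \<delta> by simp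
    have A: "a \<in> carrier ?X \<and> vnorm ?X a \<le> ?c + \<delta>" if "a \<in> g ` U" for a
      using that gX sup_norm_bounds(2)[OF gH] \<delta> by fastforce
    obtain y where y: "y \<in> carrier (lp_space p F)" "(\<lambda>a. S (T a)) ` (g ` U) \<subseteq> p_conv p F y"
      "vnorm (lp_space p F) y \<le> (?c + \<delta>) * ?s * vnorm (lp_space p G) x"
      by (rule p_conv_of_factorization[OF p X.complex_normed_space G F Tlin Slin s(1) s(2) x(1,2)
          c A])
    have "f ` U = (\<lambda>a. S (T a)) ` (g ` U)"
      using f by (auto simp: image_iff)
    moreover have "(?c + \<delta>) * ?s * vnorm (lp_space p G) x \<le> (?c + \<delta>) * ?s * (?k + \<delta>)"
      using x(3) c \<open>0 \<le> ?s\<close> by (intro mult_left_mono) auto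
    ultimately show ?thesis
      using y by (intro exI[of _ y]) auto
  qed
  show "relatively_p_compact p F (f ` U)"
    using main[of 1] by (auto simp: relatively_p_compact_def)
  have le: "m_p p F (f ` U) \<le> (?c + \<delta>) * ?s * (?k + \<delta>)" if "\<delta> > 0" for \<delta>
    using main[OF that] m_p_le order_trans by blast
  have "(\<lambda>n. (?c + 1 / (real n + 1)) * ?s * (?k + 1 / (real n + 1))) \<longlonglongrightarrow> (?c + 0) * ?s * (?k + 0)"
    by (intro tendsto_intros) real_asymp+
  then have "m_p p F (f ` U) \<le> (?c + 0) * ?s * (?k + 0)"
    using le by (intro LIMSEQ_le_const) auto
  then show "m_p p F (f ` U) \<le> ?s * ?k * ?c"
    by (simp add: mult_ac)
qed

section \<open>Cardinality and compactness of the factors\<close>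

text \<open>
  A complex sequence is determined by the rational Dedekind cuts of the real and imaginary parts of
  its terms, which together form a subset of a countable set.
\<close>

lemma nat_complex_lepoll_reals: "(UNIV :: (nat \<Rightarrow> complex) set) \<lesssim> (UNIV :: real set)"
proof -
  define D :: "(nat \<Rightarrow> complex) \<Rightarrow> (nat \<times> bool \<times> rat) set"
    where "D = (\<lambda>a. {(n, b, q). real_of_rat q < (if b then Re (a n) else Im (a n))})"
  have cut: "x = y" if "\<And>q. real_of_rat q < x \<longleftrightarrow> real_of_rat q < y" for x y :: real
    using that of_rat_dense by (metis less_irrefl linorder_less_linear order_less_trans)
  have "inj D"
  proof (rule injI)
    fix a b assume eq: "D a = D b"
    show "a = b"
    proof
      fix n
      have "real_of_rat q < Re (a n) \<longleftrightarrow> real_of_rat q < Re (b n)" for q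
        using arg_cong[OF eq, of "\<lambda>S. (n, True, q) \<in> S"] by (simp add: D_def)
      moreover have "real_of_rat q < Im (a n) \<longleftrightarrow> real_of_rat q < Im (b n)" for q
        using arg_cong[OF eq, of "\<lambda>S. (n, False, q) \<in> S"] by (simp add: D_def)
      ultimately show "a n = b n"
        using cut by (simp add: complex_eq_iff)
    qed
  qed
  then have "inj (\<lambda>a. to_nat ` D a)"
    by (simp add: inj_def inj_image_eq_iff)
  then have "(UNIV :: (nat \<Rightarrow> complex) set) \<lesssim> (UNIV :: nat set set)"
    unfolding lepoll_def by blast
  then show ?thesis
    using nat_sets_eqpoll_reals eqpoll_imp_lepoll lepoll_trans by blast
qed

lemma (in complex_normed_space) relatively_compact_subset:
  assumes "relatively_compact V K" "L \<subseteq> K"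
  shows "relatively_compact V L"
proof -
  have "vtopology V closure_of L \<subseteq> vtopology V closure_of K"
    using assms(2) by (rule closure_of_mono)
  then show ?thesis
    using assms closed_compactin[of "vtopology V" "vtopology V closure_of K"] closedin_closure_of
    unfolding relatively_compact_def by blast
qed

text \<open>
  This yields the compactness of both \<open>g\<close> and \<open>S\<close>.
\<close>

lemma relatively_compact_diagonal_image:
  assumes Q: "sequence_space Q" and Y: "complex_banach_space Y" and R: "linear_operator Q Y R"
    and C: "\<And>a. a \<in> carrier Q \<Longrightarrow> vnorm Y (R a) \<le> C * vnorm Q a"
    and \<beta>: "\<And>n. \<bar>\<beta> n\<bar> \<le> 1" "\<beta> \<longlonglongrightarrow> 0"
  shows "relatively_compact Y ((\<lambda>a. R (\<lambda>n. complex_of_real (\<beta> n) * a n)) ` {a \<in> carrier Q. vnorm Q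
      a \<le> r})"
proof -
  interpret Q: sequence_space Q by (rule Q)
  interpret Y: complex_banach_space Y by (rule Y)
  interpret R: linear_operator_between Q Y R by standard (rule R)
  let ?D = "\<lambda>a n. complex_of_real (\<beta> n) * a n"
  show ?thesis
  proof (rule Y.relatively_compactI)
    show "(\<lambda>a. R (?D a)) ` {a \<in> carrier Q. vnorm Q a \<le> r} \<subseteq> carrier Y"
      using Q.diagonal_in(1)[OF _ \<beta>(1)] by auto
    fix s :: "nat \<Rightarrow> _" assume "range s \<subseteq> (\<lambda>a. R (?D a)) ` {a \<in> carrier Q. vnorm Q a \<le> r}"
    then have "\<forall>k. \<exists>a. a \<in> carrier Q \<and> vnorm Q a \<le> r \<and> s k = R (?D a)"
      by blast
    then obtain a where a: "\<And>k. a k \<in> carrier Q" "\<And>k. vnorm Q (a k) \<le> r" "\<And>k. s k = R (?D (a k))"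
      by metis
    obtain t :: "nat \<Rightarrow> nat" where t: "strict_mono t"
      "\<And>\<epsilon>. \<epsilon> > 0 \<Longrightarrow> \<exists>N. \<forall>k\<ge>N. \<forall>l\<ge>N. vnorm Q (\<lambda>n. complex_of_real (\<beta> n) * (a (t k) n - a (t l) n)) <
          \<epsilon>"
      by (rule Q.diagonal_compact[where a = a and C = r and \<beta> = \<beta>, OF a(1,2) \<beta>]) blast
    have Da: "?D (a k) \<in> carrier Q" for k
      by (rule Q.diagonal_in(1)[OF a(1) \<beta>(1)])
    have le: "vnorm Y (s k \<ominus>\<^bsub>Y\<^esub> s l) \<le> \<bar>C\<bar> * vnorm Q (\<lambda>n. complex_of_real (\<beta> n) * (a k n - a l n))"
        for k l
    proof -
      have eq: "?D (a k) \<ominus>\<^bsub>Q\<^esub> ?D (a l) = (\<lambda>n. complex_of_real (\<beta> n) * (a k n - a l n))"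
        using Da by (simp add: Q.minus_eq algebra_simps)
      have "s k \<ominus>\<^bsub>Y\<^esub> s l = R (?D (a k) \<ominus>\<^bsub>Q\<^esub> ?D (a l))"
        using Da by (simp add: a(3) R.minus)
      then have "vnorm Y (s k \<ominus>\<^bsub>Y\<^esub> s l) \<le> C * vnorm Q (?D (a k) \<ominus>\<^bsub>Q\<^esub> ?D (a l))"
        using Da by (simp add: C)
      also have "\<dots> \<le> \<bar>C\<bar> * vnorm Q (?D (a k) \<ominus>\<^bsub>Q\<^esub> ?D (a l))"
        using Da by (intro mult_right_mono Q.vnorm_nonneg) auto
      finally show ?thesis
        by (simp add: eq)
    qed
    have "\<exists>N. \<forall>m\<ge>N. \<forall>n\<ge>N. vnorm Y (s (t m) \<ominus>\<^bsub>Y\<^esub> s (t n)) < \<epsilon>" if \<epsilon>: "\<epsilon> > 0" for \<epsilon>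
    proof -
      obtain N where N: "\<And>k l. k \<ge> N \<Longrightarrow> l \<ge> N \<Longrightarrow>
          vnorm Q (\<lambda>n. complex_of_real (\<beta> n) * (a (t k) n - a (t l) n)) < \<epsilon> / (\<bar>C\<bar> + 1)"
        using t(2)[of "\<epsilon> / (\<bar>C\<bar> + 1)"] \<epsilon> by (auto simp: add_nonneg_pos)
      have "vnorm Y (s (t m) \<ominus>\<^bsub>Y\<^esub> s (t n)) < \<epsilon>" if "m \<ge> N" "n \<ge> N" for m n
      proof -
        let ?v = "vnorm Q (\<lambda>i. complex_of_real (\<beta> i) * (a (t m) i - a (t n) i))"
        have "?v \<ge> 0"
          by (intro Q.vnorm_nonneg Q.diagonal_in(1) Q.diff_in a(1) \<beta>(1))
        then have "\<bar>C\<bar> * ?v \<le> (\<bar>C\<bar> + 1) * ?v"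
          by (intro mult_right_mono) auto
        also have "\<dots> < \<epsilon>"
          using N[OF that] by (simp add: field_simps add_nonneg_pos)
        finally show ?thesis
          using le[of "t m" "t n"] by simp
      qed
      then show ?thesis
        by blast
    qed
    then show "\<exists>r :: nat \<Rightarrow> nat. strict_mono r \<and> (\<forall>\<epsilon>>0. \<exists>N. \<forall>m\<ge>N. \<forall>n\<ge>N. vnorm Y (s (r m) \<ominus>\<^bsub>Y\<^esub> s (r
        n)) < \<epsilon>)"
      using t(1) by blast
  qed
qed

lemma (in complex_normed_space) absolutely_convex_closure:
  assumes K: "absolutely_convex K"
  shows "absolutely_convex (vtopology V closure_of K)"
  unfolding absolutely_convex_def
proof (intro conjI ballI allI impI)
  have KV: "K \<subseteq> carrier V"
    using K by (simp add: absolutely_convex_def)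
  show "vtopology V closure_of K \<subseteq> carrier V"
    using closure_of_subset_topspace by fastforce
  show "vtopology V closure_of K \<noteq> {}"
    using K closure_of_subset[of K "vtopology V"] KV by (auto simp: absolutely_convex_def)
  fix x y and a b :: complex
  assume x: "x \<in> vtopology V closure_of K" and y: "y \<in> vtopology V closure_of K"
      and ab: "cmod a + cmod b \<le> 1"
  obtain s where s: "range s \<subseteq> K" "limitin (vtopology V) s x sequentially"
    using x unfolding closure_of_sequentially by blast
  obtain t where t: "range t \<subseteq> K" "limitin (vtopology V) t y sequentially"
    using y unfolding closure_of_sequentially by blast
  have st: "range s \<subseteq> carrier V" "range t \<subseteq> carrier V" "\<And>n. s n \<in> K" "\<And>n. t n \<in> K"
    using s t KV by auto
  have stV: "s n \<in> carrier V" "t n \<in> carrier V" for n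
    using st KV by auto
  have lim: "limitin (vtopology V) (\<lambda>n. a \<odot> s n \<oplus> b \<odot> t n) (a \<odot> x \<oplus> b \<odot> y) sequentially"
    using stV by (intro limitin_add limitin_smult s t) auto
  have in_K: "a \<odot> s n \<oplus> b \<odot> t n \<in> K" for n
    using absolutely_convexD(2)[OF K] st(3,4) ab by blast
  then have "range (\<lambda>n. a \<odot> s n \<oplus> b \<odot> t n) \<subseteq> K \<inter> carrier V"
    using KV by blast
  moreover have "a \<odot> x \<oplus> b \<odot> y \<in> carrier V"
    using limitin_topspace[OF lim] by simp
  ultimately show "a \<odot> x \<oplus> b \<odot> y \<in> vtopology V closure_of K"
    unfolding closure_of_sequentially using lim by blast
qed

lemma absolutely_convex_image:
  assumes X: "complex_normed_space X" and Y: "complex_normed_space Y" and J: "linear_operator X Y J"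
    and K: "complex_normed_space.absolutely_convex X K"
  shows "complex_normed_space.absolutely_convex Y (J ` K)"
proof -
  interpret X: complex_normed_space X by (rule X)
  interpret Y: complex_normed_space Y by (rule Y)
  interpret J: linear_operator_between X Y J by standard (rule J)
  have KX: "k \<in> carrier X" if "k \<in> K" for k
    using K that by (rule X.absolutely_convexD)
  have "a \<odot>\<^bsub>Y\<^esub> J x \<oplus>\<^bsub>Y\<^esub> b \<odot>\<^bsub>Y\<^esub> J y \<in> J ` K" if "x \<in> K" "y \<in> K" "cmod a + cmod b \<le> 1" for x y a b
  proof -
    have "a \<odot>\<^bsub>Y\<^esub> J x \<oplus>\<^bsub>Y\<^esub> b \<odot>\<^bsub>Y\<^esub> J y = J (a \<odot>\<^bsub>X\<^esub> x \<oplus>\<^bsub>X\<^esub> b \<odot>\<^bsub>X\<^esub> y)"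
      using KX that by (simp add: J.add J.smult)
    then show ?thesis
      using X.absolutely_convexD(2)[OF K that] by simp
  qed
  then show ?thesis
    unfolding Y.absolutely_convex_def using KX X.absolutely_convexD(4)[OF K] by auto
qed

text \<open>
  The closure of \<open>K\<close> is compact, so its image under \<open>J\<close> is closed, as the general lifting lemma requires.
  The set \<open>K\<close> itself need not be closed: the image of the unit ball of \<open>c\<^sub>0\<close> under multiplication by
  a null sequence without zeros is not.
\<close>

lemma holomorphic_lift_compact:
  assumes E: "complex_normed_space E" and X: "complex_normed_space X"
      and F: "complex_normed_space F"
    and U: "openin (vtopology E) U" and f: "holomorphic_map E U F f"
    and J: "linear_operator X F J" and inj: "inj_on J (carrier X)"
    and C: "\<And>v. v \<in> carrier X \<Longrightarrow> vnorm F (J v) \<le> C * vnorm X v"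
    and K: "K \<subseteq> unit_ball X" "relatively_compact X K" "complex_normed_space.absolutely_convex X K"
    and g: "\<And>u. u \<in> U \<Longrightarrow> g u \<in> K \<and> J (g u) = f u"
  shows "g \<in> H_inf_K E U X" and "sup_norm U X g \<le> 1"
proof -
  interpret X: complex_normed_space X by (rule X)
  interpret F: complex_normed_space F by (rule F)
  interpret J: linear_operator_between X F J by standard (rule J)
  let ?K = "vtopology X closure_of K"
  have KX: "K \<subseteq> carrier X"
    using K(1) by (auto simp: unit_ball_def)
  then have sub: "K \<subseteq> ?K"
    by (intro closure_of_subset) simp
  have gK: "g u \<in> K" "vnorm X (g u) \<le> 1" "g u \<in> carrier X" if "u \<in> U" for u
    using g[OF that] K(1) by (auto simp: unit_ball_def)
  have "holomorphic_map E U X g"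
  proof (rule holomorphic_lift[OF E X F U f J inj])
    show "?K \<subseteq> unit_ball X"
    proof
      fix x assume "x \<in> ?K"
      then obtain s where x: "x \<in> carrier X"
          and s: "range s \<subseteq> K \<inter> carrier X" "limitin (vtopology X) s x sequentially"
        unfolding X.closure_of_sequentially by blast
      have "(\<lambda>n. vnorm X (s n)) \<longlonglongrightarrow> vnorm X x"
        using s by (intro X.limitin_vnorm) auto
      moreover have "vnorm X (s n) \<le> 1" for n
        using s K(1) by (auto simp: unit_ball_def)
      ultimately have "vnorm X x \<le> 1"
        by (intro LIMSEQ_le_const2) auto
      then show "x \<in> unit_ball X"
        using x by (simp add: unit_ball_def)
    qed
    have "compactin (vtopology F) (J ` ?K)"
      using K(2) J.continuous[OF C] by (auto simp: relatively_compact_def intro: image_compactin)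
    then show "closedin (vtopology F) (J ` ?K)"
      using Metric_space.Hausdorff_space_mtopology[OF F.Metric_space_vdist] compactin_imp_closedin
      unfolding vtopology_def by blast
    show "F.absolutely_convex (J ` ?K)"
      by (rule absolutely_convex_image[OF X F J X.absolutely_convex_closure[OF K(3)]])
    show "f ` U \<subseteq> J ` ?K"
    proof
      fix y assume "y \<in> f ` U"
      then obtain u where "u \<in> U" "y = f u"
        by blast
      then have "g u \<in> ?K" "y = J (g u)"
        using g[of u] sub by auto
      then show "y \<in> J ` ?K"
        by blast
    qed
    show "g u \<in> carrier X \<and> J (g u) = f u" if "u \<in> U" for u
      using g[OF that] gK[OF that] by simp
  qed
  moreover have "relatively_compact X (g ` U)"
    by (rule X.relatively_compact_subset[OF K(2)]) (use gK(1) in auto)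
  moreover have "bdd_above ((\<lambda>x. vnorm X (g x)) ` U)"
    using gK(2) by (intro bdd_aboveI2)
  ultimately show "g \<in> H_inf_K E U X"
    by (simp add: H_inf_K_def H_inf_def)
  show "sup_norm U X g \<le> 1"
    unfolding sup_norm_def using gK(2) by (intro cSup_least) auto
qed

section \<open>Construction of a factorization\<close>

text \<open>
  The null sequence is split off twice because it has to make two different factors of the
  factorization compact; the remaining \<open>\<tau>\<close> carries the \<open>p\<close>-compactness.
\<close>

lemma lp_null_factor:
  fixes \<sigma> :: "nat \<Rightarrow> real"
  assumes p: "p \<ge> 1" and \<sigma>: "\<And>n. \<sigma> n \<ge> 0" "summable (\<lambda>n. \<sigma> n powr p)" and \<epsilon>: "\<epsilon> > 0"
  obtains \<beta> \<tau> where "\<And>n. 0 < \<beta> n" "\<And>n. \<beta> n \<le> 1" "\<beta> \<longlonglongrightarrow> 0" "\<And>n. \<tau> n \<ge> 0"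
    "summable (\<lambda>n. \<tau> n powr p)"
    "(\<Sum>n. \<tau> n powr p) powr (1 / p) \<le> (\<Sum>n. \<sigma> n powr p) powr (1 / p) + \<epsilon>"
    "\<And>n. \<sigma> n = \<beta> n * (\<beta> n * \<tau> n)"
proof -
  define S where "S = (\<Sum>n. \<sigma> n powr p)"
  define r where "r = S powr (1 / p)"
  have S: "S \<ge> 0"
    unfolding S_def using \<sigma> by (intro suminf_nonneg) auto
  have r: "r \<ge> 0" "r powr p = S"
    using S p by (simp_all add: r_def powr_powr)
  \<comment> \<open>The cost is allotted to the sum of the \<open>p\<close>-th powers, where it can be controlled.\<close>
  have "r powr p < (r + \<epsilon>) powr p"
    using r \<epsilon> p by (intro powr_less_mono2) auto
  then have pos: "(r + \<epsilon>) powr p - S > 0"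
    using r by simp
  obtain d where d: "\<And>n. 0 < d n" "\<And>n. d n \<le> 1" "d \<longlonglongrightarrow> 0"
    and sum: "summable (\<lambda>n. \<sigma> n powr p / d n)"
      "(\<Sum>n. \<sigma> n powr p / d n) \<le> (\<Sum>n. \<sigma> n powr p) + ((r + \<epsilon>) powr p - S)"
    by (rule summable_null_multiplier[OF _ \<sigma>(2) pos]) auto
  define \<beta> where "\<beta> = (\<lambda>n. d n powr (1 / (2 * p)))"
  define \<tau> where "\<tau> = (\<lambda>n. \<sigma> n / (\<beta> n * \<beta> n))"
  have \<beta>pos: "0 < \<beta> n" for n
    using d(1)[of n] by (simp add: \<beta>_def)
  have \<beta>\<beta>: "\<beta> n * \<beta> n = d n powr (1 / p)" for n
    using p by (simp add: \<beta>_def flip: powr_add)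
  have \<tau>: "\<tau> n powr p = \<sigma> n powr p / d n" for n
    using \<sigma>(1)[of n] d(1)[of n] p by (simp add: \<tau>_def \<beta>\<beta> powr_divide powr_powr)
  have \<tau>0: "\<tau> n \<ge> 0" for n
    using \<sigma>(1)[of n] \<beta>pos[of n] by (simp add: \<tau>_def)
  show thesis
  proof (rule that)
    show "\<beta> n \<le> 1" for n
      using powr_mono2[of "1 / (2 * p)" "d n" 1] d(1)[of n] d(2)[of n] p
          by (simp add: \<beta>_def less_imp_le)
    show "\<beta> \<longlonglongrightarrow> 0"
      unfolding \<beta>_def using d(1) p
      by (intro tendsto_zero_powrI[OF d(3) tendsto_const]) (auto intro!: always_eventually
          less_imp_le)
    show "summable (\<lambda>n. \<tau> n powr p)"
      using sum(1) by (simp add: \<tau>)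
    show "(\<Sum>n. \<tau> n powr p) powr (1 / p) \<le> (\<Sum>n. \<sigma> n powr p) powr (1 / p) + \<epsilon>"
      unfolding S_def[symmetric] r_def[symmetric]
      using p r(1) \<epsilon> \<tau>0 sum by (subst vnorm_lp_le_iff) (simp_all add: \<tau> S_def)
    show "\<sigma> n = \<beta> n * (\<beta> n * \<tau> n)" for n
      using \<beta>pos[of n] by (simp add: \<tau>_def)
  qed (fact \<beta>pos \<tau>0)+
qed

text \<open>
  The vectors \<open>\<tau> n\<close> times the images of the unit vectors of \<open>\<ell>\<^sub>1\<close> would do if the unit ball of \<open>conj_space p\<close>
  were mapped onto that of the quotient. Norms need not be attained by representatives in
  \<open>c\<^sub>0\<close>, hence the factor \<open>1 + \<eta>\<close>.
\<close>

lemma p_compact_multiplication: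
  assumes p: "p \<ge> 1" and \<tau>: "\<And>n. \<tau> n \<ge> 0" "summable (\<lambda>n. \<tau> n powr p)"
    and X: "quotient_map (conj_space p) X \<pi>" and G: "complex_normed_space G"
    and R: "linear_operator (scalar_lp 1) G R"
      "\<And>b. b \<in> carrier (scalar_lp 1) \<Longrightarrow> vnorm G (R b) \<le> vnorm (scalar_lp 1) b"
    and T: "\<And>a. a \<in> carrier (conj_space p) \<Longrightarrow> T (\<pi> a) = R (\<lambda>n. complex_of_real (\<tau> n) * a n)"
    and \<eta>: "\<eta> > 0"
  shows "\<exists>\<xi> \<in> carrier (lp_space p G). T ` unit_ball X \<subseteq> p_conv p G \<xi> \<and>
    vnorm (lp_space p G) \<xi> \<le> (1 + \<eta>) * (\<Sum>n. \<tau> n powr p) powr (1 / p)"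
proof -
  interpret Q: sequence_space "conj_space p"
    using p by (rule sequence_space_conj_space)
  interpret L: sequence_space "scalar_lp 1"
    by (rule sequence_space_lp) simp
  interpret X: quotient_map "conj_space p" X \<pi> by (rule X)
  interpret G: complex_normed_space G by (rule G)
  interpret R: linear_operator_between "scalar_lp 1" G R by standard (rule R)
  define e :: "nat \<Rightarrow> nat \<Rightarrow> complex" where "e = (\<lambda>n k. if k = n then 1 else 0)"
  have e: "e n \<in> carrier (scalar_lp 1)" "vnorm (scalar_lp 1) (e n) = 1" for n
  proof -
    have "(\<lambda>k. cmod (e n k)) sums 1"
      using sums_single[of n "\<lambda>_. 1 :: real"] by (simp add: e_def if_distrib[of cmod] cong: if_cong)
    then show "e n \<in> carrier (scalar_lp 1)" "vnorm (scalar_lp 1) (e n) = 1"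
      by (simp_all add: l1_simps sums_iff)
  qed
  define \<xi> where "\<xi> = (\<lambda>n. complex_of_real ((1 + \<eta>) * \<tau> n) \<odot>\<^bsub>G\<^esub> R (e n))"
  have \<xi>G: "\<xi> n \<in> carrier G" for n
    using e by (simp add: \<xi>_def)
  have "vnorm G (\<xi> n) \<le> (1 + \<eta>) * \<tau> n" for n
  proof -
    have "vnorm G (\<xi> n) = ((1 + \<eta>) * \<tau> n) * vnorm G (R (e n))"
      using e(1)[of n] \<tau>(1)[of n] \<eta> unfolding \<xi>_def
      by (subst G.vnorm_smult) (simp_all del: of_real_mult of_real_add)
    also have "\<dots> \<le> ((1 + \<eta>) * \<tau> n) * 1"
      using R(2)[OF e(1), of n] e(2)[of n] \<tau>(1)[of n] \<eta> by (intro mult_left_mono) auto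
    finally show ?thesis
      by simp
  qed
  then have "\<xi> \<in> carrier (lp_space p G)"
    "vnorm (lp_space p G) \<xi> \<le> (1 + \<eta>) * (\<Sum>n. \<tau> n powr p) powr (1 / p)"
    using lp_space_dominated[OF p _ \<tau>(2) \<tau>(1) G \<xi>G, of "1 + \<eta>"] \<eta> by simp_all
  moreover have "T ` unit_ball X \<subseteq> p_conv p G \<xi>"
  proof
    fix y assume "y \<in> T ` unit_ball X"
    then obtain A where A: "A \<in> carrier X" "vnorm X A \<le> 1" and y: "y = T A"
      by (auto simp: unit_ball_def)
    obtain a where a: "a \<in> carrier (conj_space p)" "\<pi> a = A" "vnorm (conj_space p) a < 1 + \<eta>"
      using X.lift[OF A(1), of "1 + \<eta>"] A(2) \<eta> by auto
    define b where "b = (\<lambda>n. complex_of_real (1 / (1 + \<eta>)) * a n)"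
    have "vnorm (conj_space p) b = 1 / (1 + \<eta>) * vnorm (conj_space p) a"
      unfolding b_def Q.vnorm_scale[OF a(1)] norm_of_real using \<eta> by simp
    also have "\<dots> \<le> 1"
      using a(3) \<eta> by (simp add: field_simps)
    finally have "vnorm (conj_space p) b \<le> 1" .
    moreover have "b \<in> carrier (conj_space p)"
      unfolding b_def by (rule Q.smult_in'[OF a(1)])
    ultimately have b: "b \<in> unit_ball (conj_space p)"
      by (simp add: unit_ball_def)
    let ?\<tau>a = "\<lambda>n. complex_of_real (\<tau> n) * a n"
    have \<tau>a: "?\<tau>a \<in> carrier (scalar_lp 1)"
      using linear_operatorD(1)[OF multiplication_into_l1(1)[OF p \<tau>] a(1)] .
    have partial: "R (\<lambda>k. if k < N then ?\<tau>a k else 0) = finsum G (\<lambda>n. b n \<odot>\<^bsub>G\<^esub> \<xi> n) {..<N}" for N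
    proof (induction N)
      case 0
      then show ?case
        using R.zero by (simp add: L.ops)
    next
      case (Suc N)
      have "(\<lambda>k. if k < Suc N then ?\<tau>a k else 0) =
          (\<lambda>k. ?\<tau>a N * e N k + (if k < N then ?\<tau>a k else 0))"
        by (intro ext) (auto simp: e_def less_Suc_eq)
      then have "R (\<lambda>k. if k < Suc N then ?\<tau>a k else 0) = ?\<tau>a N \<odot>\<^bsub>G\<^esub> R (e N) \<oplus>\<^bsub>G\<^esub> R (\<lambda>k.
          if k < N then ?\<tau>a k else 0)"
        using R.add[OF L.smult_in'[OF e(1), of "?\<tau>a N" N] L.finite_in[of N ?\<tau>a]] R.smult[OF e(1),
            of "?\<tau>a N" N]
        by (simp add: L.ops)
      also have "?\<tau>a N \<odot>\<^bsub>G\<^esub> R (e N) = b N \<odot>\<^bsub>G\<^esub> \<xi> N"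
      proof -
        have "b N * complex_of_real ((1 + \<eta>) * \<tau> N) =
            (complex_of_real (1 / (1 + \<eta>)) * complex_of_real (1 + \<eta>)) * ?\<tau>a N"
          by (simp add: b_def mult_ac del: of_real_divide of_real_add)
        also have "complex_of_real (1 / (1 + \<eta>)) * complex_of_real (1 + \<eta>) = 1"
          using \<eta> by (simp del: of_real_divide of_real_add flip: of_real_mult)
        finally show ?thesis
          using e(1)[of N] by (simp add: \<xi>_def G.smult_smult del: of_real_mult of_real_add)
      qed
      finally show ?case
        using Suc \<xi>G by (simp add: lessThan_Suc G.M.finsum_insert)
    qed
    have "limitin (vtopology G) (\<lambda>N. R (\<lambda>k. if k < N then ?\<tau>a k else 0)) (R ?\<tau>a) sequentially"
      using L.limitin_truncation[OF \<tau>a] L.finite_in R(2) by (intro R.limitin_image[of 1]) auto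
    moreover have "R ?\<tau>a = y"
      using T[OF a(1)] a(2) y by simp
    ultimately show "y \<in> p_conv p G \<xi>"
      using b by (auto simp: p_conv_def partial)
  qed
  ultimately show ?thesis
    by blast
qed

text \<open>
  With \<open>\<Psi>\<close> the synthesis operator of the normalized vectors \<open>e n\<close> and \<open>D\<close>, \<open>A\<close> the multiplications by \<open>\<beta>\<close>
  and \<open>\<tau>\<close>, every value of \<open>f\<close> has the form \<open>\<Psi> (D (A (D a)))\<close> with \<open>a\<close> in the unit ball of \<open>conj_space p\<close>.
  The inner \<open>D\<close> goes into \<open>g\<close>, \<open>A\<close> into \<open>T\<close>, and the outer \<open>\<Psi> \<circ> D\<close> into \<open>S\<close>. Since \<open>a\<close> is not determined by
  the value of \<open>f\<close>, the kernels of \<open>\<Psi> \<circ> D \<circ> A\<close> and of \<open>\<Psi> \<circ> D\<close> are divided out.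
\<close>

lemma exists_factorization:
  fixes E :: "'e cnspace" and F :: "'f cnspace"
  assumes p: "p \<ge> 1" and E: "complex_normed_space E" and F: "complex_banach_space F"
    and U: "openin (vtopology E) U" and f: "f \<in> H_inf E U F"
    and large: "(UNIV :: real set) \<lesssim> (UNIV :: 'g set)"
    and x: "x \<in> carrier (lp_space p F)" "f ` U \<subseteq> p_conv p F x" and \<epsilon>: "\<epsilon> > 0"
  shows "\<exists>M (G :: 'g cnspace) T g S. p_compact_factorization p E U F f M G T g S \<and>
    operator_norm G F S \<le> 1 \<and>
    k_p p (quotient_space (conj_space p) M) G T \<le> (1 + \<epsilon>) * (vnorm (lp_space p F) x + \<epsilon>) \<and>
    sup_norm U (quotient_space (conj_space p) M) g \<le> 1"
proof -
  let ?Q = "conj_space p" and ?L = "scalar_lp 1"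
  interpret F: complex_banach_space F by (rule F)
  interpret Q: sequence_space ?Q
    using p by (rule sequence_space_conj_space)
  interpret L: sequence_space ?L
    by (rule sequence_space_lp) simp
  have Fn: "complex_normed_space F"
    by (rule F.complex_normed_space_axioms)
  have xF: "x n \<in> carrier F" and xs: "summable (\<lambda>n. vnorm F (x n) powr p)" for n
    using x(1) by (auto simp: lp_space_simps)
  obtain \<beta> \<tau> where \<beta>: "\<And>n. 0 < \<beta> n" "\<And>n. \<beta> n \<le> 1" "\<beta> \<longlonglongrightarrow> 0"
    and \<tau>: "\<And>n. \<tau> n \<ge> 0" "summable (\<lambda>n. \<tau> n powr p)"
    and \<tau>_le: "(\<Sum>n. \<tau> n powr p) powr (1 / p) \<le> (\<Sum>n. vnorm F (x n) powr p) powr (1 / p) + \<epsilon>"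
    and \<sigma>: "\<And>n. vnorm F (x n) = \<beta> n * (\<beta> n * \<tau> n)"
    by (rule lp_null_factor[OF p F.vnorm_nonneg[OF xF] xs \<epsilon>]) blast
  have \<beta>_abs: "\<bar>\<beta> n\<bar> \<le> 1" for n
    using \<beta>(1,2)[of n] by simp
  define D where "D = (\<lambda>(a :: nat \<Rightarrow> complex) n. complex_of_real (\<beta> n) * a n)"
  define A where "A = (\<lambda>(a :: nat \<Rightarrow> complex) n. complex_of_real (\<tau> n) * a n)"
  have DQ: "D a \<in> carrier ?Q" "vnorm ?Q (D a) \<le> vnorm ?Q a" if "a \<in> carrier ?Q" for a
    unfolding D_def using Q.diagonal_in[OF that \<beta>_abs] by auto
  have DL: "D a \<in> carrier ?L" "vnorm ?L (D a) \<le> vnorm ?L a" if "a \<in> carrier ?L" for a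
    unfolding D_def using L.diagonal_in[OF that \<beta>_abs] by auto
  have A: "linear_operator ?Q ?L A"
    unfolding A_def by (rule multiplication_into_l1[OF p \<tau>])
  obtain C where C: "\<And>a. a \<in> carrier ?Q \<Longrightarrow> vnorm ?L (A a) \<le> C * vnorm ?Q a"
    using multiplication_into_l1(2)[OF p \<tau>] unfolding A_def by blast
  \<comment> \<open>As \<open>inverse 0 = 0\<close>, this gives \<open>e n = 0\<close> where \<open>x n = 0\<close>.\<close>
  define e where "e = (\<lambda>n. complex_of_real (inverse (vnorm F (x n))) \<odot>\<^bsub>F\<^esub> x n)"
  have e: "e n \<in> carrier F" "vnorm F (e n) \<le> 1" for n
  proof -
    show "e n \<in> carrier F"
      using xF by (simp add: e_def)
    have "vnorm F (e n) = \<bar>inverse (vnorm F (x n))\<bar> * vnorm F (x n)"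
      unfolding e_def F.vnorm_smult[OF xF] norm_of_real ..
    also have "\<dots> \<le> 1"
      using F.vnorm_nonneg[OF xF, of n] by (cases "vnorm F (x n) = 0") auto
    finally show "vnorm F (e n) \<le> 1" .
  qed
  have xe: "x n = complex_of_real (vnorm F (x n)) \<odot>\<^bsub>F\<^esub> e n" for n
  proof (cases "vnorm F (x n) = 0")
    case True
    then show ?thesis
      using F.vnorm_zero_iff[OF xF] e(1)[of n] by (simp add: F.vnorm_zero)
  next
    case False
    then show ?thesis
      using xF[of n] by (simp add: e_def F.smult_smult flip: of_real_mult del: of_real_inverse)
  qed
  obtain \<Psi> where \<Psi>: "linear_operator ?L F \<Psi>"
    "\<And>b. b \<in> carrier ?L \<Longrightarrow> vnorm F (\<Psi> b) \<le> vnorm ?L b"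
    "\<And>b. b \<in> carrier ?L \<Longrightarrow>
      limitin (vtopology F) (\<lambda>N. finsum F (\<lambda>n. b n \<odot>\<^bsub>F\<^esub> e n) {..<N}) (\<Psi> b) sequentially"
    by (rule l1_synthesis[where e = e, OF F e]) blast
  define \<Phi> where "\<Phi> = (\<lambda>b. \<Psi> (D b))"
  define \<Theta> where "\<Theta> = (\<lambda>a. \<Phi> (A a))"
  have Dlin: "linear_operator ?L ?L D"
    by (rule linear_operatorI)
      (use DL in \<open>auto simp: L.ops D_def distrib_left mult.left_commute\<close>)
  have \<Phi>lin: "linear_operator ?L F \<Phi>"
    unfolding \<Phi>_def by (rule linear_operator_compose[OF Dlin \<Psi>(1)])
  have \<Phi>le: "vnorm F (\<Phi> b) \<le> vnorm ?L b" if "b \<in> carrier ?L" for b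
    unfolding \<Phi>_def using \<Psi>(2)[OF DL(1)[OF that]] DL(2)[OF that] by simp
  have \<Theta>lin: "linear_operator ?Q F \<Theta>"
    unfolding \<Theta>_def by (rule linear_operator_compose[OF A \<Phi>lin])
  have \<Theta>le: "vnorm F (\<Theta> a) \<le> C * vnorm ?Q a" if "a \<in> carrier ?Q" for a
    unfolding \<Theta>_def using \<Phi>le[OF linear_operatorD(1)[OF A that]] C[OF that] by simp
  interpret \<Theta>: linear_operator_between ?Q F \<Theta> by standard (rule \<Theta>lin)
  interpret \<Phi>: linear_operator_between ?L F \<Phi> by standard (rule \<Phi>lin)
  define M where "M = {a \<in> carrier ?Q. \<Theta> a = \<zero>\<^bsub>F\<^esub>}"
  let ?X = "quotient_space ?Q M"
  define \<pi> where "\<pi> = (\<lambda>a. M +>\<^bsub>?Q\<^esub> a)"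
  have M: "closed_subspace M ?Q"
    unfolding M_def by (rule \<Theta>.closed_subspace_kernel[OF \<Theta>le])
  interpret X: quotient_map ?Q ?X \<pi>
    unfolding \<pi>_def by (rule quotient_space_quotient_map[OF Q.complex_banach_space M])
  have X_ker: "\<pi> a = \<zero>\<^bsub>?X\<^esub> \<longleftrightarrow> \<Theta> a = \<zero>\<^bsub>F\<^esub>" if "a \<in> carrier ?Q" for a
    using quotient_space_quotient_map(2)[OF Q.complex_banach_space M that] that
    unfolding \<pi>_def M_def by simp
  \<comment> \<open>The cosets of the kernel of \<open>\<Phi>\<close> correspond to the points of its range, so an injection of the
    range into the given type provides the points of \<open>G\<close>.\<close>
  have "\<Phi> ` carrier ?L \<lesssim> (UNIV :: 'g set)"
    using image_lepoll[of \<Phi> "carrier ?L"] subset_imp_lepoll[of "carrier ?L" UNIV]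
      nat_complex_lepoll_reals large by (meson lepoll_trans subset_UNIV)
  then obtain j :: "'f \<Rightarrow> 'g" where j: "inj_on j (\<Phi> ` carrier ?L)"
    unfolding lepoll_def by blast
  define \<rho> where "\<rho> = (\<lambda>b. j (\<Phi> b))"
  have \<rho>: "\<rho> a = \<rho> b \<longleftrightarrow> \<Phi> a = \<Phi> b" if "a \<in> carrier ?L" "b \<in> carrier ?L" for a b
    using inj_on_eq_iff[OF j, of "\<Phi> a" "\<Phi> b"] that by (simp add: \<rho>_def)
  define G where "G = quotient_along ?L \<rho>"
  have \<Phi>le': "vnorm F (\<Phi> b) \<le> 1 * vnorm ?L b" if "b \<in> carrier ?L" for b
    using \<Phi>le[OF that] by simp
  interpret G: quotient_map ?L G \<rho>
    unfolding G_def by (rule quotient_along_quotient_map(1)[OF L.complex_banach_space Fn \<Phi>lin \<Phi>le'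
        \<rho>])
  have G_ker: "\<rho> b = \<zero>\<^bsub>G\<^esub> \<longleftrightarrow> \<Phi> b = \<zero>\<^bsub>F\<^esub>" if "b \<in> carrier ?L" for b
    unfolding G_def by (rule quotient_along_quotient_map(2)[OF L.complex_banach_space Fn \<Phi>lin \<Phi>le'
        \<rho> that])
  obtain S where S: "linear_operator G F S" "\<And>b. b \<in> carrier ?L \<Longrightarrow> S (\<rho> b) = \<Phi> b"
    by (rule G.induced_operator[OF Fn \<Phi>lin]) (auto simp: G_ker)
  obtain J where J: "linear_operator ?X F J" "\<And>a. a \<in> carrier ?Q \<Longrightarrow> J (\<pi> a) = \<Theta> a"
    by (rule X.induced_operator[OF Fn \<Theta>lin]) (auto simp: X_ker)
  have AL: "A a \<in> carrier ?L" if "a \<in> carrier ?Q" for a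
    using A that by (rule linear_operatorD)
  have RAlin: "linear_operator ?Q G (\<lambda>a. \<rho> (A a))"
    by (rule linear_operator_compose[OF A G.linear_operator])
  obtain T where T: "linear_operator ?X G T" "\<And>a. a \<in> carrier ?Q \<Longrightarrow> T (\<pi> a) = \<rho> (A a)"
    by (rule X.induced_operator[OF G.complex_normed_space RAlin]) (auto simp: X_ker G_ker AL \<Theta>_def)
  have ST: "S (T v) = J v" if "v \<in> carrier ?X" for v
    using that AL by (auto simp: X.carrier_eq T S J \<Theta>_def)
  interpret J: linear_operator_between ?X F J by standard (rule J)
  have injJ: "inj_on J (carrier ?X)"
  proof (rule inj_onI)
    fix v w assume v: "v \<in> carrier ?X" and w: "w \<in> carrier ?X" and eq: "J v = J w"
    obtain a where a: "a \<in> carrier ?Q" "v \<ominus>\<^bsub>?X\<^esub> w = \<pi> a"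
      using v w X.W.minus_in[OF v w] by (auto simp: X.carrier_eq)
    have "\<Theta> a = J (v \<ominus>\<^bsub>?X\<^esub> w)"
      using a by (simp add: J)
    also have "\<dots> = \<zero>\<^bsub>F\<^esub>"
      using v w eq by (simp add: J.minus)
    finally have "v \<ominus>\<^bsub>?X\<^esub> w = \<zero>\<^bsub>?X\<^esub>"
      using a X_ker by simp
    then show "v = w"
      using v w by (simp add: X.W.minus_eq_zero_iff)
  qed
  have Jle: "vnorm F (J v) \<le> (\<bar>C\<bar> + 1) * vnorm ?X v" if v: "v \<in> carrier ?X" for v
  proof -
    obtain a where a: "a \<in> carrier ?Q" "\<pi> a = v"
      using v by (auto simp: X.carrier_eq)
    have "vnorm F (J v) / (\<bar>C\<bar> + 1) \<le> vnorm ?X (\<pi> a)"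
    proof (rule X.le_vnorm[OF a(1)])
      fix b assume b: "b \<in> carrier ?Q" "\<pi> b = \<pi> a"
      have "vnorm F (J v) \<le> C * vnorm ?Q b"
        using \<Theta>le[OF b(1)] J(2)[OF b(1)] a b by simp
      also have "\<dots> \<le> (\<bar>C\<bar> + 1) * vnorm ?Q b"
        using Q.vnorm_nonneg[OF b(1)] by (intro mult_right_mono) auto
      finally show "vnorm F (J v) / (\<bar>C\<bar> + 1) \<le> vnorm ?Q b"
        by (simp add: field_simps add_nonneg_pos)
    qed
    then show ?thesis
      using a by (simp add: field_simps add_nonneg_pos)
  qed
  define K where "K = (\<lambda>a. \<pi> (D a)) ` unit_ball ?Q"
  have ball: "unit_ball ?Q = {a \<in> carrier ?Q. vnorm ?Q a \<le> 1}"
    by (simp add: unit_ball_def)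
  have K_ball: "K \<subseteq> unit_ball ?X"
  proof
    fix v assume "v \<in> K"
    then obtain a where a: "a \<in> carrier ?Q" "vnorm ?Q a \<le> 1" "v = \<pi> (D a)"
      by (auto simp: K_def ball)
    then show "v \<in> unit_ball ?X"
      using X.vnorm_le[OF DQ(1)] DQ by (fastforce simp: unit_ball_def)
  qed
  have K_compact: "relatively_compact ?X K"
    unfolding K_def D_def ball
    by (rule relatively_compact_diagonal_image[OF Q.sequence_space_axioms X.complex_banach_space
          X.linear_operator _ \<beta>_abs \<beta>(3), where C = 1]) (simp add: X.vnorm_le)
  have K_convex: "X.W.absolutely_convex K"
    unfolding X.W.absolutely_convex_def
  proof (intro conjI ballI allI impI)
    show "K \<subseteq> carrier ?X"
      using K_ball by (auto simp: unit_ball_def)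
    have "\<zero>\<^bsub>?Q\<^esub> \<in> unit_ball ?Q"
      by (simp add: unit_ball_def Q.vnorm_zero)
    then show "K \<noteq> {}"
      by (auto simp: K_def)
    fix v w and c d :: complex assume vw: "v \<in> K" "w \<in> K" and cd: "cmod c + cmod d \<le> 1"
    obtain a b where a: "a \<in> carrier ?Q" "vnorm ?Q a \<le> 1" "v = \<pi> (D a)"
      and b: "b \<in> carrier ?Q" "vnorm ?Q b \<le> 1" "w = \<pi> (D b)"
      using vw by (auto simp: K_def ball)
    let ?y = "c \<odot>\<^bsub>?Q\<^esub> a \<oplus>\<^bsub>?Q\<^esub> d \<odot>\<^bsub>?Q\<^esub> b"
    have "vnorm ?Q ?y \<le> cmod c * vnorm ?Q a + cmod d * vnorm ?Q b"
      using Q.vnorm_triangle[of "c \<odot>\<^bsub>?Q\<^esub> a" "d \<odot>\<^bsub>?Q\<^esub> b"] a b by (simp add: Q.vnorm_smult)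
    also have "\<dots> \<le> cmod c * 1 + cmod d * 1"
      using a b by (intro add_mono mult_left_mono) auto
    finally have "?y \<in> unit_ball ?Q"
      using a b cd by (simp add: unit_ball_def)
    moreover have "D ?y = c \<odot>\<^bsub>?Q\<^esub> D a \<oplus>\<^bsub>?Q\<^esub> d \<odot>\<^bsub>?Q\<^esub> D b"
      by (simp add: Q.ops D_def distrib_left mult.left_commute)
    then have "\<pi> (D ?y) = c \<odot>\<^bsub>?X\<^esub> v \<oplus>\<^bsub>?X\<^esub> d \<odot>\<^bsub>?X\<^esub> w"
      using a b DQ by (simp add: X.add X.smult)
    ultimately show "c \<odot>\<^bsub>?X\<^esub> v \<oplus>\<^bsub>?X\<^esub> d \<odot>\<^bsub>?X\<^esub> w \<in> K"
      unfolding K_def by (metis image_eqI)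
  qed
  have "\<exists>v. v \<in> K \<and> J v = f u" if u: "u \<in> U" for u
  proof -
    have "f u \<in> p_conv p F x"
      using x(2) u by auto
    then obtain a where a: "a \<in> unit_ball ?Q"
      and lim: "limitin (vtopology F) (\<lambda>N. finsum F (\<lambda>n. a n \<odot>\<^bsub>F\<^esub> x n) {..<N}) (f u) sequentially"
      by (auto simp: p_conv_def)
    have aQ: "a \<in> carrier ?Q"
      using a by (simp add: unit_ball_def)
    have "(\<lambda>n. a n \<odot>\<^bsub>F\<^esub> x n) = (\<lambda>n. D (A (D a)) n \<odot>\<^bsub>F\<^esub> e n)"
    proof
      fix n
      have "a n \<odot>\<^bsub>F\<^esub> x n = (a n * complex_of_real (vnorm F (x n))) \<odot>\<^bsub>F\<^esub> e n"
        using e(1)[of n] by (subst xe) (simp add: F.smult_smult)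
      also have "a n * complex_of_real (vnorm F (x n)) = D (A (D a)) n"
        unfolding \<sigma> by (simp add: D_def A_def mult_ac)
      finally show "a n \<odot>\<^bsub>F\<^esub> x n = D (A (D a)) n \<odot>\<^bsub>F\<^esub> e n" .
    qed
    then have "limitin (vtopology F) (\<lambda>N. finsum F (\<lambda>n. D (A (D a)) n \<odot>\<^bsub>F\<^esub> e n) {..<N}) (f u)
        sequentially"
      using lim by simp
    then have "\<Psi> (D (A (D a))) = f u"
      using \<Psi>(3)[OF DL(1)[OF AL[OF DQ(1)[OF aQ]]]] F.limitin_unique by blast
    then have "J (\<pi> (D a)) = f u"
      using J(2)[OF DQ(1)[OF aQ]] by (simp add: \<Theta>_def \<Phi>_def)
    then show ?thesis
      using a by (auto simp: K_def)
  qed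
  then obtain g where g: "\<And>u. u \<in> U \<Longrightarrow> g u \<in> K \<and> J (g u) = f u"
    by metis
  have fh: "holomorphic_map E U F f"
    using f by (simp add: H_inf_def)
  note lift = holomorphic_lift_compact[OF E X.complex_normed_space Fn U fh J(1) injJ Jle K_ball
      K_compact K_convex g]
  have gK: "g u \<in> carrier ?X" if "u \<in> U" for u
    using g[OF that] K_ball by (auto simp: unit_ball_def)
  have Sle: "vnorm F (S v) \<le> vnorm G v" if v: "v \<in> carrier G" for v
  proof -
    obtain b where b: "b \<in> carrier ?L" "v = \<rho> b"
      using v by (auto simp: G.carrier_eq)
    have "vnorm F (S v) \<le> vnorm G (\<rho> b)"
    proof (rule G.le_vnorm[OF b(1)])
      fix c assume c: "c \<in> carrier ?L" "\<rho> c = \<rho> b"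
      have "S v = \<Phi> c"
        using S(2)[OF c(1)] b c by simp
      then show "vnorm F (S v) \<le> vnorm ?L c"
        using \<Phi>le[OF c(1)] by simp
    qed
    then show ?thesis
      using b by simp
  qed
  have S_norm: "operator_norm G F S \<le> 1"
    unfolding operator_norm_def
  proof (rule cSUP_least)
    have "\<zero>\<^bsub>G\<^esub> \<in> unit_ball G"
      by (simp add: unit_ball_def G.W.vnorm_zero)
    then show "unit_ball G \<noteq> {}"
      by blast
    show "vnorm F (S v) \<le> 1" if "v \<in> unit_ball G" for v
      using Sle[of v] that by (auto simp: unit_ball_def)
  qed
  have "S ` unit_ball G \<subseteq> (\<lambda>b. \<Psi> (\<lambda>n. complex_of_real (\<beta> n) * b n)) ` {b \<in> carrier ?L. vnorm ?L b
      \<le> 2}"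
  proof
    fix y assume "y \<in> S ` unit_ball G"
    then obtain v where v: "v \<in> carrier G" "vnorm G v \<le> 1" "y = S v"
      by (auto simp: unit_ball_def)
    obtain b where b: "b \<in> carrier ?L" "\<rho> b = v" "vnorm ?L b < 2"
      using G.lift[OF v(1), of 2] v(2) by auto
    then have "y = \<Psi> (\<lambda>n. complex_of_real (\<beta> n) * b n)"
      using S(2)[OF b(1)] v(3) by (simp add: \<Phi>_def D_def)
    then show "y \<in> (\<lambda>b. \<Psi> (\<lambda>n. complex_of_real (\<beta> n) * b n)) ` {b \<in> carrier ?L. vnorm ?L b \<le> 2}"
      using b by auto
  qed
  moreover have "relatively_compact F ((\<lambda>b. \<Psi> (\<lambda>n. complex_of_real (\<beta> n) * b n)) ` {b \<in> carrier
      ?L. vnorm ?L b \<le> 2})"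
    by (rule relatively_compact_diagonal_image[OF L.sequence_space_axioms F \<Psi>(1) _ \<beta>_abs \<beta>(3),
        where C = 1])
      (simp add: \<Psi>(2))
  ultimately have "relatively_compact F (S ` unit_ball G)"
    using F.relatively_compact_subset by blast
  then have S_compact: "compact_operator G F S"
    using S(1) by (simp add: compact_operator_def)
  have "\<exists>\<xi> \<in> carrier (lp_space p G). T ` unit_ball ?X \<subseteq> p_conv p G \<xi> \<and>
      vnorm (lp_space p G) \<xi> \<le> (1 + \<epsilon>) * (\<Sum>n. \<tau> n powr p) powr (1 / p)"
    by (rule p_compact_multiplication[OF p \<tau> X.quotient_map_axioms G.complex_normed_space
          G.linear_operator G.vnorm_le _ \<epsilon>]) (use T(2) in \<open>simp_all add: A_def\<close>)
  then obtain \<xi> where \<xi>: "\<xi> \<in> carrier (lp_space p G)" "T ` unit_ball ?X \<subseteq> p_conv p G \<xi>"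
    "vnorm (lp_space p G) \<xi> \<le> (1 + \<epsilon>) * (\<Sum>n. \<tau> n powr p) powr (1 / p)"
    by blast
  have T_compact: "p_compact_operator p ?X G T"
    using T(1) \<xi> by (auto simp: p_compact_operator_def relatively_p_compact_def)
  have "k_p p ?X G T \<le> (1 + \<epsilon>) * (\<Sum>n. \<tau> n powr p) powr (1 / p)"
    unfolding k_p_def using m_p_le[OF \<xi>(1,2)] \<xi>(3) by simp
  also have "\<dots> \<le> (1 + \<epsilon>) * (vnorm (lp_space p F) x + \<epsilon>)"
    unfolding lp_space_simps(2) using \<tau>_le \<epsilon> by (intro mult_left_mono) auto
  finally have T_norm: "k_p p ?X G T \<le> (1 + \<epsilon>) * (vnorm (lp_space p F) x + \<epsilon>)" .
  have "continuous_map (vtopology ?L) (vtopology G) \<rho>"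
    by (rule G.\<pi>.continuous[of 1]) (simp add: G.vnorm_le)
  then have "separable_space (vtopology G)"
    by (rule separable_space_continuous_map_image[OF L.separable]) (simp add: G.carrier_eq)
  moreover have "\<forall>u\<in>U. f u = S (T (g u))"
    using ST gK g by simp
  ultimately have "p_compact_factorization p E U F f M G T g S"
    unfolding p_compact_factorization_def
    using M G.complex_banach_space T_compact lift(1) S_compact by blast
  then show ?thesis
    using S_norm T_norm lift(2) by blast
qed

(* A separable Banach space has at most continuum many points, so every such space has an isometric
   copy with carrier in 'g as soon as 'g has at least continuum many elements; G then ranges over
   all separable Banach spaces. *)
theorem corollary1p6:
  fixes E :: "'e cnspace" and F :: "'f cnspace" and U :: "'e set"
    and f :: "'e \<Rightarrow> 'f" and p :: real
  assumes "complex_banach_space E" and "complex_banach_space F"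
    and "openin (vtopology E) U"
    and "1 \<le> p"
    and "f \<in> H_inf E U F"
    and "(UNIV :: real set) \<lesssim> (UNIV :: 'g set)"
  shows
    "(relatively_p_compact p F (f ` U) \<longleftrightarrow>
       (\<exists>M (G :: 'g cnspace) T g S. p_compact_factorization p E U F f M G T g S)) \<and>
     (relatively_p_compact p F (f ` U) \<longrightarrow>
       k_p_H_inf p U F f =
         Inf {operator_norm G F S * k_p p (quotient_space (conj_space p) M) G T *
                sup_norm U (quotient_space (conj_space p) M) g
              | M (G :: 'g cnspace) T g S. p_compact_factorization p E U F f M G T g S})"
proof (intro conjI impI)
  have E: "complex_normed_space E" and F: "complex_normed_space F"
    using assms(1,2) by (simp_all add: complex_banach_space_def)
  note ex = exists_factorization[OF assms(4) E assms(2,3,5,6)]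
  note fact = factorization_imp_relatively_p_compact[OF assms(4) F]
  show "relatively_p_compact p F (f ` U) \<longleftrightarrow>
       (\<exists>M (G :: 'g cnspace) T g S. p_compact_factorization p E U F f M G T g S)"
  proof
    assume "relatively_p_compact p F (f ` U)"
    then obtain x where "x \<in> carrier (lp_space p F)" "f ` U \<subseteq> p_conv p F x"
      by (auto simp: relatively_p_compact_def)
    from ex[OF this zero_less_one]
    show "\<exists>M (G :: 'g cnspace) T g S. p_compact_factorization p E U F f M G T g S"
      by (elim exE conjE) (intro exI)
  qed (use fact(1) in blast)
  assume rel: "relatively_p_compact p F (f ` U)"
  let ?m = "m_p p F (f ` U)"
  let ?P = "{operator_norm G F S * k_p p (quotient_space (conj_space p) M) G T *
                sup_norm U (quotient_space (conj_space p) M) g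
              | M (G :: 'g cnspace) T g S. p_compact_factorization p E U F f M G T g S}"
  have lower: "?m \<le> r" if "r \<in> ?P" for r
    using that fact(2) by blast
  have upper: "\<exists>r\<in>?P. r \<le> (1 + \<epsilon>) * (?m + 2 * \<epsilon>)" if \<epsilon>: "\<epsilon> > 0" for \<epsilon>
  proof -
    obtain x where x: "x \<in> carrier (lp_space p F)" "f ` U \<subseteq> p_conv p F x" "vnorm (lp_space p F) x < ?m + \<epsilon>"
      using m_p_less[OF rel, of "?m + \<epsilon>"] \<epsilon> by auto
    from ex[OF x(1,2) \<epsilon>] obtain M T g S and G :: "'g cnspace"
      where pf: "p_compact_factorization p E U F f M G T g S"
        and le: "operator_norm G F S \<le> 1"
          "k_p p (quotient_space (conj_space p) M) G T \<le> (1 + \<epsilon>) * (vnorm (lp_space p F) x + \<epsilon>)"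
          "sup_norm U (quotient_space (conj_space p) M) g \<le> 1"
      by blast
    let ?s = "operator_norm G F S" and ?k = "k_p p (quotient_space (conj_space p) M) G T"
      and ?c = "sup_norm U (quotient_space (conj_space p) M) g"
    note nonneg = fact(3-5)[OF pf]
    have "?s * ?k * ?c \<le> 1 * ?k * 1"
      using le nonneg by (intro mult_mono) auto
    also have "\<dots> \<le> (1 + \<epsilon>) * (vnorm (lp_space p F) x + \<epsilon>)"
      using le by simp
    also have "\<dots> \<le> (1 + \<epsilon>) * (?m + 2 * \<epsilon>)"
      using x(3) \<epsilon> by (intro mult_left_mono) auto
    finally show ?thesis
      using pf by blast
  qed
  have ne: "?P \<noteq> {}"
    using upper[OF zero_less_one] by blast
  have Inf_le: "Inf ?P \<le> (1 + \<epsilon>) * (?m + 2 * \<epsilon>)" if \<epsilon>: "\<epsilon> > 0" for \<epsilon>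
  proof -
    obtain r where r: "r \<in> ?P" "r \<le> (1 + \<epsilon>) * (?m + 2 * \<epsilon>)"
      using upper[OF \<epsilon>] by blast
    have "Inf ?P \<le> r"
      using lower by (intro cInf_lower r bdd_belowI[where m = ?m])
    then show ?thesis
      using r(2) by simp
  qed
  have "(\<lambda>n. (1 + 1 / (real n + 1)) * (?m + 2 * (1 / (real n + 1)))) \<longlonglongrightarrow> (1 + 0) * (?m + 2 * 0)"
    by (intro tendsto_intros) real_asymp+
  then have "Inf ?P \<le> (1 + 0) * (?m + 2 * 0)"
  proof (rule LIMSEQ_le_const)
    have "Inf ?P \<le> (1 + 1 / (real n + 1)) * (?m + 2 * (1 / (real n + 1)))" for n
      by (rule Inf_le) simp
    then show "\<exists>N. \<forall>n\<ge>N. Inf ?P \<le> (1 + 1 / (real n + 1)) * (?m + 2 * (1 / (real n + 1)))"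
      by blast
  qed
  moreover have "?m \<le> Inf ?P"
    using lower by (intro cInf_greatest[OF ne])
  ultimately show "k_p_H_inf p U F f = Inf ?P"
    by (simp add: k_p_H_inf_def)
qed

end
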